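(* Let $0<p<1$ and let $(\lambda_{ij})_{i,j\in\mathbb N}$ be arbitrary complex scalars. The following are equivalent. (i) The matrix $[\varepsilon_{ij}\lambda_{ij}]$ belongs to $S_p$ for almost all choices of signs $\varepsilon_{ij}=\pm1$. (ii) The matrix $[\varepsilon_{ij}\lambda_{ij}]$ belongs to $S_p$ for all choices of signs $\varepsilon_{ij}=\pm1$. (iii) There is a decomposition $\lambda_{ij}=a_{ij}+b_{ij}$ (with $a_{ij},b_{ij}\in\mathbb C$) such that $$\sum_i\Big(\sum_j|a_{ij}|^2\Big)^{p/2}<\infty\quad\text{and}\quad \sum_j\Big(\sum_i|b_{ij}|^2\Big)^{p/2}<\infty .$$
   Context: $S_p$ is the Schatten $p$-class on $\ell_2(\mathbb N)$. "Almost all choices of signs" means almost surely when $(\varepsilon_{ij})$ are independent random variables with $\mathbb P(\varepsilon_{ij}=\pm1)=1/2$. *)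

theory Defs
  imports "HOL-Probability.Probability"
begin

section \<open>The Hilbert space of square-summable complex sequences\<close>

typedef ell2 = "{x :: nat \<Rightarrow> complex. summable (\<lambda>n. (cmod (x n))\<^sup>2)}"
  morphisms coord Abs_ell2
  by (rule exI[of _ "\<lambda>_. 0"]) simp

setup_lifting type_definition_ell2

lemma summable_coord: "summable (\<lambda>n. (cmod (coord x n))\<^sup>2)"
  using coord[of x] by simp

lemma cmod_add_sq_le: "(cmod (a + b))\<^sup>2 \<le> 2 * (cmod a)\<^sup>2 + 2 * (cmod b)\<^sup>2"
proof -
  have "(cmod (a + b))\<^sup>2 \<le> (cmod a + cmod b)\<^sup>2"
    by (simp add: norm_triangle_ineq power_mono)
  also have "\<dots> \<le> 2 * (cmod a)\<^sup>2 + 2 * (cmod b)\<^sup>2"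
    using sum_squares_bound[of "cmod a" "cmod b"] by (simp add: power2_sum)
  finally show ?thesis .
qed

lemma summable_sq_add:
  assumes "summable (\<lambda>n. (cmod (x n))\<^sup>2)" "summable (\<lambda>n. (cmod (y n))\<^sup>2)"
  shows "summable (\<lambda>n. (cmod (x n + y n))\<^sup>2)"
  by (rule summable_comparison_test'[where N = 0, OF summable_add[OF summable_mult[OF assms(1), of 2]
        summable_mult[OF assms(2), of 2]]])
     (simp add: cmod_add_sq_le)

lemma summable_sq_scale:
  assumes "summable (\<lambda>n. (cmod (x n))\<^sup>2)"
  shows "summable (\<lambda>n. (cmod (c * x n))\<^sup>2)"
  using summable_mult[OF assms, of "(cmod c)\<^sup>2"] by (simp add: norm_mult power_mult_distrib)

instantiation ell2 :: ab_group_add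
begin

lift_definition zero_ell2 :: ell2 is "\<lambda>_. 0" by simp
lift_definition plus_ell2 :: "ell2 \<Rightarrow> ell2 \<Rightarrow> ell2" is "\<lambda>x y n. x n + y n"
  by (rule summable_sq_add)
lift_definition uminus_ell2 :: "ell2 \<Rightarrow> ell2" is "\<lambda>x n. - x n" by simp
lift_definition minus_ell2 :: "ell2 \<Rightarrow> ell2 \<Rightarrow> ell2" is "\<lambda>x y n. x n - y n"
  using summable_sq_add[of _ "\<lambda>n. - y n" for y] by simp

instance
  by standard (transfer, simp add: fun_eq_iff algebra_simps)+

end

lift_definition scaleC :: "complex \<Rightarrow> ell2 \<Rightarrow> ell2" is "\<lambda>c x n. c * x n"
  by (rule summable_sq_scale)

lift_definition unit_vec :: "nat \<Rightarrow> ell2" is "\<lambda>j n. if n = j then 1 else 0"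
proof -
  fix j :: nat
  show "summable (\<lambda>n. (cmod (if n = j then 1 else 0))\<^sup>2)"
    by (rule summable_finite[of "{j}"]) auto
qed

definition cinner :: "ell2 \<Rightarrow> ell2 \<Rightarrow> complex" where
  "cinner x y = (\<Sum>n. coord x n * cnj (coord y n))"

lemma summable_cinner: "summable (\<lambda>n. coord x n * cnj (coord y n))"
proof (rule summable_comparison_test'[where N = 0, OF summable_add[OF summable_coord[of x] summable_coord[of y]]])
  fix n
  have "2 * (cmod (coord x n) * cmod (coord y n)) \<le> (cmod (coord x n))\<^sup>2 + (cmod (coord y n))\<^sup>2"
    using sum_squares_bound[of "cmod (coord x n)" "cmod (coord y n)"] by simp
  moreover have "0 \<le> cmod (coord x n) * cmod (coord y n)" by simp
  ultimately show "norm (coord x n * cnj (coord y n)) \<le> (cmod (coord x n))\<^sup>2 + (cmod (coord y n))\<^sup>2"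
    unfolding norm_mult complex_mod_cnj by linarith
qed

text \<open>
  The real inner product is the real part of \<^term>\<open>cinner\<close>; it induces the usual norm,
  and thereby the norm topology used for compactness below.
\<close>

instantiation ell2 :: real_inner
begin

lift_definition scaleR_ell2 :: "real \<Rightarrow> ell2 \<Rightarrow> ell2" is "\<lambda>r x n. r *\<^sub>R x n"
  using summable_sq_scale[of _ "complex_of_real r" for r] by (simp add: scaleR_conv_of_real)

definition inner_ell2 :: "ell2 \<Rightarrow> ell2 \<Rightarrow> real" where
  "inner_ell2 x y = Re (cinner x y)"

definition norm_ell2 :: "ell2 \<Rightarrow> real" where
  "norm_ell2 x = sqrt (\<Sum>n. (cmod (coord x n))\<^sup>2)"

definition dist_ell2 :: "ell2 \<Rightarrow> ell2 \<Rightarrow> real" where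
  "dist_ell2 x y = norm (x - y)"

definition sgn_ell2 :: "ell2 \<Rightarrow> ell2" where
  "sgn_ell2 x = inverse (norm x) *\<^sub>R x"

definition uniformity_ell2 :: "(ell2 \<times> ell2) filter" where
  "uniformity_ell2 = (INF e\<in>{0<..}. principal {(x, y). dist x y < e})"

definition open_ell2 :: "ell2 set \<Rightarrow> bool" where
  "open_ell2 U \<longleftrightarrow> (\<forall>x\<in>U. eventually (\<lambda>(x', y). x' = x \<longrightarrow> y \<in> U) uniformity)"

instance
proof
  have inner_sums: "inner x y = (\<Sum>n. Re (coord x n * cnj (coord y n)))"
    and inner_summable: "summable (\<lambda>n. Re (coord x n * cnj (coord y n)))" for x y :: ell2
    by (simp only: inner_ell2_def cinner_def Re_suminf[OF summable_cinner])
       (rule summable_Re[OF summable_cinner])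
  have self: "Re (z * cnj z) = (cmod z)\<^sup>2" for z
    by (simp only: complex_norm_square [symmetric] Re_complex_of_real)
  fix x y z :: ell2 and r s :: real
  show "dist x y = norm (x - y)" by (rule dist_ell2_def)
  show "sgn x = inverse (norm x) *\<^sub>R x" by (rule sgn_ell2_def)
  show "(uniformity :: (ell2 \<times> ell2) filter) = (INF e\<in>{0<..}. principal {(x, y). dist x y < e})"
    by (rule uniformity_ell2_def)
  show "open U \<longleftrightarrow> (\<forall>x\<in>U. \<forall>\<^sub>F (x', y) in uniformity. x' = x \<longrightarrow> y \<in> U)" for U :: "ell2 set"
    by (rule open_ell2_def)
  show "r *\<^sub>R (x + y) = r *\<^sub>R x + r *\<^sub>R y" by transfer (simp add: algebra_simps)
  show "(r + s) *\<^sub>R x = r *\<^sub>R x + s *\<^sub>R x" by transfer (simp add: algebra_simps)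
  show "r *\<^sub>R s *\<^sub>R x = (r * s) *\<^sub>R x" by transfer simp
  show "1 *\<^sub>R x = x" by transfer simp
  show "inner x y = inner y x"
    by (simp add: inner_sums mult.commute)
  show "inner (x + y) z = inner x z + inner y z"
    unfolding inner_sums
    by (subst suminf_add[OF inner_summable inner_summable])
       (simp add: plus_ell2.rep_eq algebra_simps)
  show "inner (r *\<^sub>R x) y = r * inner x y"
    unfolding inner_sums
    by (subst suminf_mult[OF inner_summable, symmetric])
       (simp add: scaleR_ell2.rep_eq algebra_simps)
  show "0 \<le> inner x x"
    unfolding inner_sums self by (rule suminf_nonneg[OF summable_coord]) simp
  show "inner x x = 0 \<longleftrightarrow> x = 0"
    unfolding inner_sums self
    by (subst suminf_eq_zero_iff[OF summable_coord])
       (auto simp: coord_inject[symmetric] zero_ell2.rep_eq fun_eq_iff)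
  show "norm x = sqrt (inner x x)"
    unfolding inner_sums self by (rule norm_ell2_def)
qed

end

section \<open>Operators and Schatten classes\<close>

interpretation ell2: vector_space scaleC
  by standard (transfer, simp add: fun_eq_iff algebra_simps)+

definition compact_operator :: "(ell2 \<Rightarrow> ell2) \<Rightarrow> bool" where
  "compact_operator T \<longleftrightarrow>
     Vector_Spaces.linear scaleC scaleC T \<and> compact (closure (T ` cball 0 1))"

text \<open>The adjoint is well defined only for bounded operators, in particular for compact ones.\<close>

definition cadjoint :: "(ell2 \<Rightarrow> ell2) \<Rightarrow> ell2 \<Rightarrow> ell2" where
  "cadjoint T = (THE S. \<forall>x y. cinner (T x) y = cinner x (S y))"

text \<open>
  The number of times that \<open>s > 0\<close> occurs as a singular value of \<open>T\<close>: the complex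
  dimension of the eigenspace of \<open>T\<^sup>*T\<close> for \<open>s\<^sup>2\<close>, zero if \<open>s\<close> is not a singular value.
  For compact \<open>T\<close> these eigenspaces are finite-dimensional, so that the convention
  that \<^const>\<open>ell2.dim\<close> is \<open>0\<close> in infinite dimension plays no role.
\<close>

definition singular_value_mult :: "(ell2 \<Rightarrow> ell2) \<Rightarrow> real \<Rightarrow> nat" where
  "singular_value_mult T s =
     ell2.dim {x. cadjoint T (T x) = scaleC (complex_of_real (s\<^sup>2)) x}"

text \<open>
  The sum below is that of the \<open>p\<close>-th powers of the nonzero singular values,
  repeated according to multiplicity, i.e. the trace of \<open>|T|\<^sup>p\<close>.
\<close>

definition schatten_class :: "real \<Rightarrow> (ell2 \<Rightarrow> ell2) set" where
  "schatten_class p = {T. compact_operator T \<and>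
     (\<lambda>s. real (singular_value_mult T s) * s powr p) summable_on {0<..}}"

text \<open>The entry \<open>(i, j)\<close> of the matrix of \<open>T\<close> is the \<open>i\<close>-th coordinate of \<open>T e\<^sub>j\<close>.\<close>

definition matrix_in_schatten :: "real \<Rightarrow> (nat \<Rightarrow> nat \<Rightarrow> complex) \<Rightarrow> bool" where
  "matrix_in_schatten p m \<longleftrightarrow>
     (\<exists>T\<in>schatten_class p. \<forall>i j. coord (T (unit_vec j)) i = m i j)"

end

theory Submission
  imports Defs
begin

text \<open>
  Singular values and the row and column norms of a matrix are compared through truncated sums
  of squares. For a compact operator \<open>T\<close> with singular values \<open>s\<^sub>v\<close>, the quantity
  \<open>\<Phi>(\<tau>) = \<Sum>\<^sub>v min(s\<^sub>v, \<tau>)\<^sup>2\<close> is the least value of \<open>\<parallel>T - F\<parallel>\<^sup>2 + \<tau>\<^sup>2 rank F\<close> in the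
  Hilbert-Schmidt norm, and \<open>\<Sum>\<^sub>v s\<^sub>v\<^sup>p\<close> is, up to a constant, a weighted average of \<open>\<Phi>\<close> over the
  levels \<open>\<tau>\<close>. Finitely many levels suffice (\<open>threshold_weights\<close>). Estimates at a single level
  therefore turn into estimates of \<open>p\<close>-th powers.

  \<^emph>\<open>A decomposition gives all signs.\<close> At level \<open>\<tau>\<close>, delete the rows of \<open>a\<close> and the columns of
  \<open>b\<close> whose norm exceeds \<open>\<tau>\<close>. The deleted lines form an operator whose rank is at most their number,
  and the Hilbert-Schmidt norm of the rest is bounded by the remaining line norms. Hence \<open>\<Phi>(\<tau>)\<close> is at
  most a constant times the sum of \<open>min(\<rho>, \<tau>)\<^sup>2\<close> over all line norms \<open>\<rho>\<close>, whatever the signs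
  (\<open>truncated_singular_values_le\<close>, \<open>rows_plus_columns_in_schatten\<close>).

  \<^emph>\<open>Almost all signs give a decomposition.\<close> In a finite corner of the matrix, repeatedly remove a row
  or column of largest norm, putting removed rows into \<open>a\<close> and removed columns into \<open>b\<close>. If
  \<open>\<rho>\<^sub>1 \<ge> \<rho>\<^sub>2 \<ge> \<dots>\<close> are the norms of the removed lines, this decomposition costs \<open>\<Sum>\<^sub>l \<rho>\<^sub>l\<^sup>p\<close>. The
  submatrix \<open>W\<close> that is left when all lines have norm at most \<open>t\<close> has squared Hilbert-Schmidt norm
  \<open>H(t) = \<Sum> {\<rho>\<^sub>l\<^sup>2 | \<rho>\<^sub>l \<le> t}\<close>, whatever the signs (\<open>peelable_finite\<close>). On the other hand, by
  independence the fourth moment \<open>tr (W\<^sup>*W)\<^sup>2\<close> has expectation at most \<open>2 t\<^sup>2 H(t)\<close>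
  (\<open>expectation_gram_sq\<close>). A small fourth moment prevents the mass \<open>H(t)\<close> from being carried by few
  large singular values, so \<open>H(t)\<close> is dominated by \<open>\<Phi>(t)\<close> up to an error of small expectation
  (\<open>sum_sq_le_rank_error\<close>, \<open>submatrix_le_truncated_singular_values\<close>). Averaging over the levels,
  \<open>\<Sum>\<^sub>l \<rho>\<^sub>l\<^sup>p\<close> is at most a constant times \<open>\<Sum>\<^sub>v s\<^sub>v\<^sup>p\<close> with probability at least \<open>3/4\<close>
  (\<open>split_cost_le_schatten\<close>). Since the latter sum is almost surely finite, the costs of the corners
  are bounded, and by compactness the splittings of the corners have a limit
  (\<open>decomposition_of_bounded_splits\<close>).
\<close>

section \<open>The sesquilinear structure of the sequence space\<close>

lemma cinner_add_left: "cinner (x + y) z = cinner x z + cinner y z"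
  unfolding cinner_def
  by (subst suminf_add[OF summable_cinner summable_cinner]) (simp add: plus_ell2.rep_eq algebra_simps)

lemma cinner_scale_left: "cinner (scaleC c x) y = c * cinner x y"
  unfolding cinner_def
  by (subst suminf_mult[OF summable_cinner, symmetric]) (simp add: scaleC.rep_eq algebra_simps)

lemma cinner_commute: "cinner x y = cnj (cinner y x)"
proof -
  have "(\<lambda>n. coord y n * cnj (coord x n)) sums cinner y x"
    unfolding cinner_def by (rule summable_sums[OF summable_cinner])
  then have "(\<lambda>n. cnj (coord y n * cnj (coord x n))) sums cnj (cinner y x)"
    by (simp only: sums_cnj)
  then show ?thesis
    unfolding cinner_def[of x y] by (simp add: sums_iff mult.commute)
qed

lemma cinner_add_right: "cinner x (y + z) = cinner x y + cinner x z"
  by (metis cinner_add_left cinner_commute complex_cnj_add)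

lemma cinner_scale_right: "cinner x (scaleC c y) = cnj c * cinner x y"
  by (metis cinner_commute cinner_scale_left complex_cnj_mult)

lemma cinner_zero_left [simp]: "cinner 0 y = 0"
  using cinner_scale_left[of 0 0 y] by simp

lemma cinner_zero_right [simp]: "cinner x 0 = 0"
  using cinner_scale_right[of x 0 0] by simp

lemma cinner_diff_left: "cinner (x - y) z = cinner x z - cinner y z"
  by (metis add_diff_cancel cinner_add_left diff_add_cancel)

lemma cinner_diff_right: "cinner x (y - z) = cinner x y - cinner x z"
  by (metis add_diff_cancel cinner_add_right diff_add_cancel)

lemma cinner_sum_left: "cinner (\<Sum>i\<in>I. f i) y = (\<Sum>i\<in>I. cinner (f i) y)"
  by (induction I rule: infinite_finite_induct) (simp_all add: cinner_add_left)

lemma cinner_sum_right: "cinner x (\<Sum>i\<in>I. f i) = (\<Sum>i\<in>I. cinner x (f i))"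
  by (induction I rule: infinite_finite_induct) (simp_all add: cinner_add_right)

lemma norm_sq_sums: "(\<lambda>n. (cmod (coord x n))\<^sup>2) sums (norm x)\<^sup>2"
  unfolding norm_ell2_def
  by (simp add: summable_sums[OF summable_coord] suminf_nonneg[OF summable_coord])

lemma cinner_self: "cinner x x = complex_of_real ((norm x)\<^sup>2)"
proof -
  have "(\<lambda>n. complex_of_real ((cmod (coord x n))\<^sup>2)) sums complex_of_real ((norm x)\<^sup>2)"
    using norm_sq_sums[of x] by (simp only: sums_of_real_iff)
  then show ?thesis
    unfolding cinner_def by (simp only: complex_norm_square sums_iff)
qed

lemma norm_scaleC: "norm (scaleC c x) = cmod c * norm x"
proof -
  have "complex_of_real ((norm (scaleC c x))\<^sup>2) = complex_of_real ((cmod c * norm x)\<^sup>2)"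
    by (simp only: cinner_self[symmetric] cinner_scale_left cinner_scale_right power_mult_distrib
        of_real_mult complex_norm_square mult_ac)
  then show ?thesis
    by (simp only: of_real_eq_iff power2_eq_iff_nonneg norm_ge_zero mult_nonneg_nonneg)
qed

text \<open>
  Rotating \<open>x\<close> by a phase makes the complex inner product real, where the real
  Cauchy-Schwarz inequality applies.
\<close>

lemma cmod_cinner_le: "cmod (cinner x y) \<le> norm x * norm y"
proof (cases "cinner x y = 0")
  case False
  \<comment> \<open>the phase that turns \<^term>\<open>cinner x y\<close> into its modulus\<close>
  define c where "c = cnj (cinner x y) / cmod (cinner x y)"
  have c: "cmod c = 1"
    using False by (simp add: c_def norm_divide)
  have "cinner (scaleC c x) y = complex_of_real (cmod (cinner x y))"
    using False complex_norm_square[of "cinner x y"]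
    by (simp add: cinner_scale_left c_def field_simps power2_eq_square)
  then have "cmod (cinner x y) = inner (scaleC c x) y"
    by (simp add: inner_ell2_def)
  also have "\<dots> \<le> norm (scaleC c x) * norm y"
    by (rule norm_cauchy_schwarz)
  finally show ?thesis
    by (simp add: norm_scaleC c)
qed simp

lemma norm_add_orthogonal:
  assumes "cinner x y = 0"
  shows "(norm (x + y))\<^sup>2 = (norm x)\<^sup>2 + (norm y)\<^sup>2"
proof -
  have "inner x y = 0"
    using assms by (simp add: inner_ell2_def)
  then show ?thesis
    by (simp add: power2_norm_eq_inner inner_add_left inner_add_right inner_commute[of y x])
qed

lemma cinner_ext: "(\<And>x. cinner x y = cinner x z) \<Longrightarrow> y = z"
proof -
  assume "\<And>x. cinner x y = cinner x z"
  then have "cinner (y - z) (y - z) = 0"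
    by (simp add: cinner_diff_right)
  then show "y = z"
    by (simp add: cinner_self)
qed

lemma scaleR_eq_scaleC: "r *\<^sub>R x = scaleC (complex_of_real r) x"
  by transfer (simp add: scaleR_conv_of_real)

lemma cinner_unit_vec: "cinner x (unit_vec j) = coord x j"
proof -
  have "(\<lambda>n. coord x n * cnj (coord (unit_vec j) n)) sums (coord x j)"
    using sums_If_finite_set[of "{j}" "\<lambda>n. coord x n"] by (auto simp: unit_vec.rep_eq if_distrib cong: if_cong)
  then show ?thesis
    by (simp add: cinner_def sums_iff)
qed

lemma norm_unit_vec [simp]: "norm (unit_vec j) = 1"
proof -
  have "complex_of_real ((norm (unit_vec j))\<^sup>2) = 1"
    unfolding cinner_self[symmetric] cinner_unit_vec by (simp add: unit_vec.rep_eq)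
  then show ?thesis
    by (metis norm_ge_zero of_real_eq_1_iff one_power2 power2_eq_iff_nonneg zero_le_one)
qed

lemma norm_sq_sums_unit_vec: "(\<lambda>n. (cmod (cinner x (unit_vec n)))\<^sup>2) sums (norm x)\<^sup>2"
  using norm_sq_sums by (simp add: cinner_unit_vec)

lemma norm_sq_sums_unit_vec': "(\<lambda>n. (cmod (cinner (unit_vec n) x))\<^sup>2) sums (norm x)\<^sup>2"
  using norm_sq_sums_unit_vec[of x] by (subst cinner_commute) simp

lemma coord_sum: "coord (\<Sum>i\<in>I. f i) n = (\<Sum>i\<in>I. coord (f i) n)"
  by (induction I rule: infinite_finite_induct) (simp_all add: zero_ell2.rep_eq plus_ell2.rep_eq)

lemma coord_unit_combination:
  assumes "finite S"
  shows "coord (\<Sum>j\<in>S. scaleC (c j) (unit_vec j)) k = (if k \<in> S then c k else 0)"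
proof -
  have "coord (\<Sum>j\<in>S. scaleC (c j) (unit_vec j)) k = (\<Sum>j\<in>S. if k = j then c j else 0)"
    by (simp add: coord_sum scaleC.rep_eq unit_vec.rep_eq if_distrib cong: if_cong)
  then show ?thesis
    using assms by simp
qed

lemma norm_sq_unit_combination:
  assumes "finite S"
  shows "(norm (\<Sum>j\<in>S. scaleC (c j) (unit_vec j)))\<^sup>2 = (\<Sum>j\<in>S. (cmod (c j))\<^sup>2)"
proof -
  have "(\<lambda>k. (cmod (coord (\<Sum>j\<in>S. scaleC (c j) (unit_vec j)) k))\<^sup>2)
      = (\<lambda>k. if k \<in> S then (cmod (c k))\<^sup>2 else 0)"
    using assms by (auto simp: coord_unit_combination)
  moreover have "(\<lambda>k. if k \<in> S then (cmod (c k))\<^sup>2 else 0) sums (\<Sum>j\<in>S. (cmod (c j))\<^sup>2)"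
    using assms by (rule sums_If_finite_set)
  ultimately show ?thesis
    using sums_unique2[OF norm_sq_sums] by simp
qed

lemma sum_coord_sq_le:
  assumes "finite S"
  shows "(\<Sum>n\<in>S. (cmod (coord x n))\<^sup>2) \<le> (norm x)\<^sup>2"
  using sum_le_suminf[OF summable_coord assms, of x] norm_sq_sums[of x] by (simp add: sums_iff)

lemma initial_segments_tendsto:
  "(\<lambda>n. \<Sum>j<n. scaleC (coord x j) (unit_vec j)) \<longlonglongrightarrow> x"
proof -
  let ?t = "\<lambda>n. \<Sum>j<n. scaleC (coord x j) (unit_vec j)"
  have eq: "(norm (?t n - x))\<^sup>2 = (norm x)\<^sup>2 - (\<Sum>j<n. (cmod (coord x j))\<^sup>2)" for n
  proof -
    have "cinner (?t n) (x - ?t n) = 0"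
      by (simp add: cinner_sum_left cinner_scale_left cinner_commute[of "unit_vec _"] cinner_unit_vec
          minus_ell2.rep_eq coord_unit_combination)
    then have "(norm x)\<^sup>2 = (norm (?t n))\<^sup>2 + (norm (x - ?t n))\<^sup>2"
      using norm_add_orthogonal[of "?t n" "x - ?t n"] by simp
    then show ?thesis
      by (simp add: norm_sq_unit_combination norm_minus_commute)
  qed
  have "(\<lambda>n. (norm x)\<^sup>2 - (\<Sum>j<n. (cmod (coord x j))\<^sup>2)) \<longlonglongrightarrow> (norm x)\<^sup>2 - (norm x)\<^sup>2"
    using norm_sq_sums[of x] unfolding sums_def by (intro tendsto_intros)
  then have "(\<lambda>n. (norm (?t n - x))\<^sup>2) \<longlonglongrightarrow> 0"
    by (simp add: eq)
  then have "(\<lambda>n. sqrt ((norm (?t n - x))\<^sup>2)) \<longlonglongrightarrow> sqrt 0"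
    by (rule tendsto_real_sqrt)
  then have "(\<lambda>n. norm (?t n - x)) \<longlonglongrightarrow> 0"
    by simp
  then show ?thesis
    by (rule LIM_zero_cancel[OF tendsto_norm_zero_cancel])
qed

lemma tendsto_cinner_left:
  assumes "X \<longlonglongrightarrow> x"
  shows "(\<lambda>n. cinner (X n) y) \<longlonglongrightarrow> cinner x y"
proof -
  have "(\<lambda>n. norm (X n - x) * norm y) \<longlonglongrightarrow> 0 * norm y"
    using assms by (intro tendsto_mult tendsto_const tendsto_norm_zero LIM_zero)
  then have lim: "(\<lambda>n. norm (X n - x) * norm y) \<longlonglongrightarrow> 0"
    by simp
  have "(\<lambda>n. cinner (X n) y - cinner x y) \<longlonglongrightarrow> 0"
  proof (rule Lim_null_comparison[OF always_eventually lim], rule allI)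
    show "norm (cinner (X n) y - cinner x y) \<le> norm (X n - x) * norm y" for n
      by (simp only: cinner_diff_left[symmetric] cmod_cinner_le)
  qed
  then show ?thesis
    by (rule LIM_zero_cancel)
qed

section \<open>Orthonormal sets\<close>

definition orthonormal :: "ell2 set \<Rightarrow> bool" where
  "orthonormal E \<longleftrightarrow> (\<forall>u\<in>E. \<forall>v\<in>E. cinner u v = (if u = v then 1 else 0))"

text \<open>For finite orthonormal \<open>E\<close> this is the orthogonal projection onto the span of \<open>E\<close>.\<close>

definition proj :: "ell2 set \<Rightarrow> ell2 \<Rightarrow> ell2" where
  "proj E x = (\<Sum>v\<in>E. scaleC (cinner x v) v)"

lemma orthonormalD:
  assumes "orthonormal E" "u \<in> E" "v \<in> E"
  shows "cinner u v = (if u = v then 1 else 0)"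
  using assms unfolding orthonormal_def by blast

lemma norm_eq_1_iff_cinner: "norm x = 1 \<longleftrightarrow> cinner x x = 1"
  by (simp only: cinner_self of_real_eq_1_iff power2_eq_1_iff) (use norm_ge_zero[of x] in linarith)

lemma orthonormal_norm: "orthonormal E \<Longrightarrow> v \<in> E \<Longrightarrow> norm v = 1"
  by (simp add: norm_eq_1_iff_cinner orthonormalD)

lemma orthonormal_subset: "orthonormal E \<Longrightarrow> F \<subseteq> E \<Longrightarrow> orthonormal F"
  unfolding orthonormal_def by blast

lemma cinner_combination:
  assumes "orthonormal E" "finite E" "v \<in> E"
  shows "cinner (\<Sum>u\<in>E. scaleC (c u) u) v = c v"
proof -
  have "cinner (\<Sum>u\<in>E. scaleC (c u) u) v = (\<Sum>u\<in>E. c u * (if u = v then 1 else 0))"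
    using assms by (simp add: cinner_sum_left cinner_scale_left orthonormalD)
  also have "\<dots> = c v"
    using assms by (simp add: if_distrib cong: if_cong)
  finally show ?thesis .
qed

lemma cinner_proj:
  assumes "orthonormal E" "finite E" "v \<in> E"
  shows "cinner (proj E x) v = cinner x v"
  unfolding proj_def using cinner_combination[OF assms] by simp

lemma proj_diff: "proj E (x - y) = proj E x - proj E y"
  by (simp add: proj_def cinner_diff_left ell2.scale_left_diff_distrib sum_subtractf)

lemma cinner_proj_swap: "cinner (proj E x) y = cinner x (proj E y)"
  by (simp add: proj_def cinner_sum_left cinner_sum_right cinner_scale_left cinner_scale_right
      mult.commute cinner_commute[of y])

lemma cinner_residual:
  assumes "orthonormal E" "finite E" "v \<in> E"
  shows "cinner (x - proj E x) v = 0"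
  by (simp add: cinner_diff_left cinner_proj[OF assms])

lemma norm_sq_combination:
  assumes "orthonormal E" "finite E"
  shows "(norm (\<Sum>v\<in>E. scaleC (c v) v))\<^sup>2 = (\<Sum>v\<in>E. (cmod (c v))\<^sup>2)"
proof -
  have "complex_of_real ((norm (\<Sum>v\<in>E. scaleC (c v) v))\<^sup>2)
      = (\<Sum>v\<in>E. cnj (c v) * cinner (\<Sum>u\<in>E. scaleC (c u) u) v)"
    by (simp only: cinner_self[symmetric] cinner_sum_right[of _ _ E] cinner_scale_right)
  also have "\<dots> = (\<Sum>v\<in>E. cnj (c v) * c v)"
    using assms by (simp add: cinner_combination)
  also have "\<dots> = complex_of_real (\<Sum>v\<in>E. (cmod (c v))\<^sup>2)"
    by (simp only: of_real_sum complex_norm_square mult.commute)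
  finally show ?thesis
    by (simp only: of_real_eq_iff)
qed

lemma pythagoras_proj:
  assumes "orthonormal E" "finite E"
  shows "(norm x)\<^sup>2 = (\<Sum>v\<in>E. (cmod (cinner x v))\<^sup>2) + (norm (x - proj E x))\<^sup>2"
proof -
  have "cinner (proj E x) (x - proj E x) = 0"
    using assms cinner_residual[OF assms]
    by (subst cinner_commute, subst (2) proj_def) (simp add: cinner_sum_right cinner_scale_right)
  from norm_add_orthogonal[OF this] show ?thesis
    using norm_sq_combination[OF assms, of "cinner x"] by (simp add: proj_def)
qed

lemma bessel:
  assumes "orthonormal E" "finite E"
  shows "(\<Sum>v\<in>E. (cmod (cinner x v))\<^sup>2) \<le> (norm x)\<^sup>2"
  using pythagoras_proj[OF assms, of x] by simp

lemma norm_residual_le: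
  assumes "orthonormal E" "finite E"
  shows "(norm (x - proj E x))\<^sup>2 \<le> (norm x)\<^sup>2"
  using pythagoras_proj[OF assms, of x] by (simp add: sum_nonneg)

lemma proj_span:
  assumes "orthonormal E" "finite E" "x \<in> ell2.span E"
  shows "proj E x = x"
proof -
  from assms(3,2) obtain c where "x = (\<Sum>v\<in>E. scaleC (c v) v)"
    unfolding ell2.span_finite[OF assms(2)] by auto
  then show ?thesis
    using assms(1,2) unfolding proj_def by (simp add: cinner_combination)
qed

lemma span_proj: "finite E \<Longrightarrow> proj E x \<in> ell2.span E"
  unfolding proj_def by (intro ell2.span_sum ell2.span_scale ell2.span_base)

text \<open>
  Pythagoras turns the fact that the projection is the nearest point of the span into an upper
  bound on \<open>x\<close>, with the two parts that are estimated separately later on.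
\<close>

lemma residual_le_dist_span:
  assumes "orthonormal E" "finite E" "z \<in> ell2.span E"
  shows "(norm x)\<^sup>2 \<le> (\<Sum>v\<in>E. (cmod (cinner x v))\<^sup>2) + (norm (x - z))\<^sup>2"
proof -
  have eq: "(x - z) - proj E (x - z) = x - proj E x"
    using proj_span[OF assms] by (simp add: proj_diff)
  show ?thesis
    using norm_residual_le[OF assms(1,2), of "x - z"] pythagoras_proj[OF assms(1,2), of x]
    unfolding eq by linarith
qed

lemma orthonormal_insert:
  assumes "orthonormal E" "norm y = 1" "\<And>v. v \<in> E \<Longrightarrow> cinner y v = 0"
  shows "orthonormal (insert y E)"
proof -
  have "cinner v y = 0" if "v \<in> E" for v
    using assms(3)[OF that] by (subst cinner_commute) simp
  moreover have "cinner y y = 1"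
    using assms(2) by (simp add: cinner_self)
  moreover have "y \<notin> E"
    using assms(3)[of y] \<open>cinner y y = 1\<close> by auto
  ultimately show ?thesis
    using assms(1,3) unfolding orthonormal_def by auto
qed

lemma gram_schmidt:
  assumes "finite Y"
  shows "\<exists>E. finite E \<and> orthonormal E \<and> card E \<le> card Y \<and> Y \<subseteq> ell2.span E \<and> E \<subseteq> ell2.span Y"
  using assms
proof (induction Y rule: finite_induct)
  case empty
  show ?case
    by (intro exI[of _ "{}"]) (simp add: orthonormal_def)
next
  case (insert y Y)
  then obtain E where E: "finite E" "orthonormal E" "card E \<le> card Y" "Y \<subseteq> ell2.span E"
      "E \<subseteq> ell2.span Y"
    by blast
  define z where "z = y - proj E y"
  have YE: "ell2.span E \<subseteq> ell2.span (insert y Y)"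
    using E(5) ell2.span_mono[of Y "insert y Y"] by (intro ell2.span_minimal) auto
  show ?case
  proof (cases "z = 0")
    case True
    then have "y \<in> ell2.span E"
      using span_proj[OF E(1), of y] by (simp add: z_def)
    then show ?thesis
      using E insert.hyps order_trans[OF ell2.span_superset YE]
      by (intro exI[of _ E]) (simp add: le_SucI)
  next
    case False
    define e where "e = scaleC (complex_of_real (inverse (norm z))) z"
    have ne: "norm e = 1"
      using False by (simp add: e_def norm_scaleC norm_inverse)
    have oe: "cinner e v = 0" if "v \<in> E" for v
      using cinner_residual[OF E(2,1) that, of y] by (simp add: e_def cinner_scale_left z_def)
    have "z = scaleC (complex_of_real (norm z)) e"
      using False by (simp add: e_def)
    then have y: "y = scaleC (complex_of_real (norm z)) e + proj E y"
      by (simp add: z_def)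
    have "proj E y \<in> ell2.span (insert e E)"
      using span_proj[OF E(1), of y] ell2.span_mono[of E "insert e E"] by blast
    then have "y \<in> ell2.span (insert e E)"
      by (subst y) (intro ell2.span_add ell2.span_scale ell2.span_base[OF insertI1])
    moreover have "proj E y \<in> ell2.span (insert y Y)"
      using span_proj[OF E(1), of y] YE by blast
    then have "e \<in> ell2.span (insert y Y)"
      unfolding e_def z_def
      by (intro ell2.span_diff ell2.span_scale ell2.span_base[OF insertI1])
    moreover have "orthonormal (insert e E)"
      by (rule orthonormal_insert[OF E(2) ne oe])
    moreover have "card (insert e E) \<le> card (insert y Y)"
      using E(1,3) insert.hyps by (simp add: card_insert_if)
    moreover have "Y \<subseteq> ell2.span (insert e E)"
      using E(4) ell2.span_mono[of E "insert e E"] by auto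
    moreover have "E \<subseteq> ell2.span (insert y Y)"
      using YE ell2.span_superset[of E] by blast
    ultimately show ?thesis
      using E(1) by (intro exI[of _ "insert e E"]) auto
  qed
qed

section \<open>Singular vectors of a compact operator\<close>

lemma compact_operator_add: "compact_operator T \<Longrightarrow> T (x + y) = T x + T y"
  by (simp add: compact_operator_def Vector_Spaces.linear_iff)

lemma compact_operator_scale: "compact_operator T \<Longrightarrow> T (scaleC c x) = scaleC c (T x)"
  by (simp add: compact_operator_def Vector_Spaces.linear_iff)

lemma compact_operator_diff: "compact_operator T \<Longrightarrow> T (x - y) = T x - T y"
  by (metis add_diff_cancel compact_operator_add diff_add_cancel)

lemma compact_operator_zero: "compact_operator T \<Longrightarrow> T 0 = 0"
  using compact_operator_diff[of T 0 0] by simp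

lemma compact_operator_sum: "compact_operator T \<Longrightarrow> T (\<Sum>i\<in>I. f i) = (\<Sum>i\<in>I. T (f i))"
  by (induction I rule: infinite_finite_induct)
     (simp_all add: compact_operator_zero compact_operator_add)

lemma compact_operator_bounded:
  assumes T: "compact_operator T"
  obtains K where "K > 0" "\<And>x. norm (T x) \<le> K * norm x"
proof -
  have "bounded (closure (T ` cball 0 1))"
    using T by (auto simp: compact_operator_def compact_imp_bounded)
  then obtain K where K: "K > 0" "\<And>y. y \<in> closure (T ` cball 0 1) \<Longrightarrow> norm y \<le> K"
    by (metis bounded_pos)
  have unit: "norm (T x) \<le> K" if "norm x \<le> 1" for x
    using that by (intro K(2) subsetD[OF closure_subset]) auto
  have "norm (T x) \<le> K * norm x" for x
  proof (cases "x = 0")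
    case False
    let ?r = "complex_of_real (inverse (norm x))"
    have r: "cmod ?r = inverse (norm x)"
      by (simp only: norm_of_real abs_inverse abs_norm_cancel)
    have "norm (T (scaleC ?r x)) \<le> K"
      using False by (intro unit) (simp only: norm_scaleC r, simp)
    then have "inverse (norm x) * norm (T x) \<le> K"
      by (simp only: compact_operator_scale[OF T] norm_scaleC r)
    then show ?thesis
      using False by (simp add: field_simps)
  qed (simp add: compact_operator_zero[OF T])
  with K(1) show ?thesis
    by (rule that)
qed

lemma compact_operator_tendsto:
  assumes T: "compact_operator T" and X: "X \<longlonglongrightarrow> x"
  shows "(\<lambda>n. T (X n)) \<longlonglongrightarrow> T x"
proof -
  obtain K where K: "K > 0" "\<And>x. norm (T x) \<le> K * norm x"
    using compact_operator_bounded[OF T] by blast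
  have "(\<lambda>n. K * norm (X n - x)) \<longlonglongrightarrow> K * 0"
    using X by (intro tendsto_mult tendsto_const tendsto_norm_zero LIM_zero)
  then have lim: "(\<lambda>n. K * norm (X n - x)) \<longlonglongrightarrow> 0"
    by simp
  have "(\<lambda>n. T (X n) - T x) \<longlonglongrightarrow> 0"
  proof (rule Lim_null_comparison[OF always_eventually lim], rule allI)
    show "norm (T (X n) - T x) \<le> K * norm (X n - x)" for n
      by (simp only: compact_operator_diff[OF T, symmetric] K(2))
  qed
  then show ?thesis
    by (rule LIM_zero_cancel)
qed

lemma compact_operator_convergent_subseq:
  assumes T: "compact_operator T" and X: "\<And>n::nat. norm (X n) \<le> 1"
  obtains r :: "nat \<Rightarrow> nat" and y where "strict_mono r" "(\<lambda>n. T (X (r n))) \<longlonglongrightarrow> y"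
proof -
  have "seq_compact (closure (T ` cball 0 1))"
    using T by (simp add: compact_operator_def compact_imp_seq_compact)
  moreover have "\<forall>n. T (X n) \<in> closure (T ` cball 0 1)"
    using X by (intro allI subsetD[OF closure_subset]) auto
  ultimately obtain l r where "strict_mono r" "((\<lambda>n. T (X n)) \<circ> r) \<longlonglongrightarrow> l"
    by (rule seq_compactE)
  then show ?thesis
    using that by (simp add: o_def)
qed

text \<open>
  The coordinates of \<open>T\<^sup>* y\<close> are forced, and they are square summable because
  pairing \<open>T\<^sup>* y\<close> with its own truncations only costs the norm of \<open>T\<close>.
\<close>

lemma adjoint_exists:
  assumes T: "compact_operator T"
  shows "\<exists>S. \<forall>x y. cinner (T x) y = cinner x (S y)"
proof -
  obtain K where K: "K > 0" "\<And>x. norm (T x) \<le> K * norm x"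
    using compact_operator_bounded[OF T] by blast
  have "\<exists>z. \<forall>x. cinner (T x) y = cinner x z" for y
  proof -
    define s where "s j = cinner y (T (unit_vec j))" for j
    have cs: "cinner (T (unit_vec j)) y = cnj (s j)" for j
      by (simp add: s_def cinner_commute[of y])
    have "(\<Sum>j<n. (cmod (s j))\<^sup>2) \<le> (K * norm y)\<^sup>2" for n
    proof -
      define x where "x = (\<Sum>j<n. scaleC (s j) (unit_vec j))"
      define q where "q = (\<Sum>j<n. (cmod (s j))\<^sup>2)"
      have q0: "q \<ge> 0" and nx: "norm x = sqrt q"
        using norm_sq_unit_combination[of "{..<n}" s] by (auto simp: q_def x_def sum_nonneg real_sqrt_unique)
      have "cinner (T x) y = complex_of_real q"
        by (simp add: x_def q_def compact_operator_sum[OF T] compact_operator_scale[OF T]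
            cinner_sum_left cinner_scale_left cs complex_norm_square[symmetric])
      then have "q = cmod (cinner (T x) y)"
        using q0 by simp
      also have "\<dots> \<le> norm (T x) * norm y"
        by (rule cmod_cinner_le)
      also have "\<dots> \<le> K * norm x * norm y"
        by (intro mult_right_mono K(2)) simp
      finally have "sqrt q * sqrt q \<le> sqrt q * (K * norm y)"
        using q0 by (simp add: nx mult_ac)
      then have "sqrt q \<le> K * norm y"
        using K(1) q0 by (cases "q = 0") (simp, metis mult_left_le_imp_le order_le_less real_sqrt_gt_zero)
      then show ?thesis
        using q0 K(1) unfolding q_def[symmetric] by (meson real_sqrt_le_iff sqrt_le_D)
    qed
    then have "summable (\<lambda>j. (cmod (s j))\<^sup>2)"
      by (intro summableI_nonneg_bounded) auto
    then have cz: "coord (Abs_ell2 s) = s"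
      by (intro Abs_ell2_inverse) simp
    have "cinner (T x) y = cinner x (Abs_ell2 s)" for x
    proof -
      have "(\<lambda>n. \<Sum>j<n. coord x j * cnj (coord (Abs_ell2 s) j)) \<longlonglongrightarrow> cinner x (Abs_ell2 s)"
        unfolding cinner_def using summable_sums[OF summable_cinner] by (simp add: sums_def)
      moreover have "(\<lambda>n. cinner (T (\<Sum>j<n. scaleC (coord x j) (unit_vec j))) y)
          \<longlonglongrightarrow> cinner (T x) y"
        by (intro tendsto_cinner_left compact_operator_tendsto[OF T] initial_segments_tendsto)
      ultimately show ?thesis
        by (intro LIMSEQ_unique[of "\<lambda>n. \<Sum>j<n. coord x j * cnj (coord (Abs_ell2 s) j)"])
           (simp_all add: compact_operator_sum[OF T] compact_operator_scale[OF T]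
            cinner_sum_left cinner_scale_left cs cz)
    qed
    then show ?thesis
      by blast
  qed
  then show ?thesis
    by metis
qed

lemma cinner_cadjoint:
  assumes T: "compact_operator T"
  shows "cinner (T x) y = cinner x (cadjoint T y)"
proof -
  obtain S where S: "\<forall>x y. cinner (T x) y = cinner x (S y)"
    using adjoint_exists[OF T] by blast
  have "\<forall>x y. cinner (T x) y = cinner x (cadjoint T y)"
    unfolding cadjoint_def
  proof (rule theI[where P = "\<lambda>S. \<forall>x y. cinner (T x) y = cinner x (S y)", OF S])
    fix S' assume S': "\<forall>x y. cinner (T x) y = cinner x (S' y)"
    show "S' = S"
      using S S' by (intro ext cinner_ext) simp
  qed
  then show ?thesis
    by blast
qed

lemma cinner_cadjoint':
  "compact_operator T \<Longrightarrow> cinner (cadjoint T y) x = cinner y (T x)"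
  by (metis cinner_cadjoint cinner_commute)

lemma cadjoint_diff:
  "compact_operator T \<Longrightarrow> cadjoint T (x - y) = cadjoint T x - cadjoint T y"
  by (rule cinner_ext) (simp add: cinner_cadjoint[symmetric] cinner_diff_right)

lemma cadjoint_scale:
  "compact_operator T \<Longrightarrow> cadjoint T (scaleC c x) = scaleC c (cadjoint T x)"
  by (rule cinner_ext) (simp add: cinner_cadjoint[symmetric] cinner_scale_right)

lemma cadjoint_tendsto:
  assumes T: "compact_operator T" and X: "X \<longlonglongrightarrow> x"
  shows "(\<lambda>n. cadjoint T (X n)) \<longlonglongrightarrow> cadjoint T x"
proof -
  obtain K where K: "K > 0" "\<And>x. norm (T x) \<le> K * norm x"
    using compact_operator_bounded[OF T] by blast
  have bound: "norm (cadjoint T y) \<le> K * norm y" for y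
  proof -
    let ?z = "cadjoint T y"
    have "(norm ?z)\<^sup>2 = cmod (cinner (T ?z) y)"
      by (simp add: cinner_cadjoint[OF T] cinner_self norm_power)
    also have "\<dots> \<le> norm (T ?z) * norm y"
      by (rule cmod_cinner_le)
    also have "\<dots> \<le> K * norm ?z * norm y"
      by (intro mult_right_mono K(2)) simp
    finally have "norm ?z * norm ?z \<le> norm ?z * (K * norm y)"
      by (simp add: power2_eq_square mult_ac)
    then show ?thesis
      using K(1) by (cases "?z = 0") auto
  qed
  have "(\<lambda>n. K * norm (X n - x)) \<longlonglongrightarrow> K * 0"
    using X by (intro tendsto_mult tendsto_const tendsto_norm_zero LIM_zero)
  then have lim: "(\<lambda>n. K * norm (X n - x)) \<longlonglongrightarrow> 0"
    by simp
  have "(\<lambda>n. cadjoint T (X n) - cadjoint T x) \<longlonglongrightarrow> 0"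
  proof (rule Lim_null_comparison[OF always_eventually lim], rule allI)
    show "norm (cadjoint T (X n) - cadjoint T x) \<le> K * norm (X n - x)" for n
      by (simp only: cadjoint_diff[OF T, symmetric] bound)
  qed
  then show ?thesis
    by (rule LIM_zero_cancel)
qed

text \<open>The zero vector counts as an eigenvector for every \<open>s\<close>, so that these vectors form a subspace.\<close>

abbreviation eigvec :: "(ell2 \<Rightarrow> ell2) \<Rightarrow> real \<Rightarrow> ell2 \<Rightarrow> bool" where
  "eigvec T s x \<equiv> cadjoint T (T x) = scaleC (complex_of_real (s\<^sup>2)) x"

lemma eigvec_orthogonal:
  assumes T: "compact_operator T" and "eigvec T s x" "eigvec T t y" "s \<ge> 0" "t \<ge> 0" "s \<noteq> t"
  shows "cinner x y = 0"
proof -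
  have "complex_of_real (s\<^sup>2) * cinner x y = cinner (cadjoint T (T x)) y"
    by (simp add: assms cinner_scale_left)
  also have "\<dots> = cinner x (cadjoint T (T y))"
    by (simp add: cinner_cadjoint'[OF T] cinner_cadjoint[OF T])
  also have "\<dots> = complex_of_real (t\<^sup>2) * cinner x y"
    by (simp add: assms cinner_scale_right)
  finally show ?thesis
    using assms by (auto simp: power2_eq_iff_nonneg simp flip: of_real_power)
qed

lemma eigvec_norm:
  assumes T: "compact_operator T" and "eigvec T s x" "s \<ge> 0"
  shows "norm (T x) = s * norm x"
proof -
  have "complex_of_real ((norm (T x))\<^sup>2) = complex_of_real ((s * norm x)\<^sup>2)"
    by (simp only: cinner_self[symmetric] cinner_cadjoint[OF T] assms cinner_scale_right)
       (simp add: cinner_self power_mult_distrib)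
  then show ?thesis
    using assms(3) by (simp only: of_real_eq_iff power2_eq_iff_nonneg norm_ge_zero mult_nonneg_nonneg)
qed

text \<open>
  The right singular vectors of \<open>T\<close>, with multiplicities: a maximal orthonormal set
  of eigenvectors of \<open>T\<^sup>*T\<close> for positive eigenvalues. The singular value of
  \<open>v\<close> is \<^term>\<open>norm (T v)\<close>.
\<close>

definition singular_system :: "(ell2 \<Rightarrow> ell2) \<Rightarrow> ell2 set \<Rightarrow> bool" where
  "singular_system T V \<longleftrightarrow> orthonormal V
     \<and> (\<forall>v\<in>V. T v \<noteq> 0 \<and> eigvec T (norm (T v)) v)
     \<and> (\<forall>x s. s > 0 \<longrightarrow> eigvec T s x \<longrightarrow> (\<forall>v\<in>V. cinner x v = 0) \<longrightarrow> x = 0)"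

lemma singular_system_exists:
  assumes T: "compact_operator T"
  shows "\<exists>V. singular_system T V"
proof -
  let ?A = "{V. orthonormal V \<and> (\<forall>v\<in>V. T v \<noteq> 0 \<and> eigvec T (norm (T v)) v)}"
  have "\<exists>V\<in>?A. \<forall>X\<in>?A. V \<subseteq> X \<longrightarrow> X = V"
  proof (rule subset_Zorn')
    fix C assume C: "subset.chain ?A C"
    have "orthonormal (\<Union>C)"
      unfolding orthonormal_def
    proof (intro ballI)
      fix u v assume "u \<in> \<Union>C" "v \<in> \<Union>C"
      then obtain U W where UW: "U \<in> C" "W \<in> C" "u \<in> U" "v \<in> W"
        by blast
      moreover have "U \<subseteq> W \<or> W \<subseteq> U"
        using C UW(1,2) unfolding subset_chain_def by blast
      ultimately obtain V where "V \<in> C" "u \<in> V" "v \<in> V"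
        by blast
      moreover have "orthonormal V"
        using C \<open>V \<in> C\<close> unfolding subset_chain_def by blast
      ultimately show "cinner u v = (if u = v then 1 else 0)"
        by (intro orthonormalD)
    qed
    then show "\<Union>C \<in> ?A"
      using C unfolding subset_chain_def by blast
  qed
  then obtain V where V: "V \<in> ?A" and max: "\<forall>X\<in>?A. V \<subseteq> X \<longrightarrow> X = V"
    by (rule bexE)
  have "x = 0" if s: "s > 0" and x: "eigvec T s x" and orth: "\<forall>v\<in>V. cinner x v = 0" for x s
  proof (rule ccontr)
    assume "x \<noteq> 0"
    define y where "y = scaleC (complex_of_real (inverse (norm x))) x"
    have ny: "norm y = 1"
      using \<open>x \<noteq> 0\<close> by (simp add: y_def norm_scaleC norm_inverse)
    have ey: "eigvec T s y"
      using x by (simp add: y_def compact_operator_scale[OF T] cadjoint_scale[OF T] mult.commute)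
    then have nTy: "norm (T y) = s"
      using eigvec_norm[OF T ey] s ny by simp
    have "orthonormal (insert y V)"
      using V orth ny by (intro orthonormal_insert) (auto simp: y_def cinner_scale_left)
    then have "insert y V \<in> ?A"
      using V ey nTy s by auto
    then have "y \<in> V"
      using bspec[OF max, of "insert y V"] by blast
    then have "cinner x y = 0"
      using orth by blast
    then have "cinner y y = 0"
      by (subst (1) y_def) (simp add: cinner_scale_left)
    then show False
      using ny by (simp add: cinner_self)
  qed
  then show ?thesis
    using V unfolding singular_system_def by blast
qed

lemma singular_systemD:
  assumes "singular_system T V"
  shows "orthonormal V" and "v \<in> V \<Longrightarrow> eigvec T (norm (T v)) v" and "v \<in> V \<Longrightarrow> norm (T v) > 0"
    and "s > 0 \<Longrightarrow> eigvec T s x \<Longrightarrow> (\<And>v. v \<in> V \<Longrightarrow> cinner x v = 0) \<Longrightarrow> x = 0"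
  using assms by (auto simp: singular_system_def)

lemma cinner_singular_images:
  assumes T: "compact_operator T" and V: "singular_system T V" and v: "v \<in> V"
  shows "cinner (T x) (T v) = complex_of_real ((norm (T v))\<^sup>2) * cinner x v"
  using singular_systemD(2)[OF V v] by (simp add: cinner_cadjoint[OF T] cinner_scale_right)

text \<open>
  Infinitely many singular values above a positive level would give a bounded sequence
  whose images under \<open>T\<close> are uniformly separated.
\<close>

lemma finite_large_singular:
  assumes T: "compact_operator T" and V: "singular_system T V" and t: "t > 0"
  shows "finite {v\<in>V. norm (T v) > t}"
proof (rule ccontr)
  assume "infinite {v\<in>V. norm (T v) > t}"
  then obtain f :: "nat \<Rightarrow> ell2" where f: "inj f" "range f \<subseteq> {v\<in>V. norm (T v) > t}"
    using infinite_countable_subset by blast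
  have fV: "f n \<in> V" "norm (T (f n)) > t" for n
    using f(2) by auto
  have "norm (f n) \<le> 1" for n
    using orthonormal_norm[OF singular_systemD(1)[OF V] fV(1)] by simp
  then obtain r :: "nat \<Rightarrow> nat" and y where r: "strict_mono r" "(\<lambda>n. T (f (r n))) \<longlonglongrightarrow> y"
    using compact_operator_convergent_subseq[OF T, of f] by blast
  have "Cauchy (\<lambda>n. T (f (r n)))"
    using r(2) by (rule LIMSEQ_imp_Cauchy)
  then obtain N where N: "\<And>m n. m \<ge> N \<Longrightarrow> n \<ge> N \<Longrightarrow> norm (T (f (r m)) - T (f (r n))) < t"
    using t unfolding Cauchy_iff by meson
  let ?u = "f (r N)" and ?v = "f (r (Suc N))"
  have ne: "?u \<noteq> ?v"
    using f(1) r(1) by (simp add: inj_eq strict_mono_eq)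
  have "cinner (T ?u) (- T ?v) = 0"
    using cinner_singular_images[OF T V fV(1), of ?u "r (Suc N)"]
      orthonormalD[OF singular_systemD(1)[OF V] fV(1) fV(1), of "r N" "r (Suc N)"] ne
      cinner_diff_right[of "T ?u" 0 "T ?v"] by simp
  from norm_add_orthogonal[OF this]
  have "(norm (T ?u - T ?v))\<^sup>2 = (norm (T ?u))\<^sup>2 + (norm (T ?v))\<^sup>2"
    by simp
  moreover have "(norm (T ?u))\<^sup>2 > t\<^sup>2"
    using fV(2)[of "r N"] t by (intro power_strict_mono) auto
  moreover have "(norm (T ?u - T ?v))\<^sup>2 < t\<^sup>2"
    using N[of N "Suc N"] by (intro power_strict_mono) auto
  ultimately show False
    by (smt (verit) zero_le_power2)
qed

text \<open>
  The heart of the spectral theorem. On the orthogonal complement of the large singular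
  vectors the operator norm is attained, because \<open>T\<^sup>*T\<close> sends a maximizing sequence
  asymptotically to a multiple of itself and is compact; a maximizer is an eigenvector, and
  so its eigenvalue cannot be large.
\<close>

lemma norm_le_orthogonal_to_large:
  assumes T: "compact_operator T" and V: "singular_system T V" and t: "t \<ge> 0"
    and x: "\<And>v. v \<in> V \<Longrightarrow> norm (T v) > t \<Longrightarrow> cinner x v = 0"
  shows "norm (T x) \<le> t * norm x"
proof (rule ccontr)
  assume contra: "\<not> norm (T x) \<le> t * norm x"
  define M where "M = {x. \<forall>v\<in>V. norm (T v) > t \<longrightarrow> cinner x v = 0}"
  define Z where "Z = (\<lambda>x. norm (T x)) ` {x\<in>M. norm x \<le> 1}"
  define \<sigma> where "\<sigma> = Sup Z"
  let ?A = "\<lambda>x. cadjoint T (T x)"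
  obtain K where K: "K > 0" "\<And>x. norm (T x) \<le> K * norm x"
    using compact_operator_bounded[OF T] by blast
  have Zb: "bdd_above Z"
  proof (rule bdd_aboveI[of _ K])
    fix z assume "z \<in> Z"
    then obtain u where u: "z = norm (T u)" "norm u \<le> 1"
      by (auto simp: Z_def)
    have "K * norm u \<le> K * 1"
      using u(2) K(1) by (intro mult_left_mono) auto
    with K(2)[of u] u(1) show "z \<le> K"
      by simp
  qed
  have Mscale: "scaleC c u \<in> M" if "u \<in> M" for c u
    using that by (auto simp: M_def cinner_scale_left)
  have M0: "x \<in> M"
    using x by (auto simp: M_def)
  have x0: "x \<noteq> 0"
    using contra by (auto simp: compact_operator_zero[OF T])
  have normalize: "norm (scaleC (complex_of_real (inverse (norm u))) u) = 1" if "u \<noteq> 0" for u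
    using that by (simp add: norm_scaleC norm_inverse)
  have inZ: "inverse (norm u) * norm (T u) \<in> Z" if "u \<in> M" "u \<noteq> 0" for u
    unfolding Z_def
    using Mscale[OF that(1)] normalize[OF that(2)]
    by (intro image_eqI[of _ _ "scaleC (complex_of_real (inverse (norm u))) u"])
       (auto simp: compact_operator_scale[OF T] norm_scaleC norm_inverse)
  have \<sigma>le: "norm (T u) \<le> \<sigma> * norm u" if "u \<in> M" for u
  proof (cases "u = 0")
    case False
    have "inverse (norm u) * norm (T u) \<le> \<sigma>"
      unfolding \<sigma>_def by (rule cSup_upper[OF inZ[OF that False] Zb])
    then show ?thesis
      using False by (simp add: field_simps)
  qed (simp add: compact_operator_zero[OF T])
  have \<sigma>t: "\<sigma> > t"
    using \<sigma>le[OF M0] contra by (smt (verit) mult_right_mono norm_ge_zero)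
  then have \<sigma>0: "\<sigma> > 0"
    using t by simp
  have "\<exists>u. u \<in> M \<and> norm u \<le> 1 \<and> norm (T u) > \<sigma> - inverse (real (Suc n))" for n
  proof -
    have "Z \<noteq> {}"
      using inZ[OF M0 x0] by blast
    then obtain z where "z \<in> Z" "z > \<sigma> - inverse (real (Suc n))"
      using less_cSup_iff[of Z "\<sigma> - inverse (real (Suc n))"] Zb unfolding \<sigma>_def
      by (metis diff_less_eq inverse_positive_iff_positive less_add_same_cancel1 of_nat_0_less_iff zero_less_Suc)
    then show ?thesis
      by (auto simp: Z_def)
  qed
  then obtain X where X: "\<And>n. X n \<in> M" "\<And>n. norm (X n) \<le> 1"
      "\<And>n. norm (T (X n)) > \<sigma> - inverse (real (Suc n))"
    by metis
  have TXle: "norm (T (X n)) \<le> \<sigma>" for n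
    using \<sigma>le[OF X(1)[of n]] X(2)[of n] \<sigma>0 by (smt (verit) mult_left_le)
  have lim: "(\<lambda>n. norm (T (X n))) \<longlonglongrightarrow> \<sigma>"
  proof (rule tendsto_sandwich)
    show "(\<lambda>n. \<sigma> - inverse (real (Suc n))) \<longlonglongrightarrow> \<sigma>"
      using tendsto_diff[OF tendsto_const[of \<sigma>] LIMSEQ_inverse_real_of_nat] by simp
    show "(\<lambda>n. \<sigma>) \<longlonglongrightarrow> \<sigma>" by simp
    show "\<forall>\<^sub>F n in sequentially. \<sigma> - inverse (real (Suc n)) \<le> norm (T (X n))"
      by (intro always_eventually allI less_imp_le X(3))
  qed (simp add: TXle)
  have AM: "?A u \<in> M" if "u \<in> M" for u
  proof -
    have "cinner (?A u) v = 0" if "v \<in> V" "norm (T v) > t" for v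
      using \<open>u \<in> M\<close> that cinner_singular_images[OF T V that(1), of u]
      by (simp add: cinner_cadjoint'[OF T] M_def)
    then show ?thesis
      by (auto simp: M_def)
  qed
  have Ale: "norm (?A u) \<le> \<sigma> * norm (T u)" if "u \<in> M" for u
  proof -
    have "(norm (?A u))\<^sup>2 = cmod (cinner (T (?A u)) (T u))"
      by (simp add: cinner_cadjoint[OF T] cinner_self norm_power)
    also have "\<dots> \<le> norm (T (?A u)) * norm (T u)"
      by (rule cmod_cinner_le)
    also have "\<dots> \<le> \<sigma> * norm (?A u) * norm (T u)"
      by (intro mult_right_mono \<sigma>le AM that) simp
    finally have "norm (?A u) * norm (?A u) \<le> norm (?A u) * (\<sigma> * norm (T u))"
      by (simp add: power2_eq_square mult_ac)
    then show ?thesis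
      using \<sigma>0 by (cases "?A u = 0") auto
  qed
  have diff: "(norm (?A (X n) - \<sigma>\<^sup>2 *\<^sub>R X n))\<^sup>2 \<le> \<sigma>\<^sup>2 * (\<sigma>\<^sup>2 - (norm (T (X n)))\<^sup>2)" for n
  proof -
    have i: "inner (?A (X n)) (X n) = (norm (T (X n)))\<^sup>2"
      by (simp add: inner_ell2_def cinner_cadjoint'[OF T] cinner_self)
    have "(norm (?A (X n)))\<^sup>2 \<le> (\<sigma> * norm (T (X n)))\<^sup>2"
      by (intro power_mono Ale X) simp
    moreover have "(\<sigma>\<^sup>2)\<^sup>2 * (norm (X n))\<^sup>2 \<le> (\<sigma>\<^sup>2)\<^sup>2 * 1"
      using X(2)[of n] by (intro mult_left_mono) (auto simp: power_le_one)
    moreover have "(norm (?A (X n) - \<sigma>\<^sup>2 *\<^sub>R X n))\<^sup>2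
        = (norm (?A (X n)))\<^sup>2 - 2 * \<sigma>\<^sup>2 * (norm (T (X n)))\<^sup>2 + (\<sigma>\<^sup>2)\<^sup>2 * (norm (X n))\<^sup>2"
      unfolding power2_norm_eq_inner
      by (simp add: inner_diff_left inner_diff_right i[unfolded power2_norm_eq_inner]
          inner_commute[of "X n" "?A (X n)"] power2_eq_square algebra_simps)
    ultimately show ?thesis
      by (simp add: power2_eq_square algebra_simps)
  qed
  have "(\<lambda>n. \<sigma>\<^sup>2 * (\<sigma>\<^sup>2 - (norm (T (X n)))\<^sup>2)) \<longlonglongrightarrow> \<sigma>\<^sup>2 * (\<sigma>\<^sup>2 - \<sigma>\<^sup>2)"
    by (intro tendsto_intros lim)
  then have lim0: "(\<lambda>n. \<sigma>\<^sup>2 * (\<sigma>\<^sup>2 - (norm (T (X n)))\<^sup>2)) \<longlonglongrightarrow> 0"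
    by simp
  have "(\<lambda>n. (norm (?A (X n) - \<sigma>\<^sup>2 *\<^sub>R X n))\<^sup>2) \<longlonglongrightarrow> 0"
    by (rule real_tendsto_sandwich[OF _ _ tendsto_const lim0]) (simp_all add: diff)
  then have "(\<lambda>n. sqrt ((norm (?A (X n) - \<sigma>\<^sup>2 *\<^sub>R X n))\<^sup>2)) \<longlonglongrightarrow> sqrt 0"
    by (rule tendsto_real_sqrt)
  then have small: "(\<lambda>n. ?A (X n) - \<sigma>\<^sup>2 *\<^sub>R X n) \<longlonglongrightarrow> 0"
    by (simp add: tendsto_norm_zero_iff)
  obtain r :: "nat \<Rightarrow> nat" and y where r: "strict_mono r" "(\<lambda>n. T (X (r n))) \<longlonglongrightarrow> y"
    by (rule compact_operator_convergent_subseq[OF T X(2)])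
  define u where "u = inverse (\<sigma>\<^sup>2) *\<^sub>R cadjoint T y"
  have lA: "(\<lambda>n. ?A (X (r n))) \<longlonglongrightarrow> cadjoint T y"
    by (rule cadjoint_tendsto[OF T r(2)])
  have "(\<lambda>n. ?A (X (r n)) - (?A (X (r n)) - \<sigma>\<^sup>2 *\<^sub>R X (r n))) \<longlonglongrightarrow> cadjoint T y - 0"
    using LIMSEQ_subseq_LIMSEQ[OF small r(1)] by (intro tendsto_diff lA) (simp add: o_def)
  then have "(\<lambda>n. inverse (\<sigma>\<^sup>2) *\<^sub>R (\<sigma>\<^sup>2 *\<^sub>R X (r n))) \<longlonglongrightarrow> u"
    unfolding u_def by (intro tendsto_scaleR tendsto_const) simp
  then have Xu: "(\<lambda>n. X (r n)) \<longlonglongrightarrow> u"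
    using \<sigma>0 by simp
  have "T u = y"
    using compact_operator_tendsto[OF T Xu] r(2) by (rule LIMSEQ_unique)
  then have eu: "eigvec T \<sigma> u"
    using \<sigma>0 by (simp add: u_def scaleR_eq_scaleC)
  have "norm (T u) = \<sigma>"
    using tendsto_norm[OF compact_operator_tendsto[OF T Xu]] LIMSEQ_subseq_LIMSEQ[OF lim r(1)]
    by (intro LIMSEQ_unique) (auto simp: o_def)
  moreover have "u = 0"
  proof (rule singular_systemD(4)[OF V \<sigma>0 eu])
    fix v assume v: "v \<in> V"
    show "cinner u v = 0"
    proof (cases "norm (T v) > t")
      case True
      then have "(\<lambda>n. cinner (X (r n)) v) = (\<lambda>n. 0)"
        using X(1) v by (auto simp: M_def)
      then show ?thesis
        using tendsto_cinner_left[OF Xu, of v] by (simp add: LIMSEQ_const_iff)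
    next
      case False
      then show ?thesis
        using \<sigma>t \<sigma>0 by (intro eigvec_orthogonal[OF T eu singular_systemD(2)[OF V v]]) auto
    qed
  qed
  ultimately show False
    using \<sigma>0 by (simp add: compact_operator_zero[OF T])
qed

text \<open>
  The images of the singular vectors in \<open>G\<close> are orthogonal to each other and to the image of the
  orthogonal complement of \<open>G\<close>.
\<close>

lemma norm_sq_singular_expansion:
  assumes T: "compact_operator T" and V: "singular_system T V" and G: "finite G" "G \<subseteq> V"
  shows "(norm (T x))\<^sup>2 = (\<Sum>v\<in>G. (norm (T v))\<^sup>2 * (cmod (cinner x v))\<^sup>2) + (norm (T (x - proj G x)))\<^sup>2"
proof -
  have oG: "orthonormal G"
    using singular_systemD(1)[OF V] G(2) by (rule orthonormal_subset)
  have TG: "T (proj G x) = (\<Sum>v\<in>G. scaleC (cinner x v) (T v))"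
    by (simp add: proj_def compact_operator_sum[OF T] compact_operator_scale[OF T])
  have "cinner (T (x - proj G x)) (T (proj G x)) = 0"
    using G cinner_singular_images[OF T V] cinner_residual[OF oG G(1)]
    by (simp add: TG cinner_sum_right cinner_scale_right subset_iff)
  from norm_add_orthogonal[OF this]
  have "(norm (T x))\<^sup>2 = (norm (T (x - proj G x)))\<^sup>2 + (norm (T (proj G x)))\<^sup>2"
    by (simp add: compact_operator_diff[OF T])
  moreover have "complex_of_real ((norm (T (proj G x)))\<^sup>2)
      = (\<Sum>v\<in>G. cnj (cinner x v) * cinner (T (proj G x)) (T v))"
    by (simp only: cinner_self[symmetric]) (subst (2) TG, simp add: cinner_sum_right cinner_scale_right)
  moreover have "\<dots> = (\<Sum>v\<in>G. complex_of_real ((norm (T v))\<^sup>2 * (cmod (cinner x v))\<^sup>2))"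
    using G cinner_singular_images[OF T V] cinner_proj[OF oG G(1)]
    by (intro sum.cong) (auto simp: complex_norm_square subset_iff mult_ac simp del: of_real_power)
  ultimately show ?thesis
    by (simp only: of_real_sum[symmetric] of_real_eq_iff)
qed

text \<open>
  Eigenvectors for different eigenvalues are orthogonal, so maximality of \<open>V\<close> can be tested in
  each eigenspace separately: the vectors of \<open>V\<close> with singular value \<open>s\<close> are a basis of the
  eigenspace for \<open>s\<^sup>2\<close>.
\<close>

lemma singular_value_mult_eq_card:
  assumes T: "compact_operator T" and V: "singular_system T V" and s: "s > 0"
  shows "finite {v\<in>V. norm (T v) = s}" and "singular_value_mult T s = card {v\<in>V. norm (T v) = s}"
proof -
  let ?B = "{v\<in>V. norm (T v) = s}"
  show fin: "finite ?B"
    by (rule finite_subset[OF _ finite_large_singular[OF T V, of "s / 2"]]) (use s in auto)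
  have oB: "orthonormal ?B"
    using singular_systemD(1)[OF V] by (rule orthonormal_subset) auto
  have eB: "eigvec T s v" if "v \<in> ?B" for v
    using singular_systemD(2)[OF V] that by auto
  have sub: "?B \<subseteq> {x. eigvec T s x}"
    using eB by auto
  have span: "{x. eigvec T s x} \<subseteq> ell2.span ?B"
  proof
    fix x assume "x \<in> {x. eigvec T s x}"
    then have x: "eigvec T s x" by simp
    define y where "y = x - proj ?B x"
    have "eigvec T s (proj ?B x)"
    proof (rule cinner_ext)
      fix z
      have "cinner z (cadjoint T (T (proj ?B x)))
          = (\<Sum>v\<in>?B. cnj (cinner x v) * cinner z (cadjoint T (T v)))"
        by (simp add: cinner_cadjoint[OF T, symmetric] proj_def compact_operator_sum[OF T]
            compact_operator_scale[OF T] cinner_sum_right cinner_scale_right)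
      also have "\<dots> = (\<Sum>v\<in>?B. cnj (cinner x v) * (complex_of_real (s\<^sup>2) * cinner z v))"
        by (intro sum.cong refl) (simp add: eB[simplified] cinner_scale_right)
      also have "\<dots> = cinner z (scaleC (complex_of_real (s\<^sup>2)) (proj ?B x))"
        by (simp add: proj_def cinner_sum_right cinner_scale_right sum_distrib_left mult_ac)
      finally show "cinner z (cadjoint T (T (proj ?B x)))
          = cinner z (scaleC (complex_of_real (s\<^sup>2)) (proj ?B x))" .
    qed
    then have y: "eigvec T s y"
      using x by (simp add: y_def compact_operator_diff[OF T] cadjoint_diff[OF T]
          ell2.scale_right_diff_distrib)
    have "y = 0"
    proof (rule singular_systemD(4)[OF V s y])
      fix v assume v: "v \<in> V"
      show "cinner y v = 0"
      proof (cases "norm (T v) = s")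
        case True
        then show ?thesis
          using v cinner_residual[OF oB fin, of v x] by (simp add: y_def)
      next
        case False
        then show ?thesis
          using s by (intro eigvec_orthogonal[OF T y singular_systemD(2)[OF V v]]) auto
      qed
    qed
    then have "x = proj ?B x"
      by (simp add: y_def)
    then show "x \<in> ell2.span ?B"
      using span_proj[OF fin, of x] by metis
  qed
  have "ell2.independent ?B"
  proof (rule ell2.independent_if_scalars_zero[OF fin])
    fix c v assume "(\<Sum>v\<in>?B. scaleC (c v) v) = 0" "v \<in> ?B"
    then show "c v = 0"
      using cinner_combination[OF oB fin, of v c] by simp
  qed
  with sub span show "singular_value_mult T s = card ?B"
    unfolding singular_value_mult_def by (intro ell2.dim_unique) auto
qed

lemma schatten_class_iff:
  assumes T: "compact_operator T" and V: "singular_system T V"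
  shows "T \<in> schatten_class p \<longleftrightarrow> (\<lambda>v. norm (T v) powr p) summable_on V"
proof -
  let ?B = "\<lambda>s. {v\<in>V. norm (T v) = s}" and ?f = "\<lambda>(s::real, v::ell2). s powr p"
  have bij: "bij_betw (\<lambda>v. (norm (T v), v)) V (Sigma {0<..} ?B)"
    using singular_systemD(3)[OF V] by (intro bij_betwI[of _ _ _ snd]) auto
  have pieces: "((\<lambda>v. ?f (s, v)) has_sum real (singular_value_mult T s) * s powr p) (?B s)"
    if "s \<in> {0<..}" for s
    using has_sum_finite[OF singular_value_mult_eq_card(1)[OF T V, of s], of "\<lambda>v. ?f (s, v)"] that
    by (simp add: singular_value_mult_eq_card(2)[OF T V])
  have "(\<lambda>v. norm (T v) powr p) summable_on V \<longleftrightarrow> ?f summable_on (Sigma {0<..} ?B)"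
    using summable_on_reindex_bij_betw[OF bij, of ?f] by simp
  also have "\<dots> \<longleftrightarrow> (\<lambda>s. real (singular_value_mult T s) * s powr p) summable_on {0<..}"
  proof
    assume "?f summable_on (Sigma {0<..} ?B)"
    then have "(\<lambda>s. infsum (\<lambda>v. s powr p) (?B s)) summable_on {0<..}"
      using summable_on_Sigma_banach[of "\<lambda>s v. s powr p"] by simp
    then show "(\<lambda>s. real (singular_value_mult T s) * s powr p) summable_on {0<..}"
      using infsumI[OF pieces] by (subst (asm) summable_on_cong) auto
  next
    assume "(\<lambda>s. real (singular_value_mult T s) * s powr p) summable_on {0<..}"
    then show "?f summable_on (Sigma {0<..} ?B)"
      by (intro summable_on_SigmaI[OF pieces]) auto
  qed
  finally show ?thesis
    using T by (simp add: schatten_class_def)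
qed

section \<open>Weights that turn truncated squares into powers\<close>

text \<open>
  Young's inequality for \<open>y\<^sup>p = (y\<^sup>2 x\<^bsup>p-2\<^esup>)\<^bsup>p/2\<^esup> (x\<^sup>p)\<^bsup>1-p/2\<^esup>\<close>.
\<close>

lemma powr_young:
  fixes p x y :: real
  assumes p: "0 < p" "p < 2" and y: "0 < y" and yx: "y \<le> x"
  shows "(2 / p) * y powr p \<le> y\<^sup>2 * x powr (p - 2) + ((2 - p) / p) * x powr p"
proof -
  have x: "x > 0"
    using y yx by simp
  have "(y\<^sup>2 * x powr (p - 2)) powr (p / 2) * (x powr p) powr (1 - p / 2)
      \<le> (p / 2) * (y\<^sup>2 * x powr (p - 2)) + (1 - p / 2) * x powr p"
    using p x y by (intro Youngs_inequality_0) auto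
  moreover have "(y\<^sup>2 * x powr (p - 2)) powr (p / 2) * (x powr p) powr (1 - p / 2) = y powr p"
  proof -
    have "(y\<^sup>2) powr (p / 2) = y powr p"
      using y by (simp add: powr_powr flip: powr_numeral)
    moreover have "x powr ((p - 2) * (p / 2)) * x powr (p * (1 - p / 2)) = 1"
    proof -
      have "(p - 2) * (p / 2) + p * (1 - p / 2) = 0"
        by (simp add: field_simps)
      then show ?thesis
        using x by (simp only: powr_add[symmetric]) simp
    qed
    ultimately show ?thesis
      using x y by (simp add: powr_mult powr_powr mult.assoc)
  qed
  ultimately have "y powr p \<le> (p / 2) * (y\<^sup>2 * x powr (p - 2)) + (1 - p / 2) * x powr p"
    by simp
  then have "(2 / p) * y powr p \<le> (2 / p) * ((p / 2) * (y\<^sup>2 * x powr (p - 2)) + (1 - p / 2) * x powr p)"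
    using p by (intro mult_left_mono) auto
  also have "\<dots> = y\<^sup>2 * x powr (p - 2) + ((2 - p) / p) * x powr p"
    using p by (simp add: field_simps)
  finally show ?thesis .
qed

lemma power2_mult_powr: "0 < x \<Longrightarrow> x\<^sup>2 * x powr (p - 2) = x powr (p::real)"
  by (simp add: powr_diff powr_numeral)

text \<open>
  A discrete form of the identity \<open>(2 - p) \<integral> t\<^bsup>p-3\<^esup> min(s, t)\<^sup>2 dt = (2/p) s\<^sup>p\<close>, with the integral over
  \<open>(0, \<infinity>)\<close>. The weight of a threshold is the mass that the density \<open>(2 - p) t\<^bsup>p-3\<^esup>\<close> gives to the
  interval up to the next larger threshold, or up to \<open>\<infinity>\<close>. The weights from \<open>y\<close> on then add up to the mass
  \<open>y\<^bsup>p-2\<^esup>\<close> of \<open>(y, \<infinity>)\<close>, and the weighted sum is a lower Riemann sum of the integral.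
\<close>

lemma threshold_weights:
  fixes p :: real
  assumes p: "0 < p" "p < 2" and X: "finite X" "\<And>x. x \<in> X \<Longrightarrow> 0 < x"
  shows "\<exists>w. (\<forall>x\<in>X. 0 \<le> w x)
    \<and> (\<forall>y\<in>X. (\<Sum>x | x \<in> X \<and> y \<le> x. w x) = y powr (p - 2))
    \<and> (\<forall>s\<ge>0. (\<Sum>x\<in>X. w x * (min s x)\<^sup>2) \<le> (2 / p) * s powr p)"
proof -
  \<comment> \<open>\<open>\<Psi> s y\<close> is the part of the integral over \<open>(y, \<infinity>)\<close>, evaluated\<close>
  define \<Psi> where "\<Psi> s y = (if s \<le> y then s\<^sup>2 * y powr (p - 2)
      else (2 / p) * s powr p - ((2 - p) / p) * y powr p)" for s y :: real
  have \<Psi>_le: "\<Psi> s y \<le> (2 / p) * s powr p" if "s \<ge> 0" "y > 0" for s y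
  proof (cases "s \<le> y")
    case True
    show ?thesis
    proof (cases "s = 0")
      case False
      have "s\<^sup>2 * y powr (p - 2) \<le> s\<^sup>2 * s powr (p - 2)"
        using that True False p by (intro mult_left_mono powr_mono2') auto
      also have "\<dots> = 1 * s powr p"
        using that False by (simp add: power2_mult_powr)
      also have "\<dots> \<le> (2 / p) * s powr p"
        using p by (intro mult_right_mono) auto
      finally show ?thesis
        using True by (simp add: \<Psi>_def)
    qed (use that in \<open>simp add: \<Psi>_def\<close>)
  qed (use p in \<open>simp add: \<Psi>_def\<close>)
  have step: "\<Psi> s m + (b powr (p - 2) - m powr (p - 2)) * (min s b)\<^sup>2 \<le> \<Psi> s b"
    if "s \<ge> 0" "0 < b" "b < m" for s b m
  proof -
    have young: "b\<^sup>2 * (b powr (p - 2) - x powr (p - 2)) \<le> ((2 - p) / p) * (x powr p - b powr p)"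
      if "b \<le> x" for x
    proof -
      have "(2 / p) * b powr p = b powr p + ((2 - p) / p) * b powr p"
        using p by (simp add: field_simps)
      then show ?thesis
        using powr_young[OF p \<open>0 < b\<close> that] power2_mult_powr[OF \<open>0 < b\<close>, of p]
        by (simp add: right_diff_distrib)
    qed
    \<comment> \<open>in the middle case the truncation level \<open>s\<close> separates \<open>m\<close> from \<open>b\<close>\<close>
    consider "s \<le> b" | "b < s" "s \<le> m" | "m < s"
      by linarith
    then show ?thesis
    proof cases
      case 1
      then show ?thesis
        using that by (simp add: \<Psi>_def algebra_simps)
    next
      case 2
      have sp: "s > 0"
        using 2 that by simp
      have "(s\<^sup>2 - b\<^sup>2) * m powr (p - 2) \<le> (s\<^sup>2 - b\<^sup>2) * s powr (p - 2)"
        using 2 that p sp by (intro mult_left_mono powr_mono2') (auto simp: power_mono)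
      then have "s\<^sup>2 * m powr (p - 2) + (b powr (p - 2) - m powr (p - 2)) * b\<^sup>2
          \<le> s powr p + b\<^sup>2 * (b powr (p - 2) - s powr (p - 2))"
        using power2_mult_powr[OF sp, of p] by (simp add: algebra_simps)
      also have "\<dots> \<le> s powr p + ((2 - p) / p) * (s powr p - b powr p)"
        using 2 by (intro add_left_mono young) simp
      also have "\<dots> = (2 / p) * s powr p - ((2 - p) / p) * b powr p"
        using p by (simp add: field_simps)
      finally show ?thesis
        using 2 that by (simp add: \<Psi>_def)
    next
      case 3
      have "(b powr (p - 2) - m powr (p - 2)) * b\<^sup>2
          \<le> ((2 - p) / p) * m powr p - ((2 - p) / p) * b powr p"
        using young[OF less_imp_le[OF that(3)]]
        by (simp only: right_diff_distrib mult.commute[of _ "b\<^sup>2"])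
      then show ?thesis
        using 3 that unfolding \<Psi>_def by simp
    qed
  qed
  have *: "X \<noteq> {} \<longrightarrow> (\<exists>w. (\<forall>x\<in>X. 0 \<le> w x)
    \<and> (\<forall>y\<in>X. (\<Sum>x | x \<in> X \<and> y \<le> x. w x) = y powr (p - 2))
    \<and> (\<forall>s\<ge>0. (\<Sum>x\<in>X. w x * (min s x)\<^sup>2) \<le> \<Psi> s (Min X)))"
    using X
  proof (induction X rule: finite_linorder_min_induct)
    case (insert b A)
    have b: "b > 0" "b \<notin> A"
      using insert by auto
    show ?case
    proof (cases "A = {}")
      case True
      have "b powr (p - 2) * (min s b)\<^sup>2 \<le> \<Psi> s b" if "s \<ge> 0" for s
      proof (cases "s \<le> b")
        case False
        have "b powr p \<le> s powr p"
          using False b p by (intro powr_mono2) auto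
        then have "(2 / p) * b powr p \<le> (2 / p) * s powr p"
          using p by (intro mult_left_mono) auto
        moreover have "(2 / p) * b powr p = b powr p + ((2 - p) / p) * b powr p"
          using p by (simp add: field_simps)
        ultimately show ?thesis
          using False b power2_mult_powr[OF b(1), of p] by (simp add: \<Psi>_def mult.commute)
      qed (simp add: \<Psi>_def mult.commute)
      moreover have "{x. x = b \<and> b \<le> x} = {b}"
        by auto
      ultimately show ?thesis
        using True by (intro impI exI[of _ "\<lambda>_. b powr (p - 2)"]) auto
    next
      case False
      define m where "m = Min A"
      have m: "m \<in> A" "b < m" "\<And>a. a \<in> A \<Longrightarrow> m \<le> a"
        using False insert.hyps by (auto simp: m_def)
      obtain w where w: "\<forall>x\<in>A. 0 \<le> w x"
        "\<forall>y\<in>A. (\<Sum>x | x \<in> A \<and> y \<le> x. w x) = y powr (p - 2)"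
        "\<forall>s\<ge>0. (\<Sum>x\<in>A. w x * (min s x)\<^sup>2) \<le> \<Psi> s m"
        using insert.IH insert.prems False unfolding m_def by auto
      define w' where "w' = w(b := b powr (p - 2) - m powr (p - 2))"
      have w'A: "w' x = w x" if "x \<in> A" for x
        using that b by (auto simp: w'_def)
      have "{x. x \<in> A \<and> m \<le> x} = A"
        using m by auto
      then have total: "sum w A = m powr (p - 2)"
        using w(2) m(1) by metis
      have "0 \<le> w' x" if "x \<in> insert b A" for x
        using that w(1) w'A m(2) b p by (auto simp: w'_def intro!: powr_mono2')
      moreover have "(\<Sum>x | x \<in> insert b A \<and> y \<le> x. w' x) = y powr (p - 2)" if y: "y \<in> insert b A" for y
      proof (cases "y = b")
        case True
        then have "{x. x \<in> insert b A \<and> y \<le> x} = insert b A"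
          using insert.hyps by auto
        then have "(\<Sum>x | x \<in> insert b A \<and> y \<le> x. w' x) = w' b + (\<Sum>x\<in>A. w x)"
          using insert.hyps b w'A by simp
        then show ?thesis
          using True total by (simp add: w'_def)
      next
        case False
        then have "{x. x \<in> insert b A \<and> y \<le> x} = {x. x \<in> A \<and> y \<le> x}" "y \<in> A"
          using insert.hyps y by auto
        moreover have "(\<Sum>x | x \<in> A \<and> y \<le> x. w' x) = (\<Sum>x | x \<in> A \<and> y \<le> x. w x)"
          by (intro sum.cong) (auto simp: w'A)
        ultimately show ?thesis
          using w(2) by auto
      qed
      moreover have "(\<Sum>x\<in>insert b A. w' x * (min s x)\<^sup>2) \<le> \<Psi> s b" if "s \<ge> 0" for s
      proof -
        have "(\<Sum>x\<in>insert b A. w' x * (min s x)\<^sup>2)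
            = (b powr (p - 2) - m powr (p - 2)) * (min s b)\<^sup>2 + (\<Sum>x\<in>A. w x * (min s x)\<^sup>2)"
          using insert.hyps b w'A by (simp add: w'_def)
        also have "\<dots> \<le> (b powr (p - 2) - m powr (p - 2)) * (min s b)\<^sup>2 + \<Psi> s m"
          using w(3) that by simp
        also have "\<dots> \<le> \<Psi> s b"
          using step[OF that b(1) m(2)] by simp
        finally show ?thesis .
      qed
      moreover have "Min (insert b A) = b"
        using insert.hyps by (intro Min_eqI) auto
      ultimately show ?thesis
        by (intro impI exI[of _ w']) simp
    qed
  qed simp
  show ?thesis
  proof (cases "X = {}")
    case False
    then have "Min X > 0"
      using X by auto
    obtain w where w: "\<forall>x\<in>X. 0 \<le> w x"
      "\<forall>y\<in>X. (\<Sum>x | x \<in> X \<and> y \<le> x. w x) = y powr (p - 2)"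
      "\<forall>s\<ge>0. (\<Sum>x\<in>X. w x * (min s x)\<^sup>2) \<le> \<Psi> s (Min X)"
      using False * by blast
    moreover have "(\<Sum>x\<in>X. w x * (min s x)\<^sup>2) \<le> (2 / p) * s powr p" if "s \<ge> 0" for s
      using w(3) that \<Psi>_le[OF that \<open>Min X > 0\<close>] order_trans by blast
    ultimately show ?thesis
      by blast
  qed (use p in simp)
qed

section \<open>Comparing truncated singular values with finite-rank approximations\<close>

text \<open>
  How much of the Hilbert-Schmidt norm of \<open>W\<close> a matrix \<open>F\<close> of rank \<open>r\<close> can absorb. Let \<open>K\<close> be the
  projection onto the row space of \<open>F\<close> and \<open>M\<close> the Gram matrix of the columns of \<open>W\<close>. Outside the row
  space, \<open>W\<close> and \<open>W - F\<close> agree. Inside it, \<open>W\<close> has squared norm \<open>tr (M K)\<close>, and the squared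
  Hilbert-Schmidt norm of \<open>K\<close> is at most \<open>r\<close>; weighting \<open>\<bar>M\<^sub>j\<^sub>k\<bar>\<^sup>2\<close> by \<open>1/(4 \<tau>\<^sup>2)\<close> and
  \<open>\<bar>K\<^sub>j\<^sub>k\<bar>\<^sup>2\<close> by \<open>\<tau>\<^sup>2\<close> bounds the product.
\<close>

lemma sum_sq_le_rank_error:
  fixes W F :: "nat \<Rightarrow> nat \<Rightarrow> complex" and y :: "'v \<Rightarrow> nat \<Rightarrow> complex" and \<tau> :: real
  assumes R: "finite R" and S: "finite S" and B: "finite B" and \<tau>: "\<tau> > 0"
    and F: "\<And>i j. F i j = (\<Sum>v\<in>B. z v i * y v j)"
  shows "(\<Sum>i\<in>R. \<Sum>j\<in>S. (cmod (W i j))\<^sup>2) \<le> (\<Sum>i\<in>R. \<Sum>j\<in>S. (cmod (W i j - F i j))\<^sup>2)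
      + \<tau>\<^sup>2 * card B + (\<Sum>j\<in>S. \<Sum>k\<in>S. (cmod (\<Sum>i\<in>R. W i j * cnj (W i k)))\<^sup>2) / (4 * \<tau>\<^sup>2)"
proof -
  let ?u = "\<lambda>c. \<Sum>j\<in>S. scaleC (c j) (unit_vec j)"
  define w where "w i = ?u (W i)" for i
  define f where "f i = ?u (F i)" for i
  obtain E where E: "finite E" "orthonormal E" "card E \<le> card ((\<lambda>v. ?u (y v)) ` B)"
    "(\<lambda>v. ?u (y v)) ` B \<subseteq> ell2.span E"
    using gram_schmidt[of "(\<lambda>v. ?u (y v)) ` B"] B by blast
  have cardE: "card E \<le> card B"
    using E(3) card_image_le[OF B, of "\<lambda>v. ?u (y v)"] by simp
  have f: "f i = (\<Sum>v\<in>B. scaleC (z v i) (?u (y v)))" for i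
  proof -
    have "f i = (\<Sum>j\<in>S. \<Sum>v\<in>B. scaleC (z v i) (scaleC (y v j) (unit_vec j)))"
      by (simp add: f_def F ell2.scale_sum_left)
    also have "\<dots> = (\<Sum>v\<in>B. \<Sum>j\<in>S. scaleC (z v i) (scaleC (y v j) (unit_vec j)))"
      by (rule sum.swap)
    finally show ?thesis
      by (simp only: ell2.scale_sum_right)
  qed
  have fE: "f i \<in> ell2.span E" for i
    unfolding f using E(4) by (rule_tac ell2.span_sum, rule_tac ell2.span_scale) blast
  have wf: "w i - f i = ?u (\<lambda>j. W i j - F i j)" for i
    by (simp add: w_def f_def sum_subtractf ell2.scale_left_diff_distrib)
  have row: "(\<Sum>j\<in>S. (cmod (W i j))\<^sup>2)
      \<le> (\<Sum>e\<in>E. (cmod (cinner (w i) e))\<^sup>2) + (\<Sum>j\<in>S. (cmod (W i j - F i j))\<^sup>2)" for i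
    using residual_le_dist_span[OF E(2,1) fE, of "w i" i] norm_sq_unit_combination[OF S]
    by (simp add: wf) (simp add: w_def)
  define M where "M j k = (\<Sum>i\<in>R. W i j * cnj (W i k))" for j k
  define K where "K j k = (\<Sum>e\<in>E. cnj (coord e j) * coord e k)" for j k
  have cinner_w: "cinner (w i) e = (\<Sum>j\<in>S. W i j * cnj (coord e j))" for i e
    by (simp add: w_def cinner_sum_left cinner_scale_left cinner_commute[of "unit_vec _"] cinner_unit_vec)
  have "complex_of_real (\<Sum>i\<in>R. \<Sum>e\<in>E. (cmod (cinner (w i) e))\<^sup>2) = (\<Sum>j\<in>S. \<Sum>k\<in>S. M j k * K j k)"
  proof -
    have "complex_of_real (\<Sum>i\<in>R. \<Sum>e\<in>E. (cmod (cinner (w i) e))\<^sup>2)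
        = (\<Sum>i\<in>R. \<Sum>e\<in>E. \<Sum>j\<in>S. \<Sum>k\<in>S. W i j * cnj (W i k) * (cnj (coord e j) * coord e k))"
      by (simp only: of_real_sum complex_norm_square cinner_w cnj_sum sum_product)
         (simp add: mult_ac)
    also have "\<dots> = (\<Sum>i\<in>R. \<Sum>j\<in>S. \<Sum>e\<in>E. \<Sum>k\<in>S. W i j * cnj (W i k) * (cnj (coord e j) * coord e k))"
      by (intro sum.cong refl sum.swap)
    also have "\<dots> = (\<Sum>i\<in>R. \<Sum>j\<in>S. \<Sum>k\<in>S. W i j * cnj (W i k) * K j k)"
      unfolding K_def sum_distrib_left by (intro sum.cong refl sum.swap)
    also have "\<dots> = (\<Sum>j\<in>S. \<Sum>i\<in>R. \<Sum>k\<in>S. W i j * cnj (W i k) * K j k)"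
      by (rule sum.swap)
    also have "\<dots> = (\<Sum>j\<in>S. \<Sum>k\<in>S. M j k * K j k)"
      unfolding M_def sum_distrib_right by (intro sum.cong refl sum.swap)
    finally show ?thesis .
  qed
  from arg_cong[OF this, of cmod]
  have "(\<Sum>i\<in>R. \<Sum>e\<in>E. (cmod (cinner (w i) e))\<^sup>2) = cmod (\<Sum>j\<in>S. \<Sum>k\<in>S. M j k * K j k)"
    unfolding norm_of_real by (simp add: sum_nonneg)
  also have "\<dots> \<le> (\<Sum>j\<in>S. \<Sum>k\<in>S. cmod (M j k) * cmod (K j k))"
    by (intro order_trans[OF norm_sum] sum_mono) (simp add: norm_mult)
  also have "\<dots> \<le> (\<Sum>j\<in>S. \<Sum>k\<in>S. (cmod (M j k))\<^sup>2 / (4 * \<tau>\<^sup>2) + \<tau>\<^sup>2 * (cmod (K j k))\<^sup>2)"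
  proof (intro sum_mono)
    fix j k
    have "2 * (cmod (M j k) / (2 * \<tau>)) * (\<tau> * cmod (K j k))
        \<le> (cmod (M j k) / (2 * \<tau>))\<^sup>2 + (\<tau> * cmod (K j k))\<^sup>2"
      by (rule sum_squares_bound)
    then show "cmod (M j k) * cmod (K j k) \<le> (cmod (M j k))\<^sup>2 / (4 * \<tau>\<^sup>2) + \<tau>\<^sup>2 * (cmod (K j k))\<^sup>2"
      using \<tau> by (simp add: power_mult_distrib power_divide)
  qed
  also have "\<dots> = (\<Sum>j\<in>S. \<Sum>k\<in>S. (cmod (M j k))\<^sup>2) / (4 * \<tau>\<^sup>2) + \<tau>\<^sup>2 * (\<Sum>j\<in>S. \<Sum>k\<in>S. (cmod (K j k))\<^sup>2)"
    by (simp add: sum.distrib sum_distrib_left sum_divide_distrib)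
  also have "\<dots> \<le> (\<Sum>j\<in>S. \<Sum>k\<in>S. (cmod (M j k))\<^sup>2) / (4 * \<tau>\<^sup>2) + \<tau>\<^sup>2 * card B"
  proof (intro add_left_mono mult_left_mono)
    have "(\<Sum>k\<in>S. (cmod (K j k))\<^sup>2) \<le> (\<Sum>e\<in>E. (cmod (coord e j))\<^sup>2)" for j
    proof -
      have "K j k = coord (\<Sum>e\<in>E. scaleC (cnj (coord e j)) e) k" for k
        by (simp add: K_def coord_sum scaleC.rep_eq)
      then have "(\<Sum>k\<in>S. (cmod (K j k))\<^sup>2) \<le> (norm (\<Sum>e\<in>E. scaleC (cnj (coord e j)) e))\<^sup>2"
        using sum_coord_sq_le[OF S] by simp
      then show ?thesis
        by (simp add: norm_sq_combination[OF E(2,1)])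
    qed
    then have "(\<Sum>j\<in>S. \<Sum>k\<in>S. (cmod (K j k))\<^sup>2) \<le> (\<Sum>j\<in>S. \<Sum>e\<in>E. (cmod (coord e j))\<^sup>2)"
      by (intro sum_mono)
    also have "\<dots> = (\<Sum>e\<in>E. \<Sum>j\<in>S. (cmod (coord e j))\<^sup>2)"
      by (rule sum.swap)
    also have "\<dots> \<le> (\<Sum>e\<in>E. 1)"
      using sum_coord_sq_le[OF S] orthonormal_norm[OF E(2)] by (intro sum_mono) (metis one_power2)
    finally show "(\<Sum>j\<in>S. \<Sum>k\<in>S. (cmod (K j k))\<^sup>2) \<le> real (card B)"
      using cardE by simp
  qed simp
  finally have "(\<Sum>i\<in>R. \<Sum>e\<in>E. (cmod (cinner (w i) e))\<^sup>2)
      \<le> (\<Sum>j\<in>S. \<Sum>k\<in>S. (cmod (M j k))\<^sup>2) / (4 * \<tau>\<^sup>2) + \<tau>\<^sup>2 * card B" .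
  moreover have "(\<Sum>i\<in>R. \<Sum>j\<in>S. (cmod (W i j))\<^sup>2) \<le> (\<Sum>i\<in>R. \<Sum>e\<in>E. (cmod (cinner (w i) e))\<^sup>2)
      + (\<Sum>i\<in>R. \<Sum>j\<in>S. (cmod (W i j - F i j))\<^sup>2)"
    unfolding sum.distrib[symmetric] by (intro sum_mono row)
  ultimately show ?thesis
    by (simp add: M_def)
qed

text \<open>
  Here \<open>F\<close> is \<open>T\<close> composed with the projection onto the singular vectors with singular value above
  \<open>\<tau>\<close>. The cutoff \<open>\<tau>'\<close> keeps all sums finite; it costs \<open>\<tau>'\<^sup>2\<close> per column and tends to \<open>0\<close> in the
  application.
\<close>

lemma submatrix_le_truncated_singular_values:
  fixes \<tau> \<tau>' :: real
  assumes T: "compact_operator T" and V: "singular_system T V"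
    and R: "finite R" and S: "finite S" and \<tau>: "0 < \<tau>'" "\<tau>' \<le> \<tau>"
    and W: "\<And>i j. W i j = coord (T (unit_vec j)) i"
  shows "(\<Sum>i\<in>R. \<Sum>j\<in>S. (cmod (W i j))\<^sup>2)
      \<le> (\<Sum>v | v \<in> V \<and> norm (T v) > \<tau>'. (min (norm (T v)) \<tau>)\<^sup>2) + card S * \<tau>'\<^sup>2
       + (\<Sum>j\<in>S. \<Sum>k\<in>S. (cmod (\<Sum>i\<in>R. W i j * cnj (W i k)))\<^sup>2) / (4 * \<tau>\<^sup>2)"
proof -
  define G where "G = {v\<in>V. norm (T v) > \<tau>'}"
  define B where "B = {v\<in>G. norm (T v) > \<tau>}"
  have fG: "finite G" and GV: "G \<subseteq> V"
    using finite_large_singular[OF T V \<tau>(1)] by (auto simp: G_def)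
  have fB: "finite B" and BV: "B \<subseteq> V" and BG: "B \<subseteq> G"
    using fG GV by (auto simp: B_def)
  have oG: "orthonormal G"
    by (rule orthonormal_subset[OF singular_systemD(1)[OF V] GV])
  define F where "F i j = (\<Sum>v\<in>B. coord (T v) i * cnj (coord v j))" for i j
  have F: "F i j = coord (T (proj B (unit_vec j))) i" for i j
    by (simp add: F_def proj_def compact_operator_sum[OF T] compact_operator_scale[OF T] coord_sum
        scaleC.rep_eq cinner_commute[of "unit_vec _"] cinner_unit_vec mult.commute)
  have unit: "(cmod (cinner (unit_vec j) v))\<^sup>2 = (cmod (coord v j))\<^sup>2" for j v
    by (subst cinner_commute) (simp add: cinner_unit_vec)
  have col: "(\<Sum>i\<in>R. (cmod (W i j - F i j))\<^sup>2)
      \<le> (\<Sum>v\<in>G - B. (norm (T v))\<^sup>2 * (cmod (coord v j))\<^sup>2) + \<tau>'\<^sup>2" for j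
  proof -
    let ?e = "unit_vec j"
    have "(\<Sum>i\<in>R. (cmod (W i j - F i j))\<^sup>2) \<le> (norm (T (?e - proj B ?e)))\<^sup>2"
      using sum_coord_sq_le[OF R, of "T (?e - proj B ?e)"]
      by (simp add: W F compact_operator_diff[OF T] minus_ell2.rep_eq)
    also have "\<dots> = (\<Sum>v\<in>G - B. (norm (T v))\<^sup>2 * (cmod (coord v j))\<^sup>2) + (norm (T (?e - proj G ?e)))\<^sup>2"
      using norm_sq_singular_expansion[OF T V fG GV, of ?e] norm_sq_singular_expansion[OF T V fB BV, of ?e]
      by (simp add: unit sum_diff[OF fG BG])
    also have "(norm (T (?e - proj G ?e)))\<^sup>2 \<le> (\<tau>' * 1)\<^sup>2"
    proof (rule power_mono)
      have "norm (T (?e - proj G ?e)) \<le> \<tau>' * norm (?e - proj G ?e)"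
        using \<tau> cinner_residual[OF oG fG, of _ ?e]
        by (intro norm_le_orthogonal_to_large[OF T V]) (auto simp: G_def)
      also have "norm (?e - proj G ?e) \<le> 1"
        using norm_residual_le[OF oG fG, of ?e] by (simp add: abs_square_le_1)
      finally show "norm (T (?e - proj G ?e)) \<le> \<tau>' * 1"
        using \<tau> by (simp add: mult_left_mono)
    qed simp
    finally show ?thesis
      by simp
  qed
  have "(\<Sum>i\<in>R. \<Sum>j\<in>S. (cmod (W i j - F i j))\<^sup>2) = (\<Sum>j\<in>S. \<Sum>i\<in>R. (cmod (W i j - F i j))\<^sup>2)"
    by (rule sum.swap)
  also have "\<dots> \<le> (\<Sum>j\<in>S. (\<Sum>v\<in>G - B. (norm (T v))\<^sup>2 * (cmod (coord v j))\<^sup>2) + \<tau>'\<^sup>2)"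
    by (intro sum_mono col)
  also have "\<dots> = (\<Sum>v\<in>G - B. (norm (T v))\<^sup>2 * (\<Sum>j\<in>S. (cmod (coord v j))\<^sup>2)) + card S * \<tau>'\<^sup>2"
    unfolding sum.distrib sum_distrib_left by (subst sum.swap) simp
  also have "\<dots> \<le> (\<Sum>v\<in>G - B. (norm (T v))\<^sup>2 * 1) + card S * \<tau>'\<^sup>2"
  proof (intro add_right_mono sum_mono mult_left_mono)
    fix v assume "v \<in> G - B"
    then show "(\<Sum>j\<in>S. (cmod (coord v j))\<^sup>2) \<le> 1"
      using sum_coord_sq_le[OF S, of v] orthonormal_norm[OF oG, of v] by simp
  qed simp
  finally have err: "(\<Sum>i\<in>R. \<Sum>j\<in>S. (cmod (W i j - F i j))\<^sup>2)
      \<le> (\<Sum>v\<in>G - B. (norm (T v))\<^sup>2) + card S * \<tau>'\<^sup>2"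
    by simp
  have "(\<Sum>v\<in>G. (min (norm (T v)) \<tau>)\<^sup>2)
      = (\<Sum>v\<in>G - B. (min (norm (T v)) \<tau>)\<^sup>2) + (\<Sum>v\<in>B. (min (norm (T v)) \<tau>)\<^sup>2)"
    by (rule sum.subset_diff[OF BG fG])
  also have "(\<Sum>v\<in>B. (min (norm (T v)) \<tau>)\<^sup>2) = (\<Sum>v\<in>B. \<tau>\<^sup>2)"
    by (intro sum.cong) (auto simp: B_def)
  also have "(\<Sum>v\<in>G - B. (min (norm (T v)) \<tau>)\<^sup>2) = (\<Sum>v\<in>G - B. (norm (T v))\<^sup>2)"
    by (intro sum.cong) (auto simp: B_def)
  finally have "(\<Sum>v\<in>G. (min (norm (T v)) \<tau>)\<^sup>2) = (\<Sum>v\<in>G - B. (norm (T v))\<^sup>2) + card B * \<tau>\<^sup>2"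
    by simp
  with err sum_sq_le_rank_error[where W = W and F = F, OF R S fB order.strict_trans2[OF \<tau>] F_def]
  show ?thesis
    by (simp add: G_def mult.commute)
qed

text \<open>
  Conversely, let \<open>T\<close> agree with a Hilbert-Schmidt matrix, with conjugated rows \<open>c i\<close>, on the
  orthogonal complement of \<open>E\<close>. On the complement the truncated squares are controlled by that
  matrix, and by Bessel's inequality each vector of \<open>E\<close> accounts for at most \<open>\<tau>\<^sup>2\<close>.
\<close>

lemma truncated_singular_values_le:
  assumes T: "compact_operator T" and V: "singular_system T V"
    and G: "finite G" "G \<subseteq> V" and E: "finite E" "orthonormal E" and \<tau>: "\<tau> \<ge> 0"
    and c: "\<And>x i. (\<And>e. e \<in> E \<Longrightarrow> cinner x e = 0) \<Longrightarrow> coord (T x) i = cinner x (c i)"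
    and HS: "summable (\<lambda>i. (norm (c i))\<^sup>2)"
  shows "(\<Sum>v\<in>G. (min (norm (T v)) \<tau>)\<^sup>2) \<le> (\<Sum>i. (norm (c i))\<^sup>2) + \<tau>\<^sup>2 * card E"
proof -
  let ?m = "\<lambda>v. (min (norm (T v)) \<tau>)\<^sup>2" and ?r = "\<lambda>x. x - proj E x"
  have oG: "orthonormal G"
    by (rule orthonormal_subset[OF singular_systemD(1)[OF V] G(2)])
  have swap: "cinner (?r x) y = cinner x (?r y)" for x y
    by (simp add: cinner_diff_left cinner_diff_right cinner_proj_swap)
  have HS': "summable (\<lambda>i. (norm (?r (c i)))\<^sup>2)"
    by (rule summable_comparison_test'[OF HS, of 0]) (simp add: norm_residual_le[OF E(2,1)])
  have column: "(\<Sum>v\<in>G. ?m v * (cmod (cinner (unit_vec j) (?r v)))\<^sup>2)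
      \<le> (\<Sum>i. (cmod (cinner (unit_vec j) (?r (c i))))\<^sup>2)"
    and column_summable: "summable (\<lambda>i. (cmod (cinner (unit_vec j) (?r (c i))))\<^sup>2)" for j
  proof -
    let ?x = "?r (unit_vec j)"
    have sums: "(\<lambda>i. (cmod (cinner (unit_vec j) (?r (c i))))\<^sup>2) sums (norm (T ?x))\<^sup>2"
      using norm_sq_sums[of "T ?x"] c[OF cinner_residual[OF E(2,1)], of "unit_vec j"] by (simp add: swap)
    then show "summable (\<lambda>i. (cmod (cinner (unit_vec j) (?r (c i))))\<^sup>2)"
      by (simp add: sums_iff)
    have "(\<Sum>v\<in>G. ?m v * (cmod (cinner (unit_vec j) (?r v)))\<^sup>2)
        \<le> (\<Sum>v\<in>G. (norm (T v))\<^sup>2 * (cmod (cinner ?x v))\<^sup>2)"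
      unfolding swap using \<tau> by (intro sum_mono mult_right_mono power_mono) auto
    also have "\<dots> \<le> (norm (T ?x))\<^sup>2"
      using norm_sq_singular_expansion[OF T V G, of ?x] by simp
    finally show "(\<Sum>v\<in>G. ?m v * (cmod (cinner (unit_vec j) (?r v)))\<^sup>2)
        \<le> (\<Sum>i. (cmod (cinner (unit_vec j) (?r (c i))))\<^sup>2)"
      using sums by (simp add: sums_iff)
  qed
  have partial: "(\<Sum>v\<in>G. ?m v * (\<Sum>j<n. (cmod (cinner (unit_vec j) (?r v)))\<^sup>2)) \<le> (\<Sum>i. (norm (c i))\<^sup>2)" for n
  proof -
    have "(\<Sum>v\<in>G. ?m v * (\<Sum>j<n. (cmod (cinner (unit_vec j) (?r v)))\<^sup>2))
        = (\<Sum>j<n. \<Sum>v\<in>G. ?m v * (cmod (cinner (unit_vec j) (?r v)))\<^sup>2)"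
      unfolding sum_distrib_left by (rule sum.swap)
    also have "\<dots> \<le> (\<Sum>j<n. \<Sum>i. (cmod (cinner (unit_vec j) (?r (c i))))\<^sup>2)"
      by (intro sum_mono column)
    also have "\<dots> = (\<Sum>i. \<Sum>j<n. (cmod (cinner (unit_vec j) (?r (c i))))\<^sup>2)"
      by (rule suminf_sum[symmetric]) (rule column_summable)
    also have "\<dots> \<le> (\<Sum>i. (norm (?r (c i)))\<^sup>2)"
    proof (rule suminf_le)
      show "(\<Sum>j<n. (cmod (cinner (unit_vec j) (?r (c i))))\<^sup>2) \<le> (norm (?r (c i)))\<^sup>2" for i
        using sum_le_suminf[OF sums_summable[OF norm_sq_sums_unit_vec'], of "{..<n}" "?r (c i)"]
          norm_sq_sums_unit_vec'[of "?r (c i)"] by (simp add: sums_iff)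
    qed (intro summable_sum column_summable HS')+
    also have "\<dots> \<le> (\<Sum>i. (norm (c i))\<^sup>2)"
      by (intro suminf_le HS HS' norm_residual_le[OF E(2,1)])
    finally show ?thesis .
  qed
  have "(\<lambda>n. \<Sum>v\<in>G. ?m v * (\<Sum>j<n. (cmod (cinner (unit_vec j) (?r v)))\<^sup>2))
      \<longlonglongrightarrow> (\<Sum>v\<in>G. ?m v * (norm (?r v))\<^sup>2)"
    using norm_sq_sums_unit_vec' unfolding sums_def by (intro tendsto_sum tendsto_mult tendsto_const)
  then have le: "(\<Sum>v\<in>G. ?m v * (norm (?r v))\<^sup>2) \<le> (\<Sum>i. (norm (c i))\<^sup>2)"
    by (rule LIMSEQ_le_const2) (use partial in blast)
  have "(\<Sum>v\<in>G. ?m v) = (\<Sum>v\<in>G. ?m v * (norm v)\<^sup>2)"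
    using orthonormal_norm[OF oG] by simp
  also have "\<dots> = (\<Sum>v\<in>G. ?m v * (norm (?r v))\<^sup>2) + (\<Sum>v\<in>G. \<Sum>e\<in>E. ?m v * (cmod (cinner v e))\<^sup>2)"
    unfolding sum.distrib[symmetric]
    by (intro sum.cong refl) (subst pythagoras_proj[OF E(2,1)], simp add: algebra_simps sum_distrib_left)
  also have "(\<Sum>v\<in>G. \<Sum>e\<in>E. ?m v * (cmod (cinner v e))\<^sup>2) \<le> (\<Sum>v\<in>G. \<Sum>e\<in>E. \<tau>\<^sup>2 * (cmod (cinner v e))\<^sup>2)"
    using \<tau> by (intro sum_mono mult_right_mono power_mono) auto
  also have "\<dots> = (\<Sum>e\<in>E. \<tau>\<^sup>2 * (\<Sum>v\<in>G. (cmod (cinner e v))\<^sup>2))"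
    unfolding sum_distrib_left
    by (subst sum.swap, intro sum.cong refl, subst cinner_commute, simp)
  also have "\<dots> \<le> (\<Sum>e\<in>E. \<tau>\<^sup>2 * 1)"
    using bessel[OF oG G(1)] orthonormal_norm[OF E(2)]
    by (intro sum_mono mult_left_mono) (auto, metis one_power2)
  finally show ?thesis
    using le by (simp add: mult.commute)
qed

section \<open>Matrices with square-summable entries\<close>

lemma coord_eqI: "(\<And>n. coord x n = coord y n) \<Longrightarrow> x = y"
  by (simp add: coord_inject[symmetric] fun_eq_iff)

lemma coord_Abs: "summable (\<lambda>n. (cmod (x n))\<^sup>2) \<Longrightarrow> coord (Abs_ell2 x) = x"
  by (rule Abs_ell2_inverse) simp

lemma norm_sq_Abs:
  "summable (\<lambda>n. (cmod (x n))\<^sup>2) \<Longrightarrow> (norm (Abs_ell2 x))\<^sup>2 = (\<Sum>n. (cmod (x n))\<^sup>2)"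
  using norm_sq_sums[of "Abs_ell2 x"] by (simp add: coord_Abs sums_iff)

text \<open>
  The Hilbert cube is a continuous image of a product of compact discs, by dominated convergence.
\<close>

lemma compact_hilbert_cube:
  assumes \<rho>: "summable (\<lambda>i. (\<rho> i)\<^sup>2)"
  shows "compact (Abs_ell2 ` {z. \<forall>i. cmod (z i) \<le> \<rho> i})"
proof (rule compact_continuous_image)
  let ?K = "{z. \<forall>i. cmod (z i) \<le> \<rho> i}"
  have "compactin (product_topology (\<lambda>_. euclidean) UNIV) (PiE UNIV (\<lambda>i. cball (0::complex) (\<rho> i)))"
    by (auto simp: compactin_PiE)
  moreover have "PiE UNIV (\<lambda>i. cball (0::complex) (\<rho> i)) = ?K"
    by (auto simp: PiE_def Pi_def)
  ultimately show "compact ?K"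
    by (simp add: euclidean_product_topology)
  have sum: "summable (\<lambda>i. (cmod (z i))\<^sup>2)" if "z \<in> ?K" for z
    using that by (intro summable_comparison_test'[OF \<rho>, of 0]) (auto intro!: power_mono)
  show "continuous_on ?K Abs_ell2"
  proof (rule continuous_on_sequentiallyI)
    fix u z assume u: "\<forall>n. u n \<in> ?K" and z: "z \<in> ?K" and "u \<longlonglongrightarrow> z"
    have coordinate: "(\<lambda>n. u n i) \<longlonglongrightarrow> z i" for i
      using continuous_on_tendsto_compose[OF continuous_on_product_coordinates \<open>u \<longlonglongrightarrow> z\<close>] by simp
    have "((\<lambda>n. \<Sum>i. (cmod (u n i - z i))\<^sup>2) \<longlongrightarrow> (\<Sum>i. 0)) sequentially"
    proof (rule tannerys_theorem[THEN conjunct2, THEN conjunct2])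
      show "(\<lambda>n. (cmod (u n i - z i))\<^sup>2) \<longlonglongrightarrow> 0" for i
        using tendsto_power[OF tendsto_norm_zero[OF LIM_zero[OF coordinate]], where n = 2] by simp
      show "\<forall>\<^sub>F (i, n) in sequentially \<times>\<^sub>F sequentially. norm ((cmod (u n i - z i))\<^sup>2) \<le> 4 * (\<rho> i)\<^sup>2"
      proof (intro always_eventually allI, clarify)
        fix i n
        have "cmod (u n i - z i) \<le> \<rho> i + \<rho> i"
          using u z by (intro order_trans[OF norm_triangle_ineq4 add_mono]) auto
        then have "(cmod (u n i - z i))\<^sup>2 \<le> (2 * \<rho> i)\<^sup>2"
          by (intro power_mono) auto
        then show "norm ((cmod (u n i - z i))\<^sup>2) \<le> 4 * (\<rho> i)\<^sup>2"
          by (simp add: power_mult_distrib)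
      qed
      show "summable (\<lambda>i. 4 * (\<rho> i)\<^sup>2)"
        using \<rho> by (rule summable_mult)
    qed simp
    moreover have "(norm (Abs_ell2 (u n) - Abs_ell2 z))\<^sup>2 = (\<Sum>i. (cmod (u n i - z i))\<^sup>2)" for n
      using norm_sq_sums[of "Abs_ell2 (u n) - Abs_ell2 z"] u z
      by (simp add: minus_ell2.rep_eq coord_Abs sum sums_iff)
    ultimately have "(\<lambda>n. sqrt ((norm (Abs_ell2 (u n) - Abs_ell2 z))\<^sup>2)) \<longlonglongrightarrow> sqrt 0"
      by (intro tendsto_real_sqrt) simp
    then have "(\<lambda>n. norm (Abs_ell2 (u n) - Abs_ell2 z)) \<longlonglongrightarrow> 0"
      by simp
    then show "(\<lambda>n. Abs_ell2 (u n)) \<longlonglongrightarrow> Abs_ell2 z"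
      by (rule LIM_zero_cancel[OF tendsto_norm_zero_cancel])
  qed
qed

text \<open>The coordinates of \<open>T x\<close> are bounded by \<open>norm (r i)\<close>, so the unit ball is mapped into a Hilbert cube.\<close>

lemma hilbert_schmidt_compact:
  assumes r: "summable (\<lambda>i. (norm (r i))\<^sup>2)"
  obtains T where "compact_operator T" "\<And>x i. coord (T x) i = cinner x (r i)"
proof -
  define T where "T x = Abs_ell2 (\<lambda>i. cinner x (r i))" for x
  have "summable (\<lambda>i. (cmod (cinner x (r i)))\<^sup>2)" for x
    using cmod_cinner_le
    by (intro summable_comparison_test'[OF summable_mult[OF r, of "(norm x)\<^sup>2"], of 0])
       (auto simp: power_mult_distrib[symmetric] intro!: power_mono)
  then have T: "coord (T x) i = cinner x (r i)" for x i
    by (simp add: T_def coord_Abs)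
  have "Vector_Spaces.linear scaleC scaleC T"
    unfolding Vector_Spaces.linear_iff
    by (auto intro!: coord_eqI ell2.vector_space_axioms
        simp: T plus_ell2.rep_eq scaleC.rep_eq cinner_add_left cinner_scale_left)
  moreover have "compact (closure (T ` cball 0 1))"
  proof -
    let ?Q = "Abs_ell2 ` {z. \<forall>i. cmod (z i) \<le> norm (r i)}"
    have "T ` cball 0 1 \<subseteq> ?Q"
    proof clarify
      fix x :: ell2 assume "x \<in> cball 0 1"
      then have "norm x * norm (r i) \<le> 1 * norm (r i)" for i
        by (intro mult_right_mono) auto
      then have "cmod (cinner x (r i)) \<le> norm (r i)" for i
        using cmod_cinner_le[of x "r i"] by (simp add: order_trans)
      then show "T x \<in> ?Q"
        unfolding T_def by blast
    qed
    moreover have Q: "compact ?Q"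
      using r by (rule compact_hilbert_cube)
    ultimately have "closure (T ` cball 0 1) \<subseteq> ?Q"
      by (simp add: closure_minimal compact_imp_closed)
    then show ?thesis
      using compact_Int_closed[OF Q closed_closure, of "T ` cball 0 1"] by (simp only: Int_absorb1)
  qed
  ultimately show ?thesis
    using that T by (simp add: compact_operator_def)
qed

lemma summable_swap_nonneg:
  fixes x :: "nat \<Rightarrow> nat \<Rightarrow> real"
  assumes x: "\<And>i j. 0 \<le> x i j" and j: "\<And>j. summable (\<lambda>i. x i j)" and "summable (\<lambda>j. \<Sum>i. x i j)"
  shows "summable (\<lambda>j. x i j)" and "summable (\<lambda>i. \<Sum>j. x i j)"
    and "(\<Sum>i. \<Sum>j. x i j) \<le> (\<Sum>j. \<Sum>i. x i j)"
proof -
  show row: "summable (\<lambda>j. x i j)" for i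
  proof (rule summable_comparison_test'[OF assms(3), of 0])
    show "norm (x i j) \<le> (\<Sum>i. x i j)" for j
      using sum_le_suminf[OF j, of "{i}"] x by simp
  qed
  have partial: "(\<Sum>i<n. \<Sum>j. x i j) \<le> (\<Sum>j. \<Sum>i. x i j)" for n
  proof -
    have "(\<Sum>i<n. \<Sum>j. x i j) = (\<Sum>j. \<Sum>i<n. x i j)"
      by (rule suminf_sum[symmetric]) (rule row)
    also have "\<dots> \<le> (\<Sum>j. \<Sum>i. x i j)"
      by (intro suminf_le sum_le_suminf j x assms(3) summable_sum row) auto
    finally show ?thesis .
  qed
  then show sum: "summable (\<lambda>i. \<Sum>j. x i j)"
    by (intro summableI_nonneg_bounded[of _ "\<Sum>j. \<Sum>i. x i j"] suminf_nonneg row x)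
  show "(\<Sum>i. \<Sum>j. x i j) \<le> (\<Sum>j. \<Sum>i. x i j)"
    using sum partial by (intro suminf_le_const)
qed

lemma summable_rows_plus_columns:
  fixes a b :: "nat \<Rightarrow> nat \<Rightarrow> complex"
  assumes a: "\<And>i. summable (\<lambda>j. (cmod (a i j))\<^sup>2)" "summable (\<lambda>i. \<Sum>j. (cmod (a i j))\<^sup>2)"
    and b: "\<And>j. summable (\<lambda>i. (cmod (b i j))\<^sup>2)" "summable (\<lambda>j. \<Sum>i. (cmod (b i j))\<^sup>2)"
  shows "summable (\<lambda>j. (cmod (a i j + b i j))\<^sup>2)"
    and "summable (\<lambda>i. \<Sum>j. (cmod (a i j + b i j))\<^sup>2)"
    and "(\<Sum>i. \<Sum>j. (cmod (a i j + b i j))\<^sup>2)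
      \<le> 2 * (\<Sum>i. \<Sum>j. (cmod (a i j))\<^sup>2) + 2 * (\<Sum>j. \<Sum>i. (cmod (b i j))\<^sup>2)"
proof -
  note b' = summable_swap_nonneg[of "\<lambda>i j. (cmod (b i j))\<^sup>2", OF zero_le_power2 b]
  show row: "summable (\<lambda>j. (cmod (a i j + b i j))\<^sup>2)" for i
    by (rule summable_sq_add[OF a(1) b'(1)])
  have row_le: "(\<Sum>j. (cmod (a i j + b i j))\<^sup>2) \<le> 2 * (\<Sum>j. (cmod (a i j))\<^sup>2) + 2 * (\<Sum>j. (cmod (b i j))\<^sup>2)" for i
  proof -
    have "(\<Sum>j. (cmod (a i j + b i j))\<^sup>2) \<le> (\<Sum>j. 2 * (cmod (a i j))\<^sup>2 + 2 * (cmod (b i j))\<^sup>2)"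
      by (intro suminf_le cmod_add_sq_le row summable_add summable_mult a(1) b'(1))
    also have "\<dots> = 2 * (\<Sum>j. (cmod (a i j))\<^sup>2) + 2 * (\<Sum>j. (cmod (b i j))\<^sup>2)"
      by (simp add: suminf_add[symmetric] suminf_mult summable_mult a(1) b'(1))
    finally show ?thesis .
  qed
  have dom: "summable (\<lambda>i. 2 * (\<Sum>j. (cmod (a i j))\<^sup>2) + 2 * (\<Sum>j. (cmod (b i j))\<^sup>2))"
    by (intro summable_add summable_mult a(2) b'(2))
  show sum: "summable (\<lambda>i. \<Sum>j. (cmod (a i j + b i j))\<^sup>2)"
    by (rule summable_comparison_test'[OF dom, of 0]) (use row_le suminf_nonneg[OF row] in auto)
  have "(\<Sum>i. \<Sum>j. (cmod (a i j + b i j))\<^sup>2)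
      \<le> (\<Sum>i. 2 * (\<Sum>j. (cmod (a i j))\<^sup>2) + 2 * (\<Sum>j. (cmod (b i j))\<^sup>2))"
    by (rule suminf_le[OF row_le sum dom])
  also have "\<dots> = 2 * (\<Sum>i. \<Sum>j. (cmod (a i j))\<^sup>2) + 2 * (\<Sum>i. \<Sum>j. (cmod (b i j))\<^sup>2)"
    by (simp add: suminf_add[symmetric] suminf_mult summable_mult a(2) b'(2))
  finally show "(\<Sum>i. \<Sum>j. (cmod (a i j + b i j))\<^sup>2)
      \<le> 2 * (\<Sum>i. \<Sum>j. (cmod (a i j))\<^sup>2) + 2 * (\<Sum>j. \<Sum>i. (cmod (b i j))\<^sup>2)"
    using b'(3) by simp
qed

section \<open>A decomposable matrix belongs to the Schatten class\<close>

text \<open>The terms tend to \<open>0\<close>, and numbers in \<open>[0, 1]\<close> are at most their \<open>q\<close>-th powers.\<close>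

lemma summable_powr_imp_summable:
  fixes f :: "nat \<Rightarrow> real"
  assumes f: "\<And>i. 0 \<le> f i" and q: "0 < q" "q \<le> 1" and sum: "summable (\<lambda>i. f i powr q)"
  shows "summable f"
proof (rule summable_comparison_test_ev[OF _ sum])
  have "\<forall>\<^sub>F i in sequentially. f i powr q < 1"
    using summable_LIMSEQ_zero[OF sum] by (rule order_tendstoD) simp
  then show "\<forall>\<^sub>F i in sequentially. norm (f i) \<le> f i powr q"
  proof eventually_elim
    case (elim i)
    have "f i \<le> 1"
      using elim q powr_mono2[of q 1 "f i"] by (cases "f i \<le> 1") auto
    then show ?case
      using f[of i] powr_mono'[of q 1 "f i"] q by (cases "f i = 0") auto
  qed
qed

text \<open>
  Abel summation: \<open>f l\<close> is counted at every threshold \<open>x \<ge> f l\<close>, with total weight \<open>f l\<^bsup>p-2\<^esup>\<close>.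
\<close>

lemma sum_powr_eq_weighted:
  fixes f :: "'l \<Rightarrow> real"
  assumes L: "finite L" and f: "\<And>l. l \<in> L \<Longrightarrow> 0 < f l"
    and w: "\<And>y. y \<in> f ` L \<Longrightarrow> (\<Sum>x | x \<in> f ` L \<and> y \<le> x. w x) = y powr (p - 2)"
  shows "(\<Sum>l\<in>L. f l powr p) = (\<Sum>x\<in>f ` L. w x * (\<Sum>l | l \<in> L \<and> f l \<le> x. (f l)\<^sup>2))"
proof -
  have fin: "finite (f ` L)"
    using L by simp
  have "(\<Sum>l\<in>L. f l powr p) = (\<Sum>l\<in>L. (f l)\<^sup>2 * (\<Sum>x | x \<in> f ` L \<and> f l \<le> x. w x))"
    using f w power2_mult_powr by (intro sum.cong refl) auto
  also have "\<dots> = (\<Sum>l\<in>L. \<Sum>x\<in>f ` L. if f l \<le> x then w x * (f l)\<^sup>2 else 0)"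
    by (simp add: sum_distrib_left sum.inter_filter[OF fin] mult.commute if_distrib cong: if_cong)
  also have "\<dots> = (\<Sum>x\<in>f ` L. \<Sum>l\<in>L. if f l \<le> x then w x * (f l)\<^sup>2 else 0)"
    by (rule sum.swap)
  also have "\<dots> = (\<Sum>x\<in>f ` L. w x * (\<Sum>l | l \<in> L \<and> f l \<le> x. (f l)\<^sup>2))"
    by (simp add: sum_distrib_left sum.inter_filter[OF L] if_distrib cong: if_cong)
  finally show ?thesis .
qed

text \<open>The domination is used at the thresholds \<open>s v\<close> themselves.\<close>

lemma truncated_domination_powr:
  fixes s :: "'v \<Rightarrow> real" and R C :: "nat \<Rightarrow> real"
  assumes p: "0 < p" "p < 2" and G: "finite G" "\<And>v. v \<in> G \<Longrightarrow> 0 < s v"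
    and R: "\<And>i. 0 \<le> R i" "summable (\<lambda>i. R i powr p)"
    and C: "\<And>j. 0 \<le> C j" "summable (\<lambda>j. C j powr p)"
    and sum_sq: "summable (\<lambda>i. (R i)\<^sup>2)" "summable (\<lambda>j. (C j)\<^sup>2)"
    and dom: "\<And>\<tau>. \<tau> > 0 \<Longrightarrow> (\<Sum>v\<in>G. (min (s v) \<tau>)\<^sup>2)
        \<le> 2 * (\<Sum>i. (min (R i) \<tau>)\<^sup>2) + 2 * (\<Sum>j. (min (C j) \<tau>)\<^sup>2)"
  shows "(\<Sum>v\<in>G. s v powr p) \<le> (4 / p) * ((\<Sum>i. R i powr p) + (\<Sum>j. C j powr p))"
proof -
  let ?X = "s ` G"
  obtain w where w: "\<forall>x\<in>?X. 0 \<le> w x"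
    "\<forall>y\<in>?X. (\<Sum>x | x \<in> ?X \<and> y \<le> x. w x) = y powr (p - 2)"
    "\<forall>s\<ge>0. (\<Sum>x\<in>?X. w x * (min s x)\<^sup>2) \<le> (2 / p) * s powr p"
    using threshold_weights[OF p, of ?X] G by auto
  have X: "x > 0" if "x \<in> ?X" for x
    using that G by auto
  have min_sum: "summable (\<lambda>i. (min (Q i) x)\<^sup>2)"
    if "summable (\<lambda>i. (Q i)\<^sup>2)" "\<And>i. 0 \<le> Q i" "x > 0" for Q :: "nat \<Rightarrow> real" and x
    using that by (intro summable_comparison_test'[OF that(1), of 0]) (auto intro!: power_mono)
  have weighted: "(\<Sum>x\<in>?X. w x * (\<Sum>i. (min (Q i) x)\<^sup>2)) \<le> (2 / p) * (\<Sum>i. Q i powr p)"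
    if Q: "summable (\<lambda>i. (Q i)\<^sup>2)" "\<And>i. 0 \<le> Q i" "summable (\<lambda>i. Q i powr p)" for Q :: "nat \<Rightarrow> real"
  proof -
    have term_summable: "summable (\<lambda>i. w x * (min (Q i) x)\<^sup>2)" if "x \<in> ?X" for x
      using Q X[OF that] by (intro summable_mult min_sum)
    have "(\<Sum>x\<in>?X. w x * (\<Sum>i. (min (Q i) x)\<^sup>2)) = (\<Sum>x\<in>?X. \<Sum>i. w x * (min (Q i) x)\<^sup>2)"
      using Q X by (intro sum.cong refl suminf_mult[symmetric] min_sum)
    also have "\<dots> = (\<Sum>i. \<Sum>x\<in>?X. w x * (min (Q i) x)\<^sup>2)"
      by (rule suminf_sum[symmetric]) (rule term_summable)
    also have "\<dots> \<le> (\<Sum>i. (2 / p) * Q i powr p)"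
      using w(3) Q by (intro suminf_le summable_sum term_summable summable_mult) auto
    also have "\<dots> = (2 / p) * (\<Sum>i. Q i powr p)"
      by (rule suminf_mult[OF Q(3)])
    finally show ?thesis .
  qed
  have "(\<Sum>v\<in>G. s v powr p) = (\<Sum>x\<in>?X. w x * (\<Sum>v | v \<in> G \<and> s v \<le> x. (s v)\<^sup>2))"
    using G w(2) by (intro sum_powr_eq_weighted) auto
  also have "\<dots> \<le> (\<Sum>x\<in>?X. w x * (2 * (\<Sum>i. (min (R i) x)\<^sup>2) + 2 * (\<Sum>j. (min (C j) x)\<^sup>2)))"
  proof (intro sum_mono mult_left_mono)
    fix x assume x: "x \<in> ?X"
    show "0 \<le> w x"
      using w(1) x by blast
    have "(\<Sum>v | v \<in> G \<and> s v \<le> x. (s v)\<^sup>2) = (\<Sum>v | v \<in> G \<and> s v \<le> x. (min (s v) x)\<^sup>2)"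
      by (intro sum.cong) auto
    also have "\<dots> \<le> (\<Sum>v\<in>G. (min (s v) x)\<^sup>2)"
      using G by (intro sum_mono2) auto
    also have "\<dots> \<le> 2 * (\<Sum>i. (min (R i) x)\<^sup>2) + 2 * (\<Sum>j. (min (C j) x)\<^sup>2)"
      by (rule dom[OF X[OF x]])
    finally show "(\<Sum>v | v \<in> G \<and> s v \<le> x. (s v)\<^sup>2)
        \<le> 2 * (\<Sum>i. (min (R i) x)\<^sup>2) + 2 * (\<Sum>j. (min (C j) x)\<^sup>2)" .
  qed
  also have "\<dots> = 2 * (\<Sum>x\<in>?X. w x * (\<Sum>i. (min (R i) x)\<^sup>2)) + 2 * (\<Sum>x\<in>?X. w x * (\<Sum>j. (min (C j) x)\<^sup>2))"
    by (simp add: distrib_left sum.distrib sum_distrib_left mult_ac)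
  also have "\<dots> \<le> 2 * ((2 / p) * (\<Sum>i. R i powr p)) + 2 * ((2 / p) * (\<Sum>j. C j powr p))"
    by (intro add_mono mult_left_mono weighted R C sum_sq) auto
  finally show ?thesis
    by (simp add: algebra_simps)
qed

text \<open>
  At threshold \<open>\<tau>\<close>, delete from \<open>a\<close> the rows and from \<open>b\<close> the columns of norm more than
  \<open>\<tau>\<close>. This changes the operator only on a space whose dimension is at most the number
  of deleted lines, and what remains has small Hilbert-Schmidt norm.
\<close>

lemma rows_plus_columns_in_schatten:
  fixes a b :: "nat \<Rightarrow> nat \<Rightarrow> complex"
  assumes p: "0 < p" "p < 2"
    and a: "\<And>i. summable (\<lambda>j. (cmod (a i j))\<^sup>2)" "summable (\<lambda>i. (\<Sum>j. (cmod (a i j))\<^sup>2) powr (p / 2))"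
    and b: "\<And>j. summable (\<lambda>i. (cmod (b i j))\<^sup>2)" "summable (\<lambda>j. (\<Sum>i. (cmod (b i j))\<^sup>2) powr (p / 2))"
  shows "matrix_in_schatten p (\<lambda>i j. a i j + b i j)"
proof -
  define R where "R i = sqrt (\<Sum>j. (cmod (a i j))\<^sup>2)" for i
  define C where "C j = sqrt (\<Sum>i. (cmod (b i j))\<^sup>2)" for j
  have R2: "(\<Sum>j. (cmod (a i j))\<^sup>2) = (R i)\<^sup>2" and R0: "0 \<le> R i" for i
    using suminf_nonneg[OF a(1)] by (auto simp: R_def)
  have C2: "(\<Sum>i. (cmod (b i j))\<^sup>2) = (C j)\<^sup>2" and C0: "0 \<le> C j" for j
    using suminf_nonneg[OF b(1)] by (auto simp: C_def)
  have pw: "(z\<^sup>2) powr (p / 2) = z powr p" if "0 \<le> z" for z :: real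
    using that by (cases "z = 0") (simp_all add: powr_powr flip: powr_numeral)
  have Rp: "summable (\<lambda>i. R i powr p)" and Cp: "summable (\<lambda>j. C j powr p)"
    using a(2) b(2) by (simp_all add: R2 C2 pw R0 C0)
  have sR: "summable (\<lambda>i. (R i)\<^sup>2)" and sC: "summable (\<lambda>j. (C j)\<^sup>2)"
    using summable_powr_imp_summable[of "\<lambda>i. (R i)\<^sup>2" "p / 2"]
      summable_powr_imp_summable[of "\<lambda>j. (C j)\<^sup>2" "p / 2"] Rp Cp p by (simp_all add: pw R0 C0)
  define m where "m i j = a i j + b i j" for i j
  note m = summable_rows_plus_columns[OF a(1) _ b(1), unfolded R2 C2, OF sR sC, folded m_def]
  define r where "r i = Abs_ell2 (\<lambda>j. cnj (m i j))" for i
  have r: "coord (r i) j = cnj (m i j)" for i j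
    using m(1) by (simp add: r_def coord_Abs)
  have "(norm (r i))\<^sup>2 = (\<Sum>j. (cmod (m i j))\<^sup>2)" for i
    using m(1) norm_sq_Abs[of "\<lambda>j. cnj (m i j)"] by (simp add: r_def)
  then have "summable (\<lambda>i. (norm (r i))\<^sup>2)"
    using m(2) by simp
  then obtain T where T: "compact_operator T" and Tr: "\<And>x i. coord (T x) i = cinner x (r i)"
    using hilbert_schmidt_compact by blast
  obtain V where V: "singular_system T V"
    using singular_system_exists[OF T] by blast
  have dom: "(\<Sum>v\<in>G. (min (norm (T v)) \<tau>)\<^sup>2)
      \<le> 2 * (\<Sum>i. (min (R i) \<tau>)\<^sup>2) + 2 * (\<Sum>j. (min (C j) \<tau>)\<^sup>2)"
    if G: "finite G" "G \<subseteq> V" and \<tau>: "\<tau> > 0" for G \<tau>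
  proof -
    have few: "finite {i. Q i > \<tau>}" if "summable (\<lambda>i. (Q i)\<^sup>2)" for Q :: "nat \<Rightarrow> real"
    proof -
      have "\<forall>\<^sub>F i in sequentially. (Q i)\<^sup>2 < \<tau>\<^sup>2"
        using summable_LIMSEQ_zero[OF that] by (rule order_tendstoD) (use \<tau> in simp)
      then have "finite {i. \<not> (Q i)\<^sup>2 < \<tau>\<^sup>2}"
        by (simp add: cofinite_eq_sequentially[symmetric] eventually_cofinite)
      moreover have "{i. Q i > \<tau>} \<subseteq> {i. \<not> (Q i)\<^sup>2 < \<tau>\<^sup>2}"
        using \<tau> by (auto simp: not_less intro!: power_mono)
      ultimately show ?thesis
        by (rule finite_subset[rotated])
    qed
    define I where "I = {i. R i > \<tau>}"
    define J where "J = {j. C j > \<tau>}"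
    have I: "finite I" and J: "finite J"
      using few sR sC by (auto simp: I_def J_def)
    define a' where "a' i j = (if i \<in> I then 0 else a i j)" for i j
    define b' where "b' i j = (if j \<in> J then 0 else b i j)" for i j
    have a'2: "(\<Sum>j. (cmod (a' i j))\<^sup>2) = (if i \<in> I then 0 else (R i)\<^sup>2)" for i
      by (simp add: a'_def R2)
    have b'2: "(\<Sum>i. (cmod (b' i j))\<^sup>2) = (if j \<in> J then 0 else (C j)\<^sup>2)" for j
      by (simp add: b'_def C2)
    have a'1: "summable (\<lambda>j. (cmod (a' i j))\<^sup>2)" and b'1: "summable (\<lambda>i. (cmod (b' i j))\<^sup>2)" for i j
      using a(1) b(1) by (cases "i \<in> I", simp_all add: a'_def) (cases "j \<in> J", simp_all add: b'_def)
    have sR': "summable (\<lambda>i. if i \<in> I then 0 else (R i)\<^sup>2)"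
      by (rule summable_comparison_test'[OF sR, of 0]) auto
    have sC': "summable (\<lambda>j. if j \<in> J then 0 else (C j)\<^sup>2)"
      by (rule summable_comparison_test'[OF sC, of 0]) auto
    define m' where "m' i j = a' i j + b' i j" for i j
    note m' = summable_rows_plus_columns[OF a'1 _ b'1, unfolded a'2 b'2, OF sR' sC', folded m'_def]
    define c where "c i = Abs_ell2 (\<lambda>j. cnj (m' i j))" for i
    have c: "coord (c i) j = cnj (m' i j)" for i j
      using m'(1) by (simp add: c_def coord_Abs)
    have c2: "(norm (c i))\<^sup>2 = (\<Sum>j. (cmod (m' i j))\<^sup>2)" for i
      using m'(1) norm_sq_Abs[of "\<lambda>j. cnj (m' i j)"] by (simp add: c_def)
    \<comment> \<open>the deleted rows of \<open>a\<close>, conjugated\<close>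
    define ar where "ar i = Abs_ell2 (\<lambda>j. cnj (a i j))" for i
    have ar: "coord (ar i) j = cnj (a i j)" for i j
      using a(1) by (simp add: ar_def coord_Abs)
    obtain E where E: "finite E" "orthonormal E" "card E \<le> card (ar ` I \<union> unit_vec ` J)"
      "ar ` I \<union> unit_vec ` J \<subseteq> ell2.span E"
      using gram_schmidt[of "ar ` I \<union> unit_vec ` J"] I J by blast
    have cardE: "card E \<le> card I + card J"
      using E(3) card_Un_le[of "ar ` I" "unit_vec ` J"] card_image_le[OF I, of ar]
        card_image_le[OF J, of unit_vec] by linarith
    have "coord (T x) i = cinner x (c i)" if x: "\<And>e. e \<in> E \<Longrightarrow> cinner x e = 0" for x i
    proof -
      have orth: "cinner x y = 0" if "y \<in> ell2.span E" for y
        using x proj_span[OF E(2,1) that] cinner_proj_swap[of E x y] by (simp add: proj_def)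
      \<comment> \<open>the deleted part of row \<open>i\<close>\<close>
      define d where "d = (if i \<in> I then ar i else 0) + (\<Sum>j\<in>J. scaleC (cnj (b i j)) (unit_vec j))"
      have "d \<in> ell2.span E"
        unfolding d_def using E(4)
        by (intro ell2.span_add ell2.span_sum ell2.span_scale) (auto simp: ell2.span_zero)
      moreover have "r i = c i + d"
        by (rule coord_eqI)
           (auto simp: r c d_def plus_ell2.rep_eq zero_ell2.rep_eq coord_unit_combination[OF J] ar
            m_def m'_def a'_def b'_def)
      ultimately show ?thesis
        by (simp add: Tr cinner_add_right orth)
    qed
    from truncated_singular_values_le[OF T V G E(1,2) less_imp_le[OF \<tau>] this]
    have "(\<Sum>v\<in>G. (min (norm (T v)) \<tau>)\<^sup>2) \<le> (\<Sum>i. (norm (c i))\<^sup>2) + \<tau>\<^sup>2 * card E"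
      using m'(2) by (simp add: c2)
    also have "\<dots> \<le> 2 * (\<Sum>i. if i \<in> I then 0 else (R i)\<^sup>2) + 2 * (\<Sum>j. if j \<in> J then 0 else (C j)\<^sup>2)
        + \<tau>\<^sup>2 * (real (card I) + real (card J))"
      using m'(3) cardE by (intro add_mono mult_left_mono) (simp_all add: c2)
    also have "\<dots> \<le> 2 * (\<Sum>i. (min (R i) \<tau>)\<^sup>2) + 2 * (\<Sum>j. (min (C j) \<tau>)\<^sup>2)"
    proof -
      have split: "(\<Sum>i. (min (Q i) \<tau>)\<^sup>2) = (\<Sum>i. if Q i > \<tau> then 0 else (Q i)\<^sup>2) + \<tau>\<^sup>2 * card {i. Q i > \<tau>}"
        if Q: "summable (\<lambda>i. (Q i)\<^sup>2)" for Q :: "nat \<Rightarrow> real"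
      proof -
        have 1: "summable (\<lambda>i. if Q i > \<tau> then 0 else (Q i)\<^sup>2)"
          by (rule summable_comparison_test'[OF Q, of 0]) auto
        have 2: "(\<lambda>i. if i \<in> {i. Q i > \<tau>} then \<tau>\<^sup>2 else 0) sums (\<Sum>i\<in>{i. Q i > \<tau>}. \<tau>\<^sup>2)"
          by (rule sums_If_finite_set[OF few[OF Q]])
        have "(\<lambda>i. (min (Q i) \<tau>)\<^sup>2)
            = (\<lambda>i. (if Q i > \<tau> then 0 else (Q i)\<^sup>2) + (if i \<in> {i. Q i > \<tau>} then \<tau>\<^sup>2 else 0))"
          by auto
        then show ?thesis
          using sums_add[OF summable_sums[OF 1] 2] by (simp add: sums_iff mult.commute)
      qed
      have "0 \<le> \<tau>\<^sup>2 * real (card I)" "0 \<le> \<tau>\<^sup>2 * real (card J)"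
        by simp_all
      then show ?thesis
        unfolding split[OF sR] split[OF sC] I_def J_def by (simp add: algebra_simps)
    qed
    finally show ?thesis .
  qed
  have "(\<lambda>v. norm (T v) powr p) summable_on V"
  proof (rule nonneg_bdd_above_summable_on)
    show "bdd_above (sum (\<lambda>v. norm (T v) powr p) ` {G. G \<subseteq> V \<and> finite G})"
    proof (rule bdd_aboveI2)
      fix G assume "G \<in> {G. G \<subseteq> V \<and> finite G}"
      then show "(\<Sum>v\<in>G. norm (T v) powr p) \<le> (4 / p) * ((\<Sum>i. R i powr p) + (\<Sum>j. C j powr p))"
        using singular_systemD(3)[OF V] dom
        by (intro truncated_domination_powr p R0 C0 Rp Cp sR sC) auto
    qed
  qed simp
  then have "T \<in> schatten_class p"
    by (simp add: schatten_class_iff[OF T V])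
  moreover have "coord (T (unit_vec j)) i = a i j + b i j" for i j
  proof -
    have "cinner (unit_vec j) (r i) = cnj (coord (r i) j)"
      by (subst cinner_commute) (simp add: cinner_unit_vec)
    then show ?thesis
      by (simp add: Tr r m_def)
  qed
  ultimately show ?thesis
    unfolding matrix_in_schatten_def by blast
qed

section \<open>Peeling the heaviest rows and columns\<close>

definition lines_le :: "(nat \<Rightarrow> nat \<Rightarrow> real) \<Rightarrow> nat set \<Rightarrow> nat set \<Rightarrow> real \<Rightarrow> bool" where
  "lines_le x R S M \<longleftrightarrow> (\<forall>i\<in>R. (\<Sum>j\<in>S. x i j) \<le> M) \<and> (\<forall>j\<in>S. (\<Sum>i\<in>R. x i j) \<le> M)"

text \<open>
  Think of \<open>x i j\<close> as the squared modulus of a matrix entry, which is put into the row part if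
  \<open>c i j\<close> holds and into the column part otherwise.
\<close>

definition split_cost :: "real \<Rightarrow> (nat \<Rightarrow> nat \<Rightarrow> real) \<Rightarrow> nat set \<Rightarrow> nat set \<Rightarrow> (nat \<Rightarrow> nat \<Rightarrow> bool) \<Rightarrow> real" where
  "split_cost q x R S c = (\<Sum>i\<in>R. (\<Sum>j\<in>S. if c i j then x i j else 0) powr q)
     + (\<Sum>j\<in>S. (\<Sum>i\<in>R. if c i j then 0 else x i j) powr q)"

text \<open>
  The outcome of removing heaviest lines one by one: \<open>\<rho> l\<close> is the norm of the removed line number
  \<open>l\<close>, counted from the last removal to the first, and \<open>c\<close> records whether an entry was
  removed with its row. The submatrix \<open>R' \<times> S'\<close> at level \<open>t\<close> is what remains when no line of norm more than
  \<open>t\<close> is left. The second condition holds because the \<open>\<rho> l\<close> are norms of lines in submatrices; it is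
  what the induction needs for \<open>t\<close> above the norm of the first removed line.
\<close>

definition peelable :: "real \<Rightarrow> (nat \<Rightarrow> nat \<Rightarrow> real) \<Rightarrow> nat set \<Rightarrow> nat set \<Rightarrow> bool" where
  "peelable q x R S \<longleftrightarrow> (\<exists>(n::nat) \<rho> c. (\<forall>l<n. 0 < \<rho> l)
     \<and> (\<forall>M. lines_le x R S M \<longrightarrow> (\<forall>l<n. (\<rho> l)\<^sup>2 \<le> M))
     \<and> (\<forall>t>0. \<exists>R'\<subseteq>R. \<exists>S'\<subseteq>S. lines_le x R' S' (t\<^sup>2)
          \<and> (\<Sum>i\<in>R'. \<Sum>j\<in>S'. x i j) = (\<Sum>l | l < n \<and> \<rho> l \<le> t. (\<rho> l)\<^sup>2))
     \<and> (\<Sum>i\<in>R. \<Sum>j\<in>S. x i j) = (\<Sum>l<n. (\<rho> l)\<^sup>2)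
     \<and> split_cost q x R S c \<le> (\<Sum>l<n. \<rho> l powr (2 * q)))"

lemma lines_le_transpose: "lines_le x R S M \<Longrightarrow> lines_le (\<lambda>i j. x j i) S R M"
  by (simp add: lines_le_def)

lemma split_cost_transpose:
  "split_cost q (\<lambda>i j. x j i) S R (\<lambda>i j. \<not> c j i) = split_cost q x R S c"
proof -
  have "(if \<not> b then u else v) = (if b then v else u)" for b and u v :: real
    by simp
  then show ?thesis
    by (simp add: split_cost_def)
qed

lemma peelable_transpose:
  assumes "peelable q (\<lambda>i j. x j i) S R"
  shows "peelable q x R S"
proof -
  obtain n :: nat and \<rho> c where P: "\<forall>l<n. 0 < \<rho> l"
    "\<forall>M. lines_le (\<lambda>i j. x j i) S R M \<longrightarrow> (\<forall>l<n. (\<rho> l)\<^sup>2 \<le> M)"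
    "\<forall>t>0. \<exists>R'\<subseteq>S. \<exists>S'\<subseteq>R. lines_le (\<lambda>i j. x j i) R' S' (t\<^sup>2)
          \<and> (\<Sum>i\<in>R'. \<Sum>j\<in>S'. x j i) = (\<Sum>l | l < n \<and> \<rho> l \<le> t. (\<rho> l)\<^sup>2)"
    "(\<Sum>i\<in>S. \<Sum>j\<in>R. x j i) = (\<Sum>l<n. (\<rho> l)\<^sup>2)"
    "split_cost q (\<lambda>i j. x j i) S R c \<le> (\<Sum>l<n. \<rho> l powr (2 * q))"
    using assms unfolding peelable_def by (elim exE conjE) (rule that, assumption+)
  have "\<exists>R'\<subseteq>R. \<exists>S'\<subseteq>S. lines_le x R' S' (t\<^sup>2)
      \<and> (\<Sum>i\<in>R'. \<Sum>j\<in>S'. x i j) = (\<Sum>l | l < n \<and> \<rho> l \<le> t. (\<rho> l)\<^sup>2)" if t: "t > 0" for t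
  proof -
    obtain R' S' where *: "R' \<subseteq> S" "S' \<subseteq> R" "lines_le (\<lambda>i j. x j i) R' S' (t\<^sup>2)"
      "(\<Sum>i\<in>R'. \<Sum>j\<in>S'. x j i) = (\<Sum>l | l < n \<and> \<rho> l \<le> t. (\<rho> l)\<^sup>2)"
      using P(3)[rule_format, OF t] by (elim exE conjE) (rule that)
    have "(\<Sum>i\<in>S'. \<Sum>j\<in>R'. x i j) = (\<Sum>i\<in>R'. \<Sum>j\<in>S'. x j i)"
      by (rule sum.swap)
    then show ?thesis
      using * lines_le_transpose[OF *(3)] by (intro exI[of _ S'] conjI exI[of _ R']) simp_all
  qed
  moreover have "(\<Sum>i\<in>R. \<Sum>j\<in>S. x i j) = (\<Sum>l<n. (\<rho> l)\<^sup>2)"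
    using P(4) by (subst sum.swap)
  moreover have "split_cost q x R S (\<lambda>i j. \<not> c j i) \<le> (\<Sum>l<n. \<rho> l powr (2 * q))"
    using P(5) split_cost_transpose[of q x S R "\<lambda>i j. \<not> c j i"] by simp
  ultimately show ?thesis
    unfolding peelable_def using P(1,2) lines_le_transpose[of x R S]
    by (intro exI[of _ n] exI[of _ \<rho>] exI[of _ "\<lambda>i j. \<not> c j i"]) simp
qed

lemma peelable_add_row:
  assumes x: "\<And>i j. 0 \<le> x i j" and R: "finite R" and S: "finite S" and i: "i \<in> R"
    and M: "M = (\<Sum>j\<in>S. x i j)" "M > 0" "lines_le x R S M"
    and peel: "peelable q x (R - {i}) S"
  shows "peelable q x R S"
proof -
  obtain n :: nat and \<rho> c where P: "\<forall>l<n. 0 < \<rho> l"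
    "\<forall>M. lines_le x (R - {i}) S M \<longrightarrow> (\<forall>l<n. (\<rho> l)\<^sup>2 \<le> M)"
    "\<forall>t>0. \<exists>R'\<subseteq>R - {i}. \<exists>S'\<subseteq>S. lines_le x R' S' (t\<^sup>2)
          \<and> (\<Sum>i\<in>R'. \<Sum>j\<in>S'. x i j) = (\<Sum>l | l < n \<and> \<rho> l \<le> t. (\<rho> l)\<^sup>2)"
    "(\<Sum>i\<in>R - {i}. \<Sum>j\<in>S. x i j) = (\<Sum>l<n. (\<rho> l)\<^sup>2)"
    "split_cost q x (R - {i}) S c \<le> (\<Sum>l<n. \<rho> l powr (2 * q))"
    using peel unfolding peelable_def by (elim exE conjE) (rule that, assumption+)
  \<comment> \<open>row \<open>i\<close> is removed first, and all its entries go to the row part\<close>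
  define \<rho>' where "\<rho>' = \<rho>(n := sqrt M)"
  define c' where "c' = c(i := \<lambda>_. True)"
  have \<rho>'n: "\<rho>' n = sqrt M" and \<rho>'l: "\<And>l. l < n \<Longrightarrow> \<rho>' l = \<rho> l"
    by (auto simp: \<rho>'_def)
  have sub: "lines_le x (R - {i}) S M'" if "lines_le x R S M'" for M'
  proof -
    have "(\<Sum>k\<in>R - {i}. x k j) \<le> (\<Sum>k\<in>R. x k j)" for j
      using R x by (intro sum_mono2) auto
    then show ?thesis
      using that unfolding lines_le_def by (meson DiffD1 order_trans)
  qed
  have total: "(\<Sum>k\<in>R. \<Sum>j\<in>S. x k j) = (\<Sum>l<Suc n. (\<rho>' l)\<^sup>2)"
    using P(4) M(1,2) by (simp add: sum.remove[OF R i] \<rho>'n \<rho>'l)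
  have "0 < \<rho>' l" if "l < Suc n" for l
    using that P(1) M(2) by (cases "l = n") (auto simp: \<rho>'_def)
  moreover have "(\<rho>' l)\<^sup>2 \<le> M'" if "lines_le x R S M'" "l < Suc n" for M' l
    using that P(2) sub[OF that(1)] M i by (cases "l = n") (auto simp: \<rho>'_def lines_le_def)
  moreover have "\<exists>R'\<subseteq>R. \<exists>S'\<subseteq>S. lines_le x R' S' (t\<^sup>2)
      \<and> (\<Sum>k\<in>R'. \<Sum>j\<in>S'. x k j) = (\<Sum>l | l < Suc n \<and> \<rho>' l \<le> t. (\<rho>' l)\<^sup>2)" if t: "t > 0" for t
  proof (cases "sqrt M \<le> t")
    case True
    have Mt: "M \<le> t\<^sup>2"
      by (rule sqrt_le_D[OF True])
    have "\<rho>' l \<le> t" if "l < Suc n" for l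
    proof (cases "l = n")
      case False
      then have l: "l < n"
        using that by simp
      then have "(\<rho> l)\<^sup>2 \<le> t\<^sup>2"
        using P(2)[rule_format, OF sub[OF M(3)] l] Mt by linarith
      then show ?thesis
        unfolding \<rho>'l[OF l] by (rule power2_le_imp_le) (use t in simp)
    qed (simp add: \<rho>'n True)
    then have "{l. l < Suc n \<and> \<rho>' l \<le> t} = {..<Suc n}"
      by auto
    then show ?thesis
      using total M(3) Mt by (intro exI[of _ R] conjI exI[of _ S]) (auto simp: lines_le_def intro: order_trans)
  next
    case False
    then have "{l. l < Suc n \<and> \<rho>' l \<le> t} = {l. l < n \<and> \<rho> l \<le> t}"
      using \<rho>'n \<rho>'l by (auto simp: less_Suc_eq)
    moreover have "(\<Sum>l | l < n \<and> \<rho> l \<le> t. (\<rho>' l)\<^sup>2) = (\<Sum>l | l < n \<and> \<rho> l \<le> t. (\<rho> l)\<^sup>2)"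
      by (intro sum.cong) (auto simp: \<rho>'l)
    moreover obtain R' S' where "R' \<subseteq> R - {i}" "S' \<subseteq> S" "lines_le x R' S' (t\<^sup>2)"
      "(\<Sum>i\<in>R'. \<Sum>j\<in>S'. x i j) = (\<Sum>l | l < n \<and> \<rho> l \<le> t. (\<rho> l)\<^sup>2)"
      using P(3)[rule_format, OF t] by (elim exE conjE) (rule that)
    ultimately show ?thesis
      by (intro exI[of _ R'] conjI exI[of _ S']) auto
  qed
  moreover have "split_cost q x R S c' \<le> (\<Sum>l<Suc n. \<rho>' l powr (2 * q))"
  proof -
    have "(\<Sum>k\<in>R. (\<Sum>j\<in>S. if c' k j then x k j else 0) powr q)
        = M powr q + (\<Sum>k\<in>R - {i}. (\<Sum>j\<in>S. if c k j then x k j else 0) powr q)"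
      by (simp add: sum.remove[OF R i] c'_def M(1))
    moreover have "(\<Sum>k\<in>R. if c' k j then 0 else x k j) = (\<Sum>k\<in>R - {i}. if c k j then 0 else x k j)" for j
      by (simp add: sum.remove[OF R i] c'_def)
    ultimately have "split_cost q x R S c' = M powr q + split_cost q x (R - {i}) S c"
      by (simp add: split_cost_def)
    also have "M powr q = sqrt M powr (2 * q)"
      using M(2) by (simp add: powr_half_sqrt[symmetric] powr_powr)
    finally show ?thesis
      using P(5) by (simp add: \<rho>'n \<rho>'l)
  qed
  ultimately show ?thesis
    unfolding peelable_def using total
    by (intro exI[of _ "Suc n"] exI[of _ \<rho>'] exI[of _ c']) simp
qed

text \<open>Columns are removed as rows of the transposed matrix.\<close>

lemma peelable_finite:
  assumes "\<And>i j. 0 \<le> x i j" "finite R" "finite S"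
  shows "peelable q x R S"
  using assms
proof (induction "card R + card S" arbitrary: x R S rule: less_induct)
  case less
  note x = less.prems(1) and R = less.prems(2) and S = less.prems(3)
  let ?row = "\<lambda>i. \<Sum>j\<in>S. x i j" and ?col = "\<lambda>j. \<Sum>i\<in>R. x i j"
  define M where "M = Max (insert 0 (?row ` R \<union> ?col ` S))"
  have fin: "finite (insert 0 (?row ` R \<union> ?col ` S))"
    using R S by simp
  have le: "lines_le x R S M"
    unfolding lines_le_def M_def using fin by (auto intro!: Max_ge)
  have "M \<in> insert 0 (?row ` R \<union> ?col ` S)"
    unfolding M_def using fin by (rule Max_in) simp
  moreover have "M \<ge> 0"
    unfolding M_def using fin by (intro Max_ge) auto
  ultimately consider "M = 0" | i where "M > 0" "i \<in> R" "M = ?row i" | j where "M > 0" "j \<in> S" "M = ?col j"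
    by (cases "M = 0") (auto simp: order_less_le)
  then show ?case
  proof cases
    case 1
    have zero: "x i j = 0" if "i \<in> R" "j \<in> S" for i j
    proof -
      have "?row i \<le> 0"
        using le 1 that by (auto simp: lines_le_def)
      moreover have "x i j \<le> ?row i"
        using that x S by (intro member_le_sum) auto
      ultimately show ?thesis
        using x[of i j] by linarith
    qed
    have "split_cost q x R S (\<lambda>_ _. True) = 0"
      using zero by (simp add: split_cost_def)
    moreover have "(\<Sum>i\<in>R. \<Sum>j\<in>S. x i j) = 0"
      using zero by simp
    moreover have "lines_le x R S (t\<^sup>2)" for t
      using zero by (simp add: lines_le_def)
    ultimately show ?thesis
      unfolding peelable_def
      by (intro exI[of _ 0] exI[of _ "\<lambda>_. 0"] exI[of _ "\<lambda>_ _. True"]) auto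
  next
    case 2
    have "card (R - {i}) + card S < card R + card S"
      using card_Diff1_less[OF R 2(2)] by linarith
    then have "peelable q x (R - {i}) S"
      using R S x by (intro less.hyps) auto
    then show ?thesis
      using x R S 2 le by (intro peelable_add_row[of x R S i M]) auto
  next
    case 3
    have "card (S - {j}) + card R < card R + card S"
      using card_Diff1_less[OF S 3(2)] by linarith
    then have "peelable q (\<lambda>i j. x j i) (S - {j}) R"
      using R S x by (intro less.hyps) auto
    then have "peelable q (\<lambda>i j. x j i) S R"
      using x R S 3 lines_le_transpose[OF le]
      by (intro peelable_add_row[of "\<lambda>i j. x j i" S R j M]) auto
    then show ?thesis
      by (rule peelable_transpose)
  qed
qed

section \<open>Random signs\<close>

lemma cmod_sq_real_combination:
  "(cmod (\<Sum>i\<in>R. complex_of_real (e i) * z i))\<^sup>2 = (\<Sum>i\<in>R. \<Sum>k\<in>R. e i * e k * Re (z i * cnj (z k)))"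
proof -
  let ?S = "\<Sum>i\<in>R. complex_of_real (e i) * z i"
  have "(cmod ?S)\<^sup>2 = Re (?S * cnj ?S)"
    by (simp only: complex_norm_square[symmetric] Re_complex_of_real)
  also have "?S * cnj ?S = (\<Sum>i\<in>R. \<Sum>k\<in>R. complex_of_real (e i * e k) * (z i * cnj (z k)))"
    by (simp add: sum_product mult_ac)
  also have "Re \<dots> = (\<Sum>i\<in>R. \<Sum>k\<in>R. e i * e k * Re (z i * cnj (z k)))"
  proof -
    have "Re (complex_of_real a * u) = a * Re u" for a u
      by simp
    then show ?thesis
      by (simp only: Re_sum)
  qed
  finally show ?thesis .
qed

locale random_signs = prob_space M for M :: "'w measure" +
  fixes s :: "nat \<Rightarrow> nat \<Rightarrow> 'w \<Rightarrow> real"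
  assumes indep: "indep_vars (\<lambda>_. borel) (\<lambda>(i, j). s i j) (UNIV :: (nat \<times> nat) set)"
    and sign: "\<And>i j w. s i j w \<in> {1, -1}"
    and mean_zero: "\<And>i j. expectation (s i j) = 0"
begin

lemma sign_sq: "s i j w * s i j w = 1"
  using sign[of i j w] by auto

lemma abs_sign: "\<bar>s i j w\<bar> = 1"
  using sign[of i j w] by auto

lemma sign_measurable [measurable]: "s i j \<in> borel_measurable M"
proof -
  have "(case (i, j) of (i, j) \<Rightarrow> s i j) \<in> borel_measurable M"
    using indep unfolding indep_vars_def by blast
  then show ?thesis
    by simp
qed

lemma integrable_signs: "integrable M (\<lambda>w. s i j w * s k l w * s i' j' w * s k' l' w)"
  by (rule integrable_const_bound[of _ 1]) (auto simp: abs_mult abs_sign)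

text \<open>The four signs are distinct members of the independent family.\<close>

lemma expectation_four_signs:
  assumes "i \<noteq> i'" "j \<noteq> k"
  shows "expectation (\<lambda>w. s i j w * s i k w * s i' j w * s i' k w) = 0"
proof -
  let ?I = "{(i, j), (i, k), (i', j), (i', k)}"
  have "expectation (\<lambda>w. \<Prod>a\<in>?I. (\<lambda>(i, j). s i j) a w) = (\<Prod>a\<in>?I. expectation ((\<lambda>(i, j). s i j) a))"
  proof (rule indep_vars_lebesgue_integral)
    show "integrable M ((\<lambda>(i, j). s i j) a)" for a
      by (cases a) (auto intro!: integrable_const_bound[of _ 1] simp: abs_sign)
  qed (auto intro: indep_vars_subset[OF indep])
  then show ?thesis
    using assms by (simp add: mean_zero mult.assoc)
qed

text \<open>The squared Hilbert-Schmidt norm of the Gram matrix of the columns of a signed submatrix.\<close>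

definition gram_sq :: "(nat \<Rightarrow> nat \<Rightarrow> complex) \<Rightarrow> nat set \<Rightarrow> nat set \<Rightarrow> 'w \<Rightarrow> real" where
  "gram_sq lam R S w = (\<Sum>j\<in>S. \<Sum>k\<in>S. (cmod (\<Sum>i\<in>R. complex_of_real (s i j w) * lam i j
      * cnj (complex_of_real (s i k w) * lam i k)))\<^sup>2)"

text \<open>
  The diagonal entries of the Gram matrix are the deterministic column sums. In an off-diagonal entry
  \<open>(j, k)\<close> the random factors \<open>s i j * s i k\<close> are orthonormal over \<open>i\<close>, so that its second moment is
  \<open>\<Sum>\<^sub>i x i j * x i k\<close>. In the total, every \<open>x i j\<close> is multiplied by a row sum, from the
  off-diagonal entries, and by a column sum, from the diagonal ones; both are at most \<open>b\<close>.
\<close>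

lemma expectation_gram_sq:
  assumes R: "finite R" and S: "finite S" and le: "lines_le (\<lambda>i j. (cmod (lam i j))\<^sup>2) R S b"
  shows "integrable M (gram_sq lam R S)"
    and "expectation (gram_sq lam R S) \<le> 2 * b * (\<Sum>i\<in>R. \<Sum>j\<in>S. (cmod (lam i j))\<^sup>2)"
proof -
  define x where "x i j = (cmod (lam i j))\<^sup>2" for i j
  define z where "z j k i = lam i j * cnj (lam i k)" for j k i
  have entry: "(cmod (\<Sum>i\<in>R. complex_of_real (s i j w) * lam i j * cnj (complex_of_real (s i k w) * lam i k)))\<^sup>2
      = (\<Sum>i\<in>R. \<Sum>i'\<in>R. s i j w * s i k w * s i' j w * s i' k w * Re (z j k i * cnj (z j k i')))" for j k w
    using cmod_sq_real_combination[of "\<lambda>i. s i j w * s i k w" "z j k" R] by (simp add: z_def mult_ac)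
  have int: "integrable M (\<lambda>w. s i j w * s i k w * s i' j w * s i' k w * Re (z j k i * cnj (z j k i')))" for i i' j k
    by (intro integrable_mult_left integrable_signs)
  have gram: "gram_sq lam R S = (\<lambda>w. \<Sum>j\<in>S. \<Sum>k\<in>S. \<Sum>i\<in>R. \<Sum>i'\<in>R.
      s i j w * s i k w * s i' j w * s i' k w * Re (z j k i * cnj (z j k i')))"
    by (rule ext) (simp only: gram_sq_def entry)
  show "integrable M (gram_sq lam R S)"
    unfolding gram by (intro Bochner_Integration.integrable_sum int)
  have entry_le: "expectation (\<lambda>w. s i j w * s i k w * s i' j w * s i' k w * Re (z j k i * cnj (z j k i')))
      \<le> (if i = i' then x i j * x i k else 0) + (if j = k then x i j * x i' j else 0)" for i i' j k
  proof -
    have x0: "0 \<le> x i j" for i j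
      by (simp add: x_def)
    consider "i \<noteq> i'" "j \<noteq> k" | "i = i'" | "j = k"
      by blast
    then show ?thesis
    proof cases
      case 1
      then show ?thesis
        using expectation_four_signs[of i i' j k] by (simp add: integrable_signs)
    next
      case 2
      have "s i j w * s i k w * s i j w * s i k w = 1" for w
        using sign_sq[of i j w] sign_sq[of i k w] by (metis mult.assoc mult.commute mult.right_neutral)
      moreover have "Re (z j k i * cnj (z j k i)) = x i j * x i k"
        by (simp only: complex_norm_square[symmetric] Re_complex_of_real)
           (simp add: z_def x_def norm_mult power_mult_distrib)
      ultimately show ?thesis
        using 2 x0 by (auto simp: prob_space)
    next
      case 3
      have "s i j w * s i j w * s i' j w * s i' j w = 1" for w
        using sign_sq[of i j w] sign_sq[of i' j w] by (simp add: mult.assoc)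
      moreover have "z j j i * cnj (z j j i') = complex_of_real (x i j * x i' j)"
        by (simp only: z_def x_def of_real_mult complex_norm_square) simp
      ultimately show ?thesis
        using 3 x0 by (auto simp: prob_space)
    qed
  qed
  have "expectation (gram_sq lam R S) = (\<Sum>j\<in>S. \<Sum>k\<in>S. \<Sum>i\<in>R. \<Sum>i'\<in>R.
      expectation (\<lambda>w. s i j w * s i k w * s i' j w * s i' k w * Re (z j k i * cnj (z j k i'))))"
    unfolding gram
    by (simp only: Bochner_Integration.integral_sum Bochner_Integration.integrable_sum int)
  also have "\<dots> \<le> (\<Sum>j\<in>S. \<Sum>k\<in>S. \<Sum>i\<in>R. \<Sum>i'\<in>R.
      (if i = i' then x i j * x i k else 0) + (if j = k then x i j * x i' j else 0))"
    by (intro sum_mono entry_le)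
  also have "\<dots> = (\<Sum>j\<in>S. \<Sum>k\<in>S. \<Sum>i\<in>R. x i j * x i k) + (\<Sum>j\<in>S. \<Sum>i\<in>R. \<Sum>i'\<in>R. x i j * x i' j)"
  proof -
    have "(\<Sum>k\<in>S. \<Sum>i\<in>R. \<Sum>i'\<in>R. if j = k then x i j * x i' j else 0) = (\<Sum>i\<in>R. \<Sum>i'\<in>R. x i j * x i' j)"
      if "j \<in> S" for j
    proof -
      have "(\<Sum>k\<in>S. \<Sum>i\<in>R. \<Sum>i'\<in>R. if j = k then x i j * x i' j else 0)
          = (\<Sum>k\<in>S. if j = k then \<Sum>i\<in>R. \<Sum>i'\<in>R. x i j * x i' j else 0)"
        by (intro sum.cong) auto
      then show ?thesis
        using that S by simp
    qed
    then show ?thesis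
      using R by (simp add: sum.distrib)
  qed
  also have "(\<Sum>j\<in>S. \<Sum>k\<in>S. \<Sum>i\<in>R. x i j * x i k) = (\<Sum>i\<in>R. \<Sum>j\<in>S. x i j * (\<Sum>k\<in>S. x i k))"
  proof -
    have "(\<Sum>j\<in>S. \<Sum>k\<in>S. \<Sum>i\<in>R. x i j * x i k) = (\<Sum>j\<in>S. \<Sum>i\<in>R. \<Sum>k\<in>S. x i j * x i k)"
      by (intro sum.cong refl sum.swap)
    then show ?thesis
      by (simp add: sum_distrib_left) (rule sum.swap)
  qed
  also have "\<dots> \<le> (\<Sum>i\<in>R. \<Sum>j\<in>S. x i j * b)"
    using le by (intro sum_mono mult_left_mono) (auto simp: lines_le_def x_def)
  also have "(\<Sum>j\<in>S. \<Sum>i\<in>R. \<Sum>i'\<in>R. x i j * x i' j) = (\<Sum>j\<in>S. \<Sum>i\<in>R. x i j * (\<Sum>i'\<in>R. x i' j))"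
    by (simp add: sum_distrib_left)
  also have "\<dots> \<le> (\<Sum>j\<in>S. \<Sum>i\<in>R. x i j * b)"
    using le by (intro sum_mono mult_left_mono) (auto simp: lines_le_def x_def)
  also have "\<dots> = (\<Sum>i\<in>R. \<Sum>j\<in>S. x i j * b)"
    by (rule sum.swap)
  also have "(\<Sum>i\<in>R. \<Sum>j\<in>S. x i j * b) = b * (\<Sum>i\<in>R. \<Sum>j\<in>S. (cmod (lam i j))\<^sup>2)"
    by (simp add: x_def sum_distrib_left mult.commute)
  finally show "expectation (gram_sq lam R S) \<le> 2 * b * (\<Sum>i\<in>R. \<Sum>j\<in>S. (cmod (lam i j))\<^sup>2)"
    by simp
qed

end

context random_signs
begin

text \<open>
  The bound of \<open>submatrix_le_truncated_singular_values\<close> is used at \<open>\<tau> = 2 t\<close> for each level \<open>t\<close>. The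
  weighted sum \<open>Q\<close> of its fourth-moment errors has expectation at most an eighth of the cost \<open>C\<close>, so
  that by Markov's inequality \<open>Q < C / 2\<close> with probability at least \<open>3/4\<close>. On this event \<open>Q\<close> can be
  absorbed into \<open>C\<close>. The event is defined by \<open>Q\<close> alone, a polynomial in finitely many signs, and is
  therefore measurable.
\<close>

lemma split_cost_le_schatten:
  fixes lam :: "nat \<Rightarrow> nat \<Rightarrow> complex"
  assumes p: "0 < p" "p < 2"
  shows "\<exists>c. \<exists>A\<in>events. 3 / 4 \<le> prob A \<and> (\<forall>w\<in>A. \<forall>T V. compact_operator T \<longrightarrow> singular_system T V
    \<longrightarrow> (\<lambda>v. norm (T v) powr p) summable_on V
    \<longrightarrow> (\<forall>i j. coord (T (unit_vec j)) i = complex_of_real (s i j w) * lam i j)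
    \<longrightarrow> split_cost (p / 2) (\<lambda>i j. (cmod (lam i j))\<^sup>2) {..<N} {..<N} c
        \<le> (16 / p) * (\<Sum>\<^sub>\<infinity>v\<in>V. norm (T v) powr p))"
proof -
  let ?x = "\<lambda>i j. (cmod (lam i j))\<^sup>2"
  have "peelable (p / 2) ?x {..<N} {..<N}"
    by (rule peelable_finite) auto
  then obtain n :: nat and \<rho> c where \<rho>: "\<forall>l<n. 0 < \<rho> l"
    and chain: "\<forall>t>0. \<exists>R\<subseteq>{..<N}. \<exists>S\<subseteq>{..<N}. lines_le ?x R S (t\<^sup>2)
          \<and> (\<Sum>i\<in>R. \<Sum>j\<in>S. ?x i j) = (\<Sum>l | l < n \<and> \<rho> l \<le> t. (\<rho> l)\<^sup>2)"
    and cost: "split_cost (p / 2) ?x {..<N} {..<N} c \<le> (\<Sum>l<n. \<rho> l powr (2 * (p / 2)))"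
    unfolding peelable_def by (elim exE conjE) (rule that, assumption+)
  define C where "C = (\<Sum>l<n. \<rho> l powr p)"
  have cost: "split_cost (p / 2) ?x {..<N} {..<N} c \<le> C"
    using cost by (simp add: C_def)
  define H where "H t = (\<Sum>l | l < n \<and> \<rho> l \<le> t. (\<rho> l)\<^sup>2)" for t
  have "\<forall>t. \<exists>RS. t > 0 \<longrightarrow> fst RS \<subseteq> {..<N} \<and> snd RS \<subseteq> {..<N} \<and> lines_le ?x (fst RS) (snd RS) (t\<^sup>2)
      \<and> (\<Sum>i\<in>fst RS. \<Sum>j\<in>snd RS. ?x i j) = H t"
  proof
    fix t :: real
    show "\<exists>RS. t > 0 \<longrightarrow> fst RS \<subseteq> {..<N} \<and> snd RS \<subseteq> {..<N} \<and> lines_le ?x (fst RS) (snd RS) (t\<^sup>2)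
      \<and> (\<Sum>i\<in>fst RS. \<Sum>j\<in>snd RS. ?x i j) = H t"
    proof (cases "t > 0")
      case True
      obtain R S where "R \<subseteq> {..<N}" "S \<subseteq> {..<N}" "lines_le ?x R S (t\<^sup>2)"
        "(\<Sum>i\<in>R. \<Sum>j\<in>S. ?x i j) = H t"
        using chain[rule_format, OF True, folded H_def] by (elim exE conjE) (rule that)
      then show ?thesis
        by (intro exI[of _ "(R, S)"]) simp
    qed simp
  qed
  from choice[OF this] obtain RS where RS: "\<forall>t. t > 0 \<longrightarrow> fst (RS t) \<subseteq> {..<N} \<and> snd (RS t) \<subseteq> {..<N}
      \<and> lines_le ?x (fst (RS t)) (snd (RS t)) (t\<^sup>2) \<and> (\<Sum>i\<in>fst (RS t). \<Sum>j\<in>snd (RS t). ?x i j) = H t"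
    by (rule exE)
  define R where "R t = fst (RS t)" for t
  define S where "S t = snd (RS t)" for t
  have R: "R t \<subseteq> {..<N}" and S: "S t \<subseteq> {..<N}" and lines: "lines_le ?x (R t) (S t) (t\<^sup>2)"
    and H: "(\<Sum>i\<in>R t. \<Sum>j\<in>S t. ?x i j) = H t" if "t > 0" for t
    using RS[rule_format, OF that] by (simp_all add: R_def S_def)
  have finR: "finite (R t)" and finS: "finite (S t)" if "t > 0" for t
    using R[OF that] S[OF that] by (auto intro: finite_subset)
  define X where "X = \<rho> ` {..<n}"
  have X: "finite X" "\<And>t. t \<in> X \<Longrightarrow> 0 < t"
    using \<rho> by (auto simp: X_def)
  obtain wt where wt: "\<forall>t\<in>X. 0 \<le> wt t"
    "\<forall>y\<in>X. (\<Sum>t | t \<in> X \<and> y \<le> t. wt t) = y powr (p - 2)"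
    "\<forall>s\<ge>0. (\<Sum>t\<in>X. wt t * (min s t)\<^sup>2) \<le> (2 / p) * s powr p"
    using threshold_weights[OF p, of X] X by auto
  have C: "C = (\<Sum>t\<in>X. wt t * H t)"
  proof -
    have "(\<Sum>l\<in>{..<n}. \<rho> l powr p) = (\<Sum>t\<in>\<rho> ` {..<n}. wt t * (\<Sum>l | l \<in> {..<n} \<and> \<rho> l \<le> t. (\<rho> l)\<^sup>2))"
      by (rule sum_powr_eq_weighted) (use \<rho> wt(2) in \<open>auto simp: X_def\<close>)
    then show ?thesis
      by (simp add: C_def H_def X_def)
  qed
  define Q where "Q w = (\<Sum>t\<in>X. wt t / (16 * t\<^sup>2) * gram_sq lam (R t) (S t) w)" for w
  have gram_nonneg: "0 \<le> gram_sq lam (R t) (S t) w" for t w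
    by (simp add: gram_sq_def sum_nonneg)
  have Qint: "integrable M Q"
    unfolding Q_def
    by (intro Bochner_Integration.integrable_sum integrable_mult_right expectation_gram_sq(1)[OF finR finS lines] X)
  have Q0: "0 \<le> Q w" for w
    unfolding Q_def using wt(1) gram_nonneg by (intro sum_nonneg mult_nonneg_nonneg) auto
  have EQ: "expectation Q \<le> C / 8"
  proof -
    have "expectation Q = (\<Sum>t\<in>X. wt t / (16 * t\<^sup>2) * expectation (gram_sq lam (R t) (S t)))"
      unfolding Q_def
      by (subst Bochner_Integration.integral_sum)
         (auto intro!: integrable_mult_right expectation_gram_sq(1)[OF finR finS lines] X)
    also have "\<dots> \<le> (\<Sum>t\<in>X. wt t / (16 * t\<^sup>2) * (2 * t\<^sup>2 * H t))"
    proof (intro sum_mono mult_left_mono)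
      fix t assume "t \<in> X"
      then have t: "t > 0"
        by (rule X)
      show "expectation (gram_sq lam (R t) (S t)) \<le> 2 * t\<^sup>2 * H t"
        using expectation_gram_sq(2)[OF finR finS lines, OF t t t] by (simp only: H[OF t])
      show "0 \<le> wt t / (16 * t\<^sup>2)"
        using wt(1) \<open>t \<in> X\<close> by simp
    qed
    also have "\<dots> = (\<Sum>t\<in>X. wt t * H t / 8)"
      using X(2) by (intro sum.cong refl) (force simp: field_simps)
    finally show ?thesis
      by (simp add: C sum_divide_distrib)
  qed
  show ?thesis
  proof (cases "C \<le> 0")
    case True
    have "split_cost (p / 2) ?x {..<N} {..<N} c \<le> (16 / p) * (\<Sum>\<^sub>\<infinity>v\<in>V. norm (T v) powr p)"
      for T :: "ell2 \<Rightarrow> ell2" and V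
      using cost True p infsum_nonneg[of V "\<lambda>v. norm (T v) powr p"]
      by (smt (verit) divide_nonneg_pos mult_nonneg_nonneg powr_ge_zero)
    then show ?thesis
      by (intro exI[of _ c] bexI[of _ "space M"]) (auto simp: prob_space)
  next
    case False
    define A where "A = space M - {w\<in>space M. C / 2 \<le> Q w}"
    have [measurable]: "Q \<in> borel_measurable M"
      using Qint by (rule borel_measurable_integrable)
    have B: "{w\<in>space M. C / 2 \<le> Q w} \<in> events"
      by measurable
    have "prob {w\<in>space M. C / 2 \<le> Q w} \<le> expectation Q / (C / 2)"
      by (rule integral_Markov_inequality_measure[OF Qint sets.empty_sets]) (use Q0 False in auto)
    also have "\<dots> \<le> 1 / 4"
      using EQ False by (simp add: field_simps)
    finally have "3 / 4 \<le> prob A"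
      using prob_compl[OF B] by (simp add: A_def)
    moreover have "A \<in> events"
      using B by (simp add: A_def sets.compl_sets)
    moreover have "split_cost (p / 2) ?x {..<N} {..<N} c \<le> (16 / p) * (\<Sum>\<^sub>\<infinity>v\<in>V. norm (T v) powr p)"
      if w: "w \<in> A" and T: "compact_operator T" and V: "singular_system T V"
        and sum: "(\<lambda>v. norm (T v) powr p) summable_on V"
        and entries: "\<forall>i j. coord (T (unit_vec j)) i = complex_of_real (s i j w) * lam i j" for w T V
    proof -
      define Y where "Y = (\<Sum>\<^sub>\<infinity>v\<in>V. norm (T v) powr p)"
      define D where "D = real N * sum wt X"
      have Qw: "Q w < C / 2"
        using w by (auto simp: A_def)
      have Xne: "X \<noteq> {}"
        using False by (auto simp: C)
      define m where "m = Min X"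
      have m: "m > 0" "\<And>t. t \<in> X \<Longrightarrow> m \<le> t"
        using X Xne by (auto simp: m_def)
      \<comment> \<open>\<open>\<delta>\<close> is the cutoff below which singular values are ignored\<close>
      have bound: "C \<le> (8 / p) * Y + D * \<delta>\<^sup>2 + Q w" if \<delta>: "0 < \<delta>" "\<delta> \<le> m" for \<delta>
      proof -
        define G where "G = {v\<in>V. norm (T v) > \<delta>}"
        have G: "finite G" "G \<subseteq> V"
          using finite_large_singular[OF T V \<delta>(1)] by (auto simp: G_def)
        have level: "H t \<le> 4 * (\<Sum>v\<in>G. (min (norm (T v)) t)\<^sup>2) + N * \<delta>\<^sup>2
            + gram_sq lam (R t) (S t) w / (16 * t\<^sup>2)" if "t \<in> X" for t
        proof -
          have t: "t > 0" "\<delta> \<le> 2 * t"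
            using X(2)[OF that] m(2)[OF that] \<delta> by auto
          have "(\<Sum>i\<in>R t. \<Sum>j\<in>S t. (cmod (complex_of_real (s i j w) * lam i j))\<^sup>2) = H t"
            by (simp add: norm_mult abs_sign H[OF t(1)])
          then have "H t \<le> (\<Sum>v\<in>G. (min (norm (T v)) (2 * t))\<^sup>2) + card (S t) * \<delta>\<^sup>2
              + gram_sq lam (R t) (S t) w / (4 * (2 * t)\<^sup>2)"
            using submatrix_le_truncated_singular_values[OF T V finR[OF t(1)] finS[OF t(1)] \<delta>(1) t(2),
                of "\<lambda>i j. complex_of_real (s i j w) * lam i j"] entries
            by (simp add: gram_sq_def G_def)
          \<comment> \<open>back from level \<open>2 t\<close> to level \<open>t\<close>\<close>
          also have "(\<Sum>v\<in>G. (min (norm (T v)) (2 * t))\<^sup>2) \<le> (\<Sum>v\<in>G. 4 * (min (norm (T v)) t)\<^sup>2)"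
          proof (rule sum_mono)
            fix v
            have "(min (norm (T v)) (2 * t))\<^sup>2 \<le> (2 * min (norm (T v)) t)\<^sup>2"
              using t(1) norm_ge_zero[of "T v"] by (intro power_mono) (auto simp: min_def simp del: norm_ge_zero)
            then show "(min (norm (T v)) (2 * t))\<^sup>2 \<le> 4 * (min (norm (T v)) t)\<^sup>2"
              by (simp add: power_mult_distrib)
          qed
          also have "real (card (S t)) * \<delta>\<^sup>2 \<le> N * \<delta>\<^sup>2"
            using card_mono[OF _ S[OF t(1)]] by (intro mult_right_mono) auto
          finally show ?thesis
            by (simp add: sum_distrib_left power_mult_distrib)
        qed
        have "C \<le> (\<Sum>t\<in>X. wt t * (4 * (\<Sum>v\<in>G. (min (norm (T v)) t)\<^sup>2) + N * \<delta>\<^sup>2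
            + gram_sq lam (R t) (S t) w / (16 * t\<^sup>2)))"
          unfolding C using wt(1) level by (intro sum_mono mult_left_mono) auto
        also have "\<dots> = 4 * (\<Sum>t\<in>X. \<Sum>v\<in>G. wt t * (min (norm (T v)) t)\<^sup>2) + D * \<delta>\<^sup>2 + Q w"
          by (simp add: Q_def D_def distrib_left sum.distrib sum_distrib_left sum_distrib_right mult_ac)
        also have "(\<Sum>t\<in>X. \<Sum>v\<in>G. wt t * (min (norm (T v)) t)\<^sup>2) = (\<Sum>v\<in>G. \<Sum>t\<in>X. wt t * (min (norm (T v)) t)\<^sup>2)"
          by (rule sum.swap)
        also have "\<dots> \<le> (\<Sum>v\<in>G. (2 / p) * norm (T v) powr p)"
          using wt(3) by (intro sum_mono) auto
        also have "\<dots> = (2 / p) * (\<Sum>v\<in>G. norm (T v) powr p)"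
          by (simp add: sum_distrib_left)
        also have "(\<Sum>v\<in>G. norm (T v) powr p) \<le> Y"
          unfolding Y_def using sum G by (intro finite_sum_le_infsum) auto
        finally show ?thesis
          using p by (simp add: mult_left_mono divide_right_mono)
      qed
      have "C / 2 \<le> (8 / p) * Y"
      proof (rule LIMSEQ_le_const)
        have "(\<lambda>n. (8 / p) * Y + D * (m * inverse (real (Suc n)))\<^sup>2) \<longlonglongrightarrow> (8 / p) * Y + D * (m * 0)\<^sup>2"
          by (intro tendsto_intros LIMSEQ_inverse_real_of_nat)
        then show "(\<lambda>n. (8 / p) * Y + D * (m * inverse (real (Suc n)))\<^sup>2) \<longlonglongrightarrow> (8 / p) * Y"
          by simp
        have "C / 2 \<le> (8 / p) * Y + D * (m * inverse (real (Suc n)))\<^sup>2" for n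
        proof -
          have "m * inverse (real (Suc n)) \<le> m * 1"
            using m(1) by (intro mult_left_mono) (auto simp: inverse_le_1_iff)
          then show ?thesis
            using bound[of "m * inverse (real (Suc n))"] m(1) Qw by (simp del: of_nat_Suc)
        qed
        then show "\<exists>N. \<forall>n\<ge>N. C / 2 \<le> (8 / p) * Y + D * (m * inverse (real (Suc n)))\<^sup>2"
          by blast
      qed
      then have "C \<le> (16 / p) * Y"
        by simp
      then show ?thesis
        using cost by (simp add: Y_def)
    qed
    ultimately show ?thesis
      by blast
  qed
qed

text \<open>
  With positive probability, infinitely many of the events for different corners occur, since each
  has probability at least \<open>3/4\<close>; at such a point, unbounded costs would contradict a finite Schatten norm.
\<close>

lemma split_cost_bounded:
  fixes lam :: "nat \<Rightarrow> nat \<Rightarrow> complex"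
  assumes p: "0 < p" "p < 2"
    and AE: "AE w in M. matrix_in_schatten p (\<lambda>i j. complex_of_real (s i j w) * lam i j)"
  shows "\<exists>K. \<forall>N. \<exists>c. split_cost (p / 2) (\<lambda>i j. (cmod (lam i j))\<^sup>2) {..<N} {..<N} c \<le> K"
proof -
  let ?cost = "\<lambda>N. split_cost (p / 2) (\<lambda>i j. (cmod (lam i j))\<^sup>2) {..<N} {..<N}"
  let ?good = "\<lambda>w. matrix_in_schatten p (\<lambda>i j. complex_of_real (s i j w) * lam i j)"
  define ok where "ok N c A \<longleftrightarrow> A \<in> events \<and> 3 / 4 \<le> prob A
      \<and> (\<forall>w\<in>A. \<forall>T V. compact_operator T \<longrightarrow> singular_system T V
        \<longrightarrow> (\<lambda>v. norm (T v) powr p) summable_on V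
        \<longrightarrow> (\<forall>i j. coord (T (unit_vec j)) i = complex_of_real (s i j w) * lam i j)
        \<longrightarrow> ?cost N c \<le> (16 / p) * (\<Sum>\<^sub>\<infinity>v\<in>V. norm (T v) powr p))" for N c A
  have "\<exists>c A. ok N c A" for N
    using split_cost_le_schatten[OF p, of lam N] unfolding ok_def
    by (elim exE bexE conjE) (intro exI conjI)
  then obtain c A where ok: "\<And>N. ok N (c N) (A N)"
    by metis
  have "\<exists>K. \<forall>N. ?cost N (c N) \<le> K"
  proof (rule ccontr)
    assume "\<nexists>K. \<forall>N. ?cost N (c N) \<le> K"
    then have "\<forall>k. \<exists>N. real k < ?cost N (c N)"
      by (meson not_le)
    then obtain N where N: "\<And>k. real k < ?cost (N k) (c (N k))"
      by metis
    define B where "B m = (\<Union>k\<in>{m..}. A (N k))" for m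
    have AN: "A (N k) \<in> events" "3 / 4 \<le> prob (A (N k))" for k
      using ok[of "N k"] by (auto simp: ok_def)
    have Be: "B m \<in> events" for m
      unfolding B_def using AN(1) by (intro sets.countable_UN) auto
    have "3 / 4 \<le> prob (B m)" for m
      by (rule order_trans[OF AN(2)[of m] finite_measure_mono[OF _ Be]]) (auto simp: B_def)
    moreover have "(\<lambda>m. prob (B m)) \<longlonglongrightarrow> prob (\<Inter>m. B m)"
    proof (rule finite_Lim_measure_decseq)
      show "decseq B"
        unfolding decseq_def B_def by (intro allI impI UN_mono) auto
    qed (use Be in auto)
    ultimately have big: "3 / 4 \<le> prob (\<Inter>m. B m)"
      by (intro LIMSEQ_le_const) auto
    have bad: "\<not> ?good w" if "w \<in> (\<Inter>m. B m)" for w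
    proof
      assume "?good w"
      then obtain T where T: "T \<in> schatten_class p"
        "\<forall>i j. coord (T (unit_vec j)) i = complex_of_real (s i j w) * lam i j"
        unfolding matrix_in_schatten_def by blast
      have cT: "compact_operator T"
        using T(1) by (simp add: schatten_class_def)
      obtain V where V: "singular_system T V"
        using singular_system_exists[OF cT] by blast
      have sum: "(\<lambda>v. norm (T v) powr p) summable_on V"
        using T(1) schatten_class_iff[OF cT V] by simp
      define Y where "Y = (16 / p) * (\<Sum>\<^sub>\<infinity>v\<in>V. norm (T v) powr p)"
      obtain m :: nat where m: "Y < m"
        using reals_Archimedean2 by blast
      have "w \<in> B m"
        using that by blast
      then obtain k where k: "k \<ge> m" "w \<in> A (N k)"
        by (auto simp: B_def)
      then have "?cost (N k) (c (N k)) \<le> Y"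
        using ok[of "N k"] cT V sum T(2) unfolding ok_def Y_def by blast
      then show False
        using N[of k] k(1) m by linarith
    qed
    have "(\<Inter>m. B m) \<in> events"
      using Be by (intro sets.countable_INT) auto
    moreover have "AE w in M. w \<notin> (\<Inter>m. B m)"
      by (rule eventually_mono[OF AE]) (use bad in blast)
    ultimately have "prob (\<Inter>m. B m) = 0"
      by (simp add: prob_eq_0)
    then show False
      using big by simp
  qed
  then show ?thesis
    by blast
qed

end

section \<open>Passing from finite corners to the whole matrix\<close>

text \<open>Sequential compactness of the space of all assignments \<open>\<nat> \<times> \<nat> \<rightarrow> {0, 1}\<close>.\<close>

lemma choice_patterns_limit:
  fixes c :: "nat \<Rightarrow> nat \<Rightarrow> nat \<Rightarrow> bool"
  shows "\<exists>d. \<forall>n. \<exists>N\<ge>n. \<forall>i<n. \<forall>j<n. c N i j = d i j"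
proof -
  define z where "z N = (\<lambda>(i, j). if c N i j then 1 else 0 :: real)" for N
  have "compactin (product_topology (\<lambda>_. euclidean) UNIV) (PiE (UNIV :: (nat \<times> nat) set) (\<lambda>_. {0, 1 :: real}))"
    by (simp add: compactin_PiE)
  then have "seq_compact (PiE (UNIV :: (nat \<times> nat) set) (\<lambda>_. {0, 1 :: real}))"
    by (simp add: euclidean_product_topology compact_imp_seq_compact)
  moreover have "\<forall>N. z N \<in> PiE UNIV (\<lambda>_. {0, 1})"
    by (auto simp: z_def split: if_splits)
  ultimately obtain l r where r: "strict_mono r" and l: "(z \<circ> r) \<longlonglongrightarrow> l"
    by (rule seq_compactE)
  have "\<forall>\<^sub>F k in sequentially. c (r k) i j = (l (i, j) > 1 / 2)" for i j
  proof -
    have lim: "(\<lambda>k. z (r k) (i, j)) \<longlonglongrightarrow> l (i, j)"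
      using continuous_on_tendsto_compose[OF continuous_on_product_coordinates l] by (simp add: o_def)
    show ?thesis
    proof (cases "l (i, j) > 1 / 2")
      case True
      show ?thesis
        using order_tendstoD(1)[OF lim True]
        by (rule eventually_mono) (use True in \<open>auto simp: z_def split: if_splits\<close>)
    next
      case False
      then have "l (i, j) < 1"
        by simp
      then show ?thesis
        using order_tendstoD(2)[OF lim \<open>l (i, j) < 1\<close>]
        by (rule_tac eventually_mono) (use False in \<open>auto simp: z_def split: if_splits\<close>)
    qed
  qed
  then have agree: "\<forall>\<^sub>F k in sequentially. \<forall>i\<in>{..<n}. \<forall>j\<in>{..<n}. c (r k) i j = (l (i, j) > 1 / 2)" for n
    by (intro eventually_ball_finite ballI) auto
  have "\<exists>N\<ge>n. \<forall>i<n. \<forall>j<n. c N i j = (l (i, j) > 1 / 2)" for n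
  proof -
    have "\<exists>k. k \<ge> n \<and> (\<forall>i\<in>{..<n}. \<forall>j\<in>{..<n}. c (r k) i j = (l (i, j) > 1 / 2))"
      by (rule eventually_happens'[OF sequentially_bot eventually_conj[OF eventually_ge_at_top agree]])
    then obtain k where k: "k \<ge> n" "\<forall>i\<in>{..<n}. \<forall>j\<in>{..<n}. c (r k) i j = (l (i, j) > 1 / 2)"
      by blast
    then have "r k \<ge> n"
      using seq_suble[OF r, of k] by simp
    with k(2) show ?thesis
      by auto
  qed
  then show ?thesis
    by (intro exI[of _ "\<lambda>i j. l (i, j) > 1 / 2"]) blast
qed

lemma split_cost_mono:
  assumes x: "\<And>i j. 0 \<le> x i j" and q: "0 < q" and n: "n \<le> N"
    and eq: "\<And>i j. i < n \<Longrightarrow> j < n \<Longrightarrow> c i j = d i j"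
  shows "split_cost q x {..<n} {..<n} d \<le> split_cost q x {..<N} {..<N} c"
proof -
  have "(\<Sum>i<n. (\<Sum>j<n. if d i j then x i j else 0) powr q) \<le> (\<Sum>i<N. (\<Sum>j<N. if c i j then x i j else 0) powr q)"
  proof -
    have "(\<Sum>i<n. (\<Sum>j<n. if d i j then x i j else 0) powr q) = (\<Sum>i<n. (\<Sum>j<n. if c i j then x i j else 0) powr q)"
      using eq by (intro sum.cong refl arg_cong[of _ _ "\<lambda>u. u powr q"]) auto
    also have "\<dots> \<le> (\<Sum>i<n. (\<Sum>j<N. if c i j then x i j else 0) powr q)"
      using x n q by (intro sum_mono powr_mono2 sum_mono2 sum_nonneg) auto
    also have "\<dots> \<le> (\<Sum>i<N. (\<Sum>j<N. if c i j then x i j else 0) powr q)"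
      using n by (intro sum_mono2) auto
    finally show ?thesis .
  qed
  moreover have "(\<Sum>j<n. (\<Sum>i<n. if d i j then 0 else x i j) powr q) \<le> (\<Sum>j<N. (\<Sum>i<N. if c i j then 0 else x i j) powr q)"
  proof -
    have "(\<Sum>j<n. (\<Sum>i<n. if d i j then 0 else x i j) powr q) = (\<Sum>j<n. (\<Sum>i<n. if c i j then 0 else x i j) powr q)"
      using eq by (intro sum.cong refl arg_cong[of _ _ "\<lambda>u. u powr q"]) auto
    also have "\<dots> \<le> (\<Sum>j<n. (\<Sum>i<N. if c i j then 0 else x i j) powr q)"
      using x n q by (intro sum_mono powr_mono2 sum_mono2 sum_nonneg) auto
    also have "\<dots> \<le> (\<Sum>j<N. (\<Sum>i<N. if c i j then 0 else x i j) powr q)"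
      using n by (intro sum_mono2) auto
    finally show ?thesis .
  qed
  ultimately show ?thesis
    by (simp add: split_cost_def)
qed

lemma summable_rows_of_bounded_corners:
  fixes y :: "nat \<Rightarrow> nat \<Rightarrow> real"
  assumes y: "\<And>i j. 0 \<le> y i j" and q: "0 < q"
    and K: "\<And>n. (\<Sum>i<n. (\<Sum>j<n. y i j) powr q) \<le> K"
  shows "summable (\<lambda>j. y i j)" and "summable (\<lambda>i. (\<Sum>j. y i j) powr q)"
proof -
  have rect: "(\<Sum>i<n. (\<Sum>j<m. y i j) powr q) \<le> K" for n m
  proof -
    have "(\<Sum>i<n. (\<Sum>j<m. y i j) powr q) \<le> (\<Sum>i<n. (\<Sum>j<max n m. y i j) powr q)"
      using y q by (intro sum_mono powr_mono2 sum_mono2 sum_nonneg) auto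
    also have "\<dots> \<le> (\<Sum>i<max n m. (\<Sum>j<max n m. y i j) powr q)"
      by (intro sum_mono2) auto
    finally show ?thesis
      using K order_trans by blast
  qed
  have K0: "0 \<le> K"
    using K[of 0] by simp
  show row: "summable (\<lambda>j. y i j)" for i
  proof (rule summableI_nonneg_bounded[of _ "K powr (1 / q)"])
    fix n
    have "(\<Sum>j<n. y i j) powr q \<le> (\<Sum>k<Suc i. (\<Sum>j<n. y k j) powr q)"
      by (rule member_le_sum) auto
    also have "\<dots> \<le> K"
      by (rule rect)
    finally have "((\<Sum>j<n. y i j) powr q) powr (1 / q) \<le> K powr (1 / q)"
      using q by (intro powr_mono2) auto
    then show "(\<Sum>j<n. y i j) \<le> K powr (1 / q)"
      using q y by (simp add: powr_powr sum_nonneg)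
  qed (rule y)
  have "(\<Sum>i<n. (\<Sum>j. y i j) powr q) \<le> K" for n
  proof (rule LIMSEQ_le_const2)
    show "(\<lambda>m. \<Sum>i<n. (\<Sum>j<m. y i j) powr q) \<longlonglongrightarrow> (\<Sum>i<n. (\<Sum>j. y i j) powr q)"
      using q y by (intro tendsto_sum tendsto_powr' summable_LIMSEQ row tendsto_const)
        (auto intro!: always_eventually sum_nonneg)
  qed (use rect in blast)
  then show "summable (\<lambda>i. (\<Sum>j. y i j) powr q)"
    by (intro summableI_nonneg_bounded[of _ K]) auto
qed

lemma decomposition_of_bounded_splits:
  fixes lam :: "nat \<Rightarrow> nat \<Rightarrow> complex"
  assumes q: "0 < q"
    and bounded: "\<forall>N. \<exists>c. split_cost q (\<lambda>i j. (cmod (lam i j))\<^sup>2) {..<N} {..<N} c \<le> K"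
  shows "\<exists>a b. (\<forall>i j. lam i j = a i j + b i j)
    \<and> (\<forall>i. summable (\<lambda>j. (cmod (a i j))\<^sup>2))
    \<and> summable (\<lambda>i. (\<Sum>j. (cmod (a i j))\<^sup>2) powr q)
    \<and> (\<forall>j. summable (\<lambda>i. (cmod (b i j))\<^sup>2))
    \<and> summable (\<lambda>j. (\<Sum>i. (cmod (b i j))\<^sup>2) powr q)"
proof -
  let ?x = "\<lambda>i j. (cmod (lam i j))\<^sup>2"
  obtain c where c: "\<And>N. split_cost q ?x {..<N} {..<N} (c N) \<le> K"
    using bounded by metis
  obtain d where d: "\<And>n. \<exists>N\<ge>n. \<forall>i<n. \<forall>j<n. c N i j = d i j"
    using choice_patterns_limit[of c] by blast
  have K: "split_cost q ?x {..<n} {..<n} d \<le> K" for n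
  proof -
    obtain N where N: "N \<ge> n" "\<forall>i<n. \<forall>j<n. c N i j = d i j"
      using d by blast
    have "split_cost q ?x {..<n} {..<n} d \<le> split_cost q ?x {..<N} {..<N} (c N)"
      using N q by (intro split_cost_mono) auto
    then show ?thesis
      using c[of N] by simp
  qed
  define a where "a i j = (if d i j then lam i j else 0)" for i j
  define b where "b i j = (if d i j then 0 else lam i j)" for i j
  have a2: "(cmod (a i j))\<^sup>2 = (if d i j then ?x i j else 0)"
    and b2: "(cmod (b i j))\<^sup>2 = (if d i j then 0 else ?x i j)" for i j
    by (simp_all add: a_def b_def)
  have "(\<Sum>i<n. (\<Sum>j<n. (cmod (a i j))\<^sup>2) powr q) \<le> K" for n
  proof -
    have "0 \<le> (\<Sum>j<n. (\<Sum>i<n. if d i j then 0 else ?x i j) powr q)"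
      by (intro sum_nonneg) auto
    then show ?thesis
      using K[of n] unfolding split_cost_def a2 by linarith
  qed
  note A = summable_rows_of_bounded_corners[of "\<lambda>i j. (cmod (a i j))\<^sup>2", OF zero_le_power2 q this]
  have "(\<Sum>j<n. (\<Sum>i<n. (cmod (b i j))\<^sup>2) powr q) \<le> K" for n
  proof -
    have "0 \<le> (\<Sum>i<n. (\<Sum>j<n. if d i j then ?x i j else 0) powr q)"
      by (intro sum_nonneg) auto
    then show ?thesis
      using K[of n] unfolding split_cost_def b2 by linarith
  qed
  note B = summable_rows_of_bounded_corners[of "\<lambda>j i. (cmod (b i j))\<^sup>2", OF zero_le_power2 q this]
  have "lam i j = a i j + b i j" for i j
    by (simp add: a_def b_def)
  then show ?thesis
    using A B by blast
qed

section \<open>The characterization\<close>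

theorem corollary3p3:
  fixes p :: real
    and lam :: "nat \<Rightarrow> nat \<Rightarrow> complex"
    and M :: "'w measure"
    and eps :: "nat \<Rightarrow> nat \<Rightarrow> 'w \<Rightarrow> real"
  assumes p: "0 < p" "p < 1"
    and M: "prob_space M"
    and indep: "prob_space.indep_vars M (\<lambda>_. borel) (\<lambda>(i, j). eps i j) (UNIV :: (nat \<times> nat) set)"
    and eps_pos: "\<And>i j. measure M {w \<in> space M. eps i j w = 1} = 1/2"
    and eps_neg: "\<And>i j. measure M {w \<in> space M. eps i j w = -1} = 1/2"
  shows
    "((AE w in M. matrix_in_schatten p (\<lambda>i j. complex_of_real (eps i j w) * lam i j))
        \<longleftrightarrow>
      (\<forall>\<sigma> :: nat \<Rightarrow> nat \<Rightarrow> real. (\<forall>i j. \<sigma> i j \<in> {1, -1}) \<longrightarrow>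
          matrix_in_schatten p (\<lambda>i j. complex_of_real (\<sigma> i j) * lam i j)))
     \<and>
     ((\<forall>\<sigma> :: nat \<Rightarrow> nat \<Rightarrow> real. (\<forall>i j. \<sigma> i j \<in> {1, -1}) \<longrightarrow>
          matrix_in_schatten p (\<lambda>i j. complex_of_real (\<sigma> i j) * lam i j))
        \<longleftrightarrow>
      (\<exists>a b :: nat \<Rightarrow> nat \<Rightarrow> complex.
          (\<forall>i j. lam i j = a i j + b i j)
          \<and> (\<forall>i. summable (\<lambda>j. (cmod (a i j))\<^sup>2))
          \<and> summable (\<lambda>i. (\<Sum>j. (cmod (a i j))\<^sup>2) powr (p/2))
          \<and> (\<forall>j. summable (\<lambda>i. (cmod (b i j))\<^sup>2))
          \<and> summable (\<lambda>j. (\<Sum>i. (cmod (b i j))\<^sup>2) powr (p/2))))"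
    (is "(?almost \<longleftrightarrow> ?all) \<and> (?all \<longleftrightarrow> ?decomposition)")
proof -
  interpret prob_space M
    by (rule M)
  have [measurable]: "eps i j \<in> borel_measurable M" for i j
  proof -
    have "(case (i, j) of (i, j) \<Rightarrow> eps i j) \<in> borel_measurable M"
      using indep unfolding indep_vars_def by blast
    then show ?thesis
      by simp
  qed
  \<comment> \<open>a version of the signs that is \<open>\<plusminus>1\<close> everywhere, not only almost surely\<close>
  define sg :: "real \<Rightarrow> real" where "sg x = (if x = 1 then 1 else -1)" for x
  have sg_measurable: "sg \<in> borel_measurable borel"
    unfolding sg_def by measurable
  define s where "s i j w = sg (eps i j w)" for i j w
  have sign: "s i j w \<in> {1, -1}" for i j w
    by (simp add: s_def sg_def)
  have eps_sign: "AE w in M. eps i j w \<in> {1, -1}" for i j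
  proof -
    have "prob ({w\<in>space M. eps i j w = 1} \<union> {w\<in>space M. eps i j w = -1})
        = prob {w\<in>space M. eps i j w = 1} + prob {w\<in>space M. eps i j w = -1}"
      by (rule finite_measure_Union) auto
    then have "prob ({w\<in>space M. eps i j w = 1} \<union> {w\<in>space M. eps i j w = -1}) = 1"
      by (simp add: eps_pos eps_neg)
    moreover have "{w\<in>space M. eps i j w = 1} \<union> {w\<in>space M. eps i j w = -1}
        = {w\<in>space M. eps i j w \<in> {1, -1}}"
      by auto
    ultimately show ?thesis
      by (subst prob_Collect_eq_1[symmetric]) auto
  qed
  then have eps_s: "AE w in M. \<forall>i j. eps i j w = s i j w"
    unfolding AE_all_countable
  proof (intro allI)
    fix i j
    show "AE w in M. eps i j w = s i j w"
      using eps_sign[of i j] by (rule AE_mp) (auto simp: s_def sg_def)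
  qed
  interpret random_signs M s
  proof
    have "indep_vars (\<lambda>_. borel) (\<lambda>a w. sg ((case a of (i, j) \<Rightarrow> eps i j) w)) (UNIV :: (nat \<times> nat) set)"
      by (rule indep_vars_compose2[OF indep]) (rule sg_measurable)
    moreover have "(\<lambda>a w. sg ((case a of (i, j) \<Rightarrow> eps i j) w)) = (\<lambda>(i, j). s i j)"
      by (auto simp: s_def fun_eq_iff)
    ultimately show "indep_vars (\<lambda>_. borel) (\<lambda>(i, j). s i j) (UNIV :: (nat \<times> nat) set)"
      by simp
    show "s i j w \<in> {1, -1}" for i j w
      by (rule sign)
    show "expectation (s i j) = 0" for i j
    proof -
      have [measurable]: "{w\<in>space M. eps i j w = 1} \<in> events"
        by measurable
      have "expectation (s i j) = expectation (\<lambda>w. 2 * indicator {w\<in>space M. eps i j w = 1} w - 1)"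
        by (intro Bochner_Integration.integral_cong) (auto simp: s_def sg_def)
      also have "\<dots> = 0"
        by (subst Bochner_Integration.integral_diff) (auto simp: eps_pos prob_space less_top[symmetric])
      finally show ?thesis .
    qed
  qed
  have "?decomposition" if ?almost
  proof -
    have "AE w in M. matrix_in_schatten p (\<lambda>i j. complex_of_real (s i j w) * lam i j)"
      using that eps_s by eventually_elim simp
    then obtain K where "\<forall>N. \<exists>c. split_cost (p / 2) (\<lambda>i j. (cmod (lam i j))\<^sup>2) {..<N} {..<N} c \<le> K"
      using split_cost_bounded[of p lam] p by auto
    then show ?thesis
      using p by (intro decomposition_of_bounded_splits[of _ _ K]) auto
  qed
  moreover have "?all" if dec: ?decomposition
  proof (intro allI impI)
    fix \<sigma> :: "nat \<Rightarrow> nat \<Rightarrow> real"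
    assume \<sigma>: "\<forall>i j. \<sigma> i j \<in> {1, -1}"
    have abs_\<sigma>: "\<bar>\<sigma> i j\<bar> = 1" for i j
      using \<sigma>[rule_format, of i j] by auto
    obtain a b where ab: "\<forall>i j. lam i j = a i j + b i j"
      "\<forall>i. summable (\<lambda>j. (cmod (a i j))\<^sup>2)" "summable (\<lambda>i. (\<Sum>j. (cmod (a i j))\<^sup>2) powr (p/2))"
      "\<forall>j. summable (\<lambda>i. (cmod (b i j))\<^sup>2)" "summable (\<lambda>j. (\<Sum>i. (cmod (b i j))\<^sup>2) powr (p/2))"
      using dec by (elim exE conjE) (rule that)
    have "matrix_in_schatten p (\<lambda>i j. complex_of_real (\<sigma> i j) * a i j + complex_of_real (\<sigma> i j) * b i j)"
      using p ab by (intro rows_plus_columns_in_schatten) (auto simp: norm_mult abs_\<sigma>)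
    then show "matrix_in_schatten p (\<lambda>i j. complex_of_real (\<sigma> i j) * lam i j)"
      using ab(1) by (simp add: distrib_left)
  qed
  moreover have "?almost" if all: ?all
    using eps_s
  proof eventually_elim
    case (elim w)
    have "matrix_in_schatten p (\<lambda>i j. complex_of_real (s i j w) * lam i j)"
      by (rule all[rule_format]) (rule sign)
    then show ?case
      using elim by simp
  qed
  ultimately show ?thesis
    by blast
qed

end
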